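(* Let $(\mathcal{N},\tau)$ be a noncommutative probability space, i.e. $\mathcal{N}$ is a finite von Neumann algebra and $\tau$ is a normal faithful tracial state on $\mathcal{N}$. Let $(\mathcal{N}_k)_{k\ge 0}$ be an increasing sequence (filtration) of von Neumann subalgebras of $\mathcal{N}$, and let $E_k:\mathcal{N}\to\mathcal{N}_k$ denote the ($\tau$-preserving) conditional expectation onto $\mathcal{N}_k$. Let $0=x_0,x_1,x_2,\ldots$ be a self-adjoint martingale in $(\mathcal{N},\tau)$ with respect to this filtration, i.e. each $x_n$ is a self-adjoint element of $\mathcal{N}_n$ and $E_{n}(x_{n+1})=x_n$ for all $n\ge 0$. Let $d_i=x_i-x_{i-1}$ for $i\ge1$, and define \[ s_n^2=\Big\|\sum_{i=1}^n E_{i-1}(d_i^2)\Big\|_\infty,\qquad u_n=[L(s_n^2)]^{1/2}, \] where $\|\cdot\|_\infty$ is the operator norm and $L(x)=\max\{1,\ln\ln x\}$ for $x>0$. Suppose $s_n^2\to\infty$ and that there is a sequence $(\alpha_n)$ of positive numbers with $\alpha_n\to0$ as $n\to\infty$ such that $\|d_n\|_\infty\le \alpha_n s_n/u_n$ for all $n$. Then \[ \limsup_{n\to\infty}\frac{x_n}{s_n u_n}\underset{a.u.}{\le}2, \] that is, for every $\varepsilon>0$ and every $\delta>0$ there exists a projection $e\in\mathcal{N}$ with $\tau(1-e)<\varepsilon$ such that \[ \limsup_{n\to\infty}\Big\|\frac{x_n}{s_n u_n}\,e\Big\|_\infty\le 2+\delta. \]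
   Context: For a sequence $(y_n)$ of ($\tau$-measurable) operators and a constant $K\ge0$, the notation $\limsup_{n\to\infty} y_n \underset{a.u.}{\le} K$ ("almost uniformly bounded by $K$") means: for any $\varepsilon>0$ and any $\delta>0$ there exists a projection $e$ with $\tau(1-e)<\varepsilon$ such that $\limsup_{n\to\infty}\|y_n e\|\le K+\delta$, where $\|\cdot\|$ is the operator norm. The conditional expectation $E_k$ satisfies $E_k(1)=1$ and $E_k(axb)=aE_k(x)b$ for $a,b\in\mathcal{N}_k$, $x\in\mathcal{N}$, and $\tau\circ E_k=\tau$. *)

theory Defs
  imports "HOL-Analysis.Analysis" "HOL-Library.Liminf_Limsup"
begin

text \<open>
  Model: a complex Hilbert space is represented as a real Hilbert space 'h
  (real_inner + complete_space) together with a complex structure J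
  (multiplication by the imaginary unit), i.e. a real-linear isometry with J o J = -1.
  The real inner product is the real part of the complex one; complex-linear bounded
  operators are the bounded real-linear operators commuting with J.
  Operator norm = norm on blinfun.
\<close>

type_synonym 'h op = "'h \<Rightarrow>\<^sub>L 'h"

definition complex_structure :: "'h::real_inner op \<Rightarrow> bool" where
  "complex_structure J \<longleftrightarrow> J o\<^sub>L J = - id_blinfun \<and> (\<forall>x y. inner (J x) (J y) = inner x y)"

definition cops :: "'h::real_inner op \<Rightarrow> 'h op set" where
  "cops J = {T. T o\<^sub>L J = J o\<^sub>L T}"

definition csmult :: "'h::real_inner op \<Rightarrow> complex \<Rightarrow> 'h op \<Rightarrow> 'h op" where
  "csmult J c T = Re c *\<^sub>R T + Im c *\<^sub>R (J o\<^sub>L T)"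

definition adj :: "'h::real_inner op \<Rightarrow> 'h op" where
  "adj T = (THE S :: 'h op. \<forall>x y. inner (T x) y = inner x (blinfun_apply S y))"

definition selfadj :: "'h::real_inner op \<Rightarrow> bool" where
  "selfadj T \<longleftrightarrow> adj T = T"

definition positive_op :: "'h::real_inner op \<Rightarrow> bool" where
  "positive_op T \<longleftrightarrow> selfadj T \<and> (\<forall>h. 0 \<le> inner (T h) h)"

definition op_le :: "'h::real_inner op \<Rightarrow> 'h op \<Rightarrow> bool" where
  "op_le S T \<longleftrightarrow> positive_op (T - S)"

definition projection :: "'h::real_inner op \<Rightarrow> bool" where
  "projection e \<longleftrightarrow> e o\<^sub>L e = e \<and> selfadj e"

definition commutant :: "'h::real_inner op \<Rightarrow> 'h op set \<Rightarrow> 'h op set" where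
  "commutant J S = {T \<in> cops J. \<forall>s\<in>S. T o\<^sub>L s = s o\<^sub>L T}"

text \<open>von Neumann algebra: self-adjoint set of operators equal to its double commutant
  (this forces it to be a unital *-subalgebra closed in the weak operator topology)\<close>
definition von_neumann_algebra :: "'h::real_inner op \<Rightarrow> 'h op set \<Rightarrow> bool" where
  "von_neumann_algebra J M \<longleftrightarrow> M \<subseteq> cops J \<and> (\<forall>T\<in>M. adj T \<in> M)
      \<and> commutant J (commutant J M) = M"

definition normal_faithful_tracial_state ::
  "'h::real_inner op \<Rightarrow> 'h op set \<Rightarrow> ('h op \<Rightarrow> complex) \<Rightarrow> bool" where
  "normal_faithful_tracial_state J M \<tau> \<longleftrightarrow>
     (\<forall>x\<in>M. \<forall>y\<in>M. \<tau> (x + y) = \<tau> x + \<tau> y) \<and>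
     (\<forall>c. \<forall>x\<in>M. \<tau> (csmult J c x) = c * \<tau> x) \<and>
     (\<forall>x\<in>M. positive_op x \<longrightarrow> Im (\<tau> x) = 0 \<and> 0 \<le> Re (\<tau> x)) \<and>
     \<tau> id_blinfun = 1 \<and>
     (\<forall>x\<in>M. \<forall>y\<in>M. \<tau> (x o\<^sub>L y) = \<tau> (y o\<^sub>L x)) \<and>
     (\<forall>x\<in>M. positive_op x \<longrightarrow> \<tau> x = 0 \<longrightarrow> x = 0) \<and>
     (\<forall>D x. D \<subseteq> M \<longrightarrow> D \<noteq> {} \<longrightarrow> (\<forall>d\<in>D. positive_op d) \<longrightarrow>
        (\<forall>a\<in>D. \<forall>b\<in>D. \<exists>c\<in>D. op_le a c \<and> op_le b c) \<longrightarrow>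
        x \<in> M \<longrightarrow> (\<forall>d\<in>D. op_le d x) \<longrightarrow>
        (\<forall>y\<in>M. selfadj y \<longrightarrow> (\<forall>d\<in>D. op_le d y) \<longrightarrow> op_le x y) \<longrightarrow>
        Re (\<tau> x) = (SUP d\<in>D. Re (\<tau> d)))"

text \<open>noncommutative probability space (M, tau): M a (necessarily finite) von Neumann
  algebra with a normal faithful tracial state\<close>
definition nc_prob_space :: "'h::real_inner op \<Rightarrow> 'h op set \<Rightarrow> ('h op \<Rightarrow> complex) \<Rightarrow> bool" where
  "nc_prob_space J M \<tau> \<longleftrightarrow> complex_structure J \<and> von_neumann_algebra J M
      \<and> normal_faithful_tracial_state J M \<tau>"

definition filtration :: "'h::real_inner op \<Rightarrow> 'h op set \<Rightarrow> (nat \<Rightarrow> 'h op set) \<Rightarrow> bool" where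
  "filtration J M Nk \<longleftrightarrow> (\<forall>k. von_neumann_algebra J (Nk k) \<and> Nk k \<subseteq> M) \<and> mono Nk"

text \<open>E is the tau-preserving conditional expectation of M onto Nsub
  (these properties determine it uniquely by faithfulness of tau)\<close>
definition cond_exp ::
  "'h::real_inner op set \<Rightarrow> ('h op \<Rightarrow> complex) \<Rightarrow> 'h op set \<Rightarrow> ('h op \<Rightarrow> 'h op) \<Rightarrow> bool" where
  "cond_exp M \<tau> Nsub E \<longleftrightarrow> (\<forall>x\<in>M. E x \<in> Nsub) \<and> E id_blinfun = id_blinfun \<and>
     (\<forall>a\<in>Nsub. \<forall>b\<in>Nsub. \<forall>x\<in>M. E (a o\<^sub>L x o\<^sub>L b) = a o\<^sub>L E x o\<^sub>L b) \<and>
     (\<forall>x\<in>M. \<tau> (E x) = \<tau> x)"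

definition LL :: "real \<Rightarrow> real" where
  "LL t = max 1 (ln (ln t))"

end

theory Submission
  imports Defs
begin

text \<open>
  Put \<open>n = 2 ^ k\<close> and approximate \<open>exp a\<close> by \<open>(1 + a / n) ^ n\<close>. Hoelder's inequality for words of length
  \<open>2 ^ k\<close> gives the Golden--Thompson inequality for the trace, and applying it to
  \<open>a = l x\<^sub>j - (2/3) l\<^sup>2 V\<^sub>j\<close> and \<open>b = l d - (2/3) l\<^sup>2 E\<^sub>j (d\<^sup>2)\<close> shows that
  \<open>tr (exp (l x\<^sub>j - (2/3) l\<^sup>2 V\<^sub>j))\<close> does not increase with \<open>j\<close>, so that
  \<open>tr (exp (l x\<^sub>n)) \<le> exp ((2/3) l\<^sup>2 s\<^sub>n\<^sup>2)\<close> as long as the increments are small compared to \<open>1 / l\<close>.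
  The time axis is cut into blocks on which \<open>s\<^sub>n\<^sup>2\<close> varies by a factor of at most \<open>9/8\<close>. Cuculescu's
  stopping construction, run through all blocks with the weight \<open>exp (l x\<^sub>N) + exp (- l x\<^sub>N)\<close> of the current
  block, yields one decreasing sequence of projections; its limit \<open>e\<close> controls all \<open>x\<^sub>n\<close> at once.
  The weight is convex in \<open>x\<^sub>N\<^sup>2\<close>, and its tangent at \<open>a\<^sup>2\<close>, together with \<open>x\<^sub>n\<^sup>2 \<le> E\<^sub>n (x\<^sub>N\<^sup>2)\<close>, turns the bound
  on the weight into a bound on \<open>x\<^sub>n e\<close>. Because of the constant \<open>2/3 < 1\<close> the trace of \<open>1 - e\<close> picks up only
  \<open>O(k powr (- 4/3))\<close> from the \<open>k\<close>-th block.
\<close>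

section \<open>Golden--Thompson inequality\<close>

text \<open>Exponentials of noncommuting sums do not factor, so the classical supermartingale is
  available only under the trace, and the trace inequality separates just two factors. Hence
  increments are peeled off one by one, with the compensator kept inside the exponent until the end,
  where only its norm enters. Nothing replaces the pathwise maximum: giving each \<open>x n\<close>
  its own projection would cost one trace term for every time in a block. When all times of a block
  share one terminal weight, the removed pieces are orthogonal and the block is paid for once. The
  projection acts on one side only, so the weight has to control the square of \<open>x n\<close>,
  not a compression; this is why it is even. In a block ending at variance \<open>y\<close>, the
  exponent \<open>(2/3) l^2 y - l a\<close> is minimal at \<open>l = 3 a / (4 y)\<close>, with value
  \<open>- (3/8) a^2 / y\<close>. The target \<open>a^2 = 4 (8/9) y L\<close>, with \<open>L\<close>
  the iterated logarithm at the lower end of the block, turns this into \<open>- (4/3) L\<close>;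
  any factor above 1 in place of 4/3 would give a summable series over the blocks.\<close>

text \<open>The class \<open>real_normed_algebra_1\<close> would require \<open>0 \<noteq> 1\<close>, which fails for operators on the zero space.\<close>

class unital_normed_algebra = real_normed_algebra + monoid_mult +
  assumes norm_one_le: "norm 1 \<le> 1"

section \<open>Powers in a normed algebra and their second-order expansion\<close>

lemma norm_power_le:
  fixes x :: "'a::unital_normed_algebra"
  shows "norm (x ^ n) \<le> norm x ^ n"
proof (induction n)
  case 0
  show ?case by (simp add: norm_one_le)
next
  case (Suc n)
  have "norm (x ^ Suc n) \<le> norm x * norm (x ^ n)"
    by (simp add: norm_mult_ineq)
  also have "\<dots> \<le> norm x * norm x ^ n"
    by (rule mult_left_mono [OF Suc]) simp
  finally show ?case by simp
qed

lemma norm_power_diff_le: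
  fixes x y :: "'a::unital_normed_algebra"
  assumes "norm x \<le> c" "norm y \<le> c"
  shows "norm (x ^ n - y ^ n) \<le> real n * c ^ (n - 1) * norm (x - y)"
proof (induction n)
  case 0
  show ?case by simp
next
  case (Suc n)
  have c0: "0 \<le> c" using assms(1) norm_ge_zero order_trans by blast
  have "x ^ Suc n - y ^ Suc n = x ^ n * (x - y) + (x ^ n - y ^ n) * y"
    by (simp add: power_Suc2 algebra_simps del: power_Suc)
  then have "norm (x ^ Suc n - y ^ Suc n) \<le> norm (x ^ n) * norm (x - y) + norm (x ^ n - y ^ n) * norm y"
    by (auto intro!: norm_triangle_le add_mono norm_mult_ineq)
  also have "norm (x ^ n) * norm (x - y) \<le> c ^ n * norm (x - y)"
    by (meson assms(1) mult_right_mono norm_ge_zero norm_power_le order_trans power_mono)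
  also have "norm (x ^ n - y ^ n) * norm y \<le> (real n * c ^ (n - 1) * norm (x - y)) * c"
    using Suc assms(2) c0 by (intro mult_mono) auto
  also have "\<dots> = real n * c ^ n * norm (x - y)"
    by (cases n) (auto simp: algebra_simps)
  finally show ?case by (simp add: algebra_simps)
qed

text \<open>The tail of the binomial expansion after the linear term, written as
  \<open>z * R * z\<close> with a factor \<open>z\<close> on either side. The trace can absorb this
  two-sided form later: the outer factors merge with the weight and only the norm of
  \<open>R\<close> matters. The recursion results from multiplying the expansion by
  \<open>1 + z\<close> on the right.\<close>

primrec binom_remainder :: "'a::unital_normed_algebra \<Rightarrow> nat \<Rightarrow> 'a" where
  "binom_remainder z 0 = 0"
| "binom_remainder z (Suc n) = real n *\<^sub>R 1 + binom_remainder z n + binom_remainder z n * z"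

lemma one_plus_power_expansion:
  "(1 + z) ^ n = 1 + real n *\<^sub>R z + z * binom_remainder z n * z"
proof (induction n)
  case (Suc n)
  have "(1 + z) ^ Suc n = (1 + real n *\<^sub>R z + z * binom_remainder z n * z) * (1 + z)"
    by (simp only: power_Suc2 Suc)
  then show ?case
    by (simp add: algebra_simps)
qed simp

text \<open>For \<open>z = b / n\<close> the factor \<open>n^2\<close> cancels the
  \<open>1 / n^2\<close> of the two outer factors, which leaves the Taylor constant
  \<open>exp (norm b) / 2\<close> uniformly in \<open>n\<close>.\<close>

lemma norm_binom_remainder:
  "norm (binom_remainder z n) \<le> (real n)\<^sup>2 / 2 * (1 + norm z) ^ n"
proof (induction n)
  case (Suc n)
  define R where "R = binom_remainder z n"
  have "norm (binom_remainder z (Suc n)) \<le> norm (real n *\<^sub>R (1::'a)) + norm R + norm (R * z)"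
    unfolding R_def by (simp add: norm_triangle_le norm_triangle_ineq add_mono)
  also have "\<dots> \<le> real n + norm R + norm R * norm z"
    using norm_one_le[where 'a='a] mult_left_mono[of "norm (1::'a)" 1 "real n"]
    by (intro add_mono) (auto simp: norm_mult_ineq)
  also have "\<dots> = real n + norm R * (1 + norm z)"
    by (simp add: algebra_simps)
  also have "\<dots> \<le> real n * (1 + norm z) ^ Suc n + ((real n)\<^sup>2 / 2 * (1 + norm z) ^ n) * (1 + norm z)"
    using Suc one_le_power[of "1 + norm z" "Suc n"]
      mult_left_mono[of 1 "(1 + norm z) ^ Suc n" "real n"]
    by (intro add_mono mult_right_mono) (auto simp: R_def)
  also have "\<dots> = ((real n)\<^sup>2 / 2 + real n) * (1 + norm z) ^ Suc n"
    by (simp add: algebra_simps)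
  also have "\<dots> \<le> (real (Suc n))\<^sup>2 / 2 * (1 + norm z) ^ Suc n"
    by (intro mult_right_mono) (auto simp: power2_eq_square algebra_simps)
  finally show ?case .
qed simp

text \<open>Halving a word by multiplying neighbours drives the induction for Hoelder's inequality.
  A last unpaired letter is dropped, so the product is preserved for even length only.\<close>

fun pair_products :: "'a::times list \<Rightarrow> 'a list" where
  "pair_products (x # y # zs) = x * y # pair_products zs"
| "pair_products _ = []"

lemma length_pair_products: "length (pair_products xs) = length xs div 2"
  by (induction xs rule: pair_products.induct) auto

lemma prod_list_pair_products:
  fixes xs :: "'a::monoid_mult list"
  shows "even (length xs) \<Longrightarrow> prod_list (pair_products xs) = prod_list xs"
  by (induction xs rule: pair_products.induct) (auto simp: mult.assoc)

lemma prod_list_map_pair_products_le: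
  fixes f g :: "'a::monoid_mult \<Rightarrow> real"
  assumes "even (length xs)" "set xs \<subseteq> S"
    and "\<And>x y. x \<in> S \<Longrightarrow> y \<in> S \<Longrightarrow> (f (x * y))\<^sup>2 \<le> g x * g y"
    and "\<And>x. x \<in> S \<Longrightarrow> 0 \<le> g x"
  shows "(prod_list (map f (pair_products xs)))\<^sup>2 \<le> prod_list (map g xs)"
  using assms(1,2)
proof (induction xs rule: pair_products.induct)
  case (1 x y zs)
  have "(f (x * y))\<^sup>2 * (prod_list (map f (pair_products zs)))\<^sup>2 \<le> (g x * g y) * prod_list (map g zs)"
    using 1 assms(3)[of x y] assms(4) by (intro mult_mono) auto
  then show ?case by (simp add: power_mult_distrib mult.assoc)
qed auto

lemma nonneg_quadratic_form:
  fixes p q r :: real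
  assumes quad: "\<And>s t. 0 \<le> s\<^sup>2 * p + 2 * s * t * q + t\<^sup>2 * r"
  shows "q\<^sup>2 \<le> p * r"
proof (cases "r = 0")
  case True
  have "q = 0"
  proof (rule ccontr)
    assume "q \<noteq> 0"
    \<comment> \<open>With \<open>r = 0\<close> the form at this point equals
      \<open>p - (p + 1) = -1\<close>.\<close>
    then show False
      using quad[of 1 "- (p + 1) / (2 * q)"] True by (simp add: field_simps)
  qed
  then show ?thesis using True by simp
next
  case False
  then have "r > 0" using quad[of 0 1] by simp
  \<comment> \<open>The point \<open>(r, - q)\<close> is proportional to the minimizer
    \<open>(1, - q / r)\<close> of the form.\<close>
  have "0 \<le> r * (r * p - q\<^sup>2)"
    using quad[of r "- q"] by (simp add: power2_eq_square algebra_simps)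
  then show ?thesis using \<open>r > 0\<close> by (simp add: zero_le_mult_iff mult.commute)
qed

text \<open>Collects what the exponential estimate uses of a tracial state, with no Hilbert space in
  sight. \<open>tr\<close> stands for the real part of the state, so real scalars suffice.
  \<open>tr_mult_bound\<close> is the trace form of \<open>star x * x \<le> norm x ^ 2\<close> and
  replaces the operator order, which is absent here.\<close>

locale tracial_star_algebra =
  fixes A :: "'a::unital_normed_algebra set"
    and star :: "'a \<Rightarrow> 'a" and tr :: "'a \<Rightarrow> real"
  assumes one_mem: "1 \<in> A"
    and add_mem: "x \<in> A \<Longrightarrow> y \<in> A \<Longrightarrow> x + y \<in> A"
    and mult_mem: "x \<in> A \<Longrightarrow> y \<in> A \<Longrightarrow> x * y \<in> A"
    and scale_mem: "x \<in> A \<Longrightarrow> c *\<^sub>R x \<in> A"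
    and star_mem: "x \<in> A \<Longrightarrow> star x \<in> A"
    and star_add: "star (x + y) = star x + star y"
    and star_scale: "star (c *\<^sub>R x) = c *\<^sub>R star x"
    and star_mult: "star (x * y) = star y * star x"
    and star_star: "star (star x) = x"
    and tr_add: "x \<in> A \<Longrightarrow> y \<in> A \<Longrightarrow> tr (x + y) = tr x + tr y"
    and tr_scale: "x \<in> A \<Longrightarrow> tr (c *\<^sub>R x) = c * tr x"
    and tr_commute: "x \<in> A \<Longrightarrow> y \<in> A \<Longrightarrow> tr (x * y) = tr (y * x)"
    and tr_star: "x \<in> A \<Longrightarrow> tr (star x) = tr x"
    and tr_one: "tr 1 = 1"
    and tr_pos: "x \<in> A \<Longrightarrow> 0 \<le> tr (star x * x)"
    and tr_mult_bound: "x \<in> A \<Longrightarrow> y \<in> A \<Longrightarrow> tr (star (x * y) * (x * y)) \<le> (norm x)\<^sup>2 * tr (star y * y)"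
begin

lemma star_one: "star 1 = 1"
  by (metis mult.right_neutral mult.left_neutral star_mult star_star)

lemma star_minus: "star (- x) = - star x"
  using star_scale[of "-1" x] by simp

lemma star_diff: "star (x - y) = star x - star y"
  using star_add[of x "- y"] by (simp add: star_minus)

lemma star_power: "star (x ^ n) = star x ^ n"
  by (induction n) (simp_all add: star_one star_mult power_commutes)

lemma minus_mem: "x \<in> A \<Longrightarrow> - x \<in> A"
  using scale_mem[of x "-1"] by simp

lemma diff_mem: "x \<in> A \<Longrightarrow> y \<in> A \<Longrightarrow> x - y \<in> A"
  using add_mem[of x "- y"] minus_mem by simp

lemma zero_mem: "0 \<in> A"
  using scale_mem[OF one_mem, of 0] by simp

lemma power_mem: "x \<in> A \<Longrightarrow> x ^ n \<in> A"
  by (induction n) (auto simp: one_mem mult_mem)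

lemma tr_diff: "x \<in> A \<Longrightarrow> y \<in> A \<Longrightarrow> tr (x - y) = tr x - tr y"
  using tr_add[of x "- y"] tr_scale[of y "-1"] minus_mem by simp

lemmas mem_intros = one_mem add_mem mult_mem scale_mem star_mem minus_mem diff_mem zero_mem power_mem

lemma tr_Cauchy_Schwarz:
  assumes x: "x \<in> A" and y: "y \<in> A"
  shows "(tr (x * y))\<^sup>2 \<le> tr (star x * x) * tr (star y * y)"
proof -
  define p q r where "p = tr (x * star x)" and "q = tr (x * y)" and "r = tr (star y * y)"
  have "tr (star y * star x) = q"
    using tr_star[of "x * y"] x y by (simp add: q_def star_mult mem_intros)
  moreover have "0 \<le> tr (star (s *\<^sub>R star x + t *\<^sub>R y) * (s *\<^sub>R star x + t *\<^sub>R y))" for s t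
    by (intro tr_pos mem_intros x y)
  ultimately have quad: "0 \<le> s\<^sup>2 * p + 2 * s * t * q + t\<^sup>2 * r" for s t
    using x y
    by (simp add: star_add star_scale star_star algebra_simps tr_add tr_scale mem_intros
        p_def q_def r_def power2_eq_square)
  have p_eq: "p = tr (star x * x)"
    using tr_commute x by (simp add: p_def star_mem)
  have "q\<^sup>2 \<le> p * r" by (rule nonneg_quadratic_form[OF quad])
  then show ?thesis by (simp add: p_eq q_def r_def)
qed

text \<open>The estimate \<open>star c * R * c \<le> norm R * star c * c\<close> under the trace,
  obtained from Cauchy--Schwarz for \<open>star c\<close> and \<open>R * c\<close>; in this form no
  self-adjointness of \<open>R\<close> has to be tracked.\<close>

lemma tr_sandwich_bound:
  assumes R: "R \<in> A" and c: "c \<in> A"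
  shows "tr (star c * R * c) \<le> norm R * tr (star c * c)"
proof -
  have "(tr (star c * (R * c)))\<^sup>2 \<le> tr (c * star c) * tr (star (R * c) * (R * c))"
    using tr_Cauchy_Schwarz[of "star c" "R * c"] R c by (simp add: star_star mem_intros)
  also have "\<dots> \<le> tr (star c * c) * ((norm R)\<^sup>2 * tr (star c * c))"
    using tr_mult_bound R c tr_commute[of c "star c"] tr_pos[OF c] star_mem
    by (intro mult_mono) (auto intro: tr_pos mem_intros)
  also have "\<dots> = (norm R * tr (star c * c))\<^sup>2"
    by (simp add: power2_eq_square)
  finally have "tr (star c * (R * c)) \<le> norm R * tr (star c * c)"
    by (rule power2_le_imp_le) (simp add: tr_pos[OF c])
  then show ?thesis by (simp add: mult.assoc)
qed

lemma abs_tr_le_norm: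
  assumes "x \<in> A"
  shows "\<bar>tr x\<bar> \<le> norm x"
proof -
  have *: "tr y \<le> norm y" if "y \<in> A" for y
    using tr_sandwich_bound[OF that one_mem] by (simp add: star_one tr_one)
  show ?thesis
    using *[OF assms] *[OF minus_mem[OF assms]] tr_scale[OF assms, of "-1"] by simp
qed

lemma tr_mult_power_commute:
  assumes "a \<in> A" "b \<in> A"
  shows "tr ((a * b) ^ m) = tr ((b * a) ^ m)"
proof (cases m)
  case (Suc n)
  have "(a * b) ^ Suc n = a * (b * a) ^ n * b"
    by (induction n) (simp_all add: mult.assoc)
  moreover have "tr (a * (b * a) ^ n * b) = tr (b * (a * (b * a) ^ n))"
    using assms by (intro tr_commute mem_intros)
  ultimately show ?thesis using Suc by (simp add: mult.assoc)
qed simp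

lemma tr_abs_power_nonneg:
  assumes "x \<in> A"
  shows "0 \<le> tr ((star x * x) ^ m)"
proof -
  define c where "c = (star x * x) ^ (m div 2)"
  have c: "c \<in> A" "star c = c"
    using assms by (simp_all add: c_def mem_intros star_power star_mult star_star)
  show ?thesis
  proof (cases "even m")
    case True
    then have "(star x * x) ^ m = star c * c"
      by (metis c(2) c_def dvd_mult_div_cancel mult_2 power_add)
    then show ?thesis using tr_pos[OF c(1)] by simp
  next
    case False
    then have "(star x * x) ^ m = (star x * x) ^ (m div 2 + Suc (m div 2))"
      by (metis add_Suc_right mult_2 odd_two_times_div_two_succ Suc_eq_plus1)
    also have "\<dots> = c * (star x * x * c)"
      by (simp only: c_def power_add power_Suc)
    also have "\<dots> = star (x * c) * (x * c)"
      by (simp add: star_mult c mult.assoc)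
    finally show ?thesis using tr_pos[of "x * c"] assms c by (simp add: mem_intros)
  qed
qed

text \<open>The factor \<open>tr ((star x * x) ^ (2 ^ k))\<close> is the \<open>p\<close>-th power
  of the Schatten \<open>p\<close>-norm of \<open>x\<close> for \<open>p = 2 ^ Suc k\<close>. All
  exponents are equal, so repeated Cauchy--Schwarz is enough. The induction hypothesis is used
  twice: for the word of products of neighbours and, in \<open>key\<close>, for an alternating word
  in \<open>P\<close> and \<open>Q\<close> that bounds the norm of a product
  \<open>x * y\<close>.\<close>

lemma tr_Hoelder:
  assumes "length xs = 2 ^ Suc k" "set xs \<subseteq> A"
  shows "\<bar>tr (prod_list xs)\<bar> ^ (2 ^ Suc k) \<le> (\<Prod>x\<leftarrow>xs. tr ((star x * x) ^ (2 ^ k)))"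
  using assms
proof (induction k arbitrary: xs)
  case 0
  then obtain x y where "xs = [x, y]"
    by (metis One_nat_def Suc_1 length_0_conv length_Suc_conv power_0 power_one_right)
  then show ?case using tr_Cauchy_Schwarz[of x y] 0 by simp
next
  case (Suc k)
  define m :: nat where "m = 2 ^ k"
  have m0: "m > 0" by (simp add: m_def)
  let ?f = "\<lambda>y. tr ((star y * y) ^ m)" and ?g = "\<lambda>x. tr ((star x * x) ^ (2 * m))"
  have key: "(?f (x * y))\<^sup>2 \<le> ?g x * ?g y" if x: "x \<in> A" and y: "y \<in> A" for x y
  proof -
    \<comment> \<open>Powers of \<open>star y * P * y\<close> and of \<open>P * Q\<close> have the
      same trace by cyclicity, so the modulus of a product becomes an alternating word in two
      self-adjoint letters.\<close>
    define P Q where "P = star x * x" and "Q = y * star y"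
    have PQ: "P \<in> A" "Q \<in> A" "star P = P" "star Q = Q"
      using x y by (auto simp: P_def Q_def mem_intros star_mult star_star)
    have f_eq: "?f (x * y) = tr ((P * Q) ^ m)"
      using tr_mult_power_commute[of "star y" "P * y" m] x y PQ
      by (simp add: P_def Q_def star_mult mult.assoc mem_intros)
    let ?w = "concat (replicate m [P, Q])"
    have "prod_list ?w = (P * Q) ^ m"
      by (induction m) (auto simp: mult.assoc)
    moreover have "length ?w = 2 ^ Suc k"
      by (simp add: m_def length_concat sum_list_replicate)
    moreover have "set ?w \<subseteq> A" using PQ by (induction m) auto
    ultimately have "\<bar>tr ((P * Q) ^ m)\<bar> ^ (2 * m) \<le> (\<Prod>x\<leftarrow>?w. ?f x)"
      using Suc.IH[of ?w] by (simp add: m_def)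
    also have "(\<Prod>x\<leftarrow>concat (replicate n [P, Q]). h x) = (h P * h Q) ^ n" for n and h :: "'a \<Rightarrow> real"
      by (induction n) auto
    finally have "(\<bar>tr ((P * Q) ^ m)\<bar>\<^sup>2) ^ m \<le> (?f P * ?f Q) ^ m"
      by (simp add: power_mult)
    moreover have "0 \<le> ?f P * ?f Q"
      using PQ(1,2) tr_abs_power_nonneg by (intro mult_nonneg_nonneg)
    ultimately have "(tr ((P * Q) ^ m))\<^sup>2 \<le> ?f P * ?f Q"
      using m0 power_le_imp_le_base[of "\<bar>tr ((P * Q) ^ m)\<bar>\<^sup>2" "m - 1" "?f P * ?f Q"] by simp
    moreover have "?f P = ?g x"
      using PQ by (simp add: P_def power_mult power2_eq_square)
    moreover have "?f Q = ?g y"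
      using PQ tr_mult_power_commute[of y "star y" "2 * m"] y
      by (simp add: Q_def power_mult power2_eq_square mem_intros)
    ultimately show ?thesis by (simp add: f_eq)
  qed
  let ?ys = "pair_products xs"
  have ev: "even (length xs)" using Suc.prems by simp
  have sub: "set ?ys \<subseteq> A"
    using Suc.prems(2) by (induction xs rule: pair_products.induct) (auto simp: mult_mem)
  have "\<bar>tr (prod_list ?ys)\<bar> ^ (2 ^ Suc k) \<le> (\<Prod>y\<leftarrow>?ys. ?f y)"
    using Suc.IH[of ?ys] sub Suc.prems by (simp add: length_pair_products m_def)
  then have "(\<bar>tr (prod_list ?ys)\<bar> ^ (2 ^ Suc k))\<^sup>2 \<le> (\<Prod>y\<leftarrow>?ys. ?f y)\<^sup>2"
    by (intro power_mono) auto
  also have "\<dots> \<le> (\<Prod>x\<leftarrow>xs. ?g x)"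
    using Suc.prems(2) ev key tr_abs_power_nonneg
    by (intro prod_list_map_pair_products_le[where S = A]) auto
  finally show ?case
    using ev by (simp add: prod_list_pair_products m_def power_mult[symmetric] mult.commute)
qed

text \<open>Hoelder's inequality for a constant word, after extracting roots.\<close>

lemma tr_power_le_tr_abs_power:
  assumes "x \<in> A"
  shows "tr (x ^ (2 ^ Suc k)) \<le> tr ((star x * x) ^ (2 ^ k))"
proof -
  have "\<bar>tr (x ^ (2 ^ Suc k))\<bar> ^ (2 ^ Suc k) \<le> tr ((star x * x) ^ (2 ^ k)) ^ (2 ^ Suc k)"
    using tr_Hoelder[of "replicate (2 ^ Suc k) x" k] assms
    by (simp add: prod_list_replicate set_replicate_conv_if)
  then have "\<bar>tr (x ^ (2 ^ Suc k))\<bar> \<le> tr ((star x * x) ^ (2 ^ k))"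
    using power_le_imp_le_base[of "\<bar>tr (x ^ (2 ^ Suc k))\<bar>" "2 ^ Suc k - 1"]
      tr_abs_power_nonneg[OF assms, of "2 ^ k"] by simp
  then show ?thesis by simp
qed

text \<open>Passing to \<open>star (a * b) * (a * b) = b * a * a * b\<close> halves the power,
  cyclicity regroups the letters to \<open>(a * a) * (b * b)\<close>, and the induction hypothesis
  applies to the squares. The argument rests on self-adjointness alone, so it covers
  \<open>1 + a / n\<close> for every self-adjoint \<open>a\<close>.\<close>

lemma Golden_Thompson:
  assumes "a \<in> A" "b \<in> A" "star a = a" "star b = b"
  shows "tr ((a * b) ^ (2 ^ k)) \<le> tr (a ^ (2 ^ k) * b ^ (2 ^ k))"
  using assms
proof (induction k arbitrary: a b)
  case (Suc k)
  have "tr ((a * b) ^ (2 ^ Suc k)) \<le> tr ((star (a * b) * (a * b)) ^ (2 ^ k))"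
    using Suc.prems by (intro tr_power_le_tr_abs_power mem_intros)
  also have "\<dots> = tr ((b * (a * a * b)) ^ (2 ^ k))"
    using Suc.prems by (simp add: star_mult mult.assoc)
  also have "\<dots> = tr (((a * a) * (b * b)) ^ (2 ^ k))"
    using tr_mult_power_commute[of b "a * a * b" "2 ^ k"] Suc.prems
    by (simp add: mem_intros mult.assoc)
  also have "\<dots> \<le> tr ((a * a) ^ (2 ^ k) * (b * b) ^ (2 ^ k))"
    using Suc.prems by (intro Suc.IH mem_intros) (auto simp: star_mult)
  finally show ?case by (simp add: power_mult power2_eq_square)
qed simp

end

section \<open>Exponential bound for martingales\<close>

definition euler_power :: "nat \<Rightarrow> 'a::unital_normed_algebra \<Rightarrow> 'a" where
  "euler_power n a = (1 + (1 / real n) *\<^sub>R a) ^ n"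

lemma norm_one_plus_le: "norm (1 + z) \<le> 1 + norm z" for z :: "'a::unital_normed_algebra"
  using norm_triangle_ineq[of 1 z] norm_one_le[where 'a = 'a] by linarith

lemma norm_euler_power_le:
  assumes "n > 0"
  shows "norm (euler_power n a) \<le> exp (norm a)"
proof -
  have "norm (euler_power n a) \<le> norm (1 + (1 / real n) *\<^sub>R a) ^ n"
    unfolding euler_power_def by (rule norm_power_le)
  also have "\<dots> \<le> (1 + norm a / real n) ^ n"
    using norm_one_plus_le[of "(1 / real n) *\<^sub>R a"] by (intro power_mono) auto
  also have "\<dots> \<le> exp (norm a)"
    using assms exp_ge_one_plus_x_over_n_power_n[of n "norm a"] norm_ge_zero[of a] by linarith
  finally show ?thesis .
qed

text \<open>The product of the two linear factors differs from \<open>1 + (a + b) / n\<close> by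
  exactly \<open>a * b / n^2\<close>, and taking \<open>n\<close>-th powers multiplies such an error
  by at most \<open>n\<close> times a bounded factor.\<close>

lemma euler_power_add_approx:
  assumes "n > 0"
  shows "norm (((1 + (1 / real n) *\<^sub>R a) * (1 + (1 / real n) *\<^sub>R b)) ^ n - euler_power n (a + b))
    \<le> exp (norm a + norm b) * (norm a * norm b) / real n"
proof -
  define h where "h = 1 / real n"
  have h: "h > 0" using assms by (simp add: h_def)
  define c where "c = (1 + h * norm a) * (1 + h * norm b)"
  let ?X = "(1 + h *\<^sub>R a) * (1 + h *\<^sub>R b)" and ?Y = "1 + h *\<^sub>R (a + b)"
  have X: "norm ?X \<le> c"
    unfolding c_def using h norm_one_plus_le[of "h *\<^sub>R a"] norm_one_plus_le[of "h *\<^sub>R b"]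
    by (intro order_trans[OF norm_mult_ineq] mult_mono) auto
  have "norm ?Y \<le> 1 + h * norm (a + b)"
    using norm_one_plus_le[of "h *\<^sub>R (a + b)"] h by simp
  also have "\<dots> \<le> 1 + h * (norm a + norm b)"
    using h by (intro add_left_mono mult_left_mono norm_triangle_ineq) simp
  also have "\<dots> \<le> c" using h by (simp add: c_def algebra_simps)
  finally have Y: "norm ?Y \<le> c" .
  have c1: "1 \<le> c" unfolding c_def using h by (simp add: algebra_simps)
  have "c ^ (n - 1) \<le> c ^ n" using c1 by (intro power_increasing) auto
  also have "\<dots> = (1 + norm a / real n) ^ n * (1 + norm b / real n) ^ n"
    by (simp add: c_def h_def power_mult_distrib)
  also have "\<dots> \<le> exp (norm a) * exp (norm b)"
    using assms exp_ge_one_plus_x_over_n_power_n[of n "norm a"] norm_ge_zero[of a]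
      exp_ge_one_plus_x_over_n_power_n[of n "norm b"] norm_ge_zero[of b]
    by (intro mult_mono) (auto intro: order_trans)
  finally have c_exp: "c ^ (n - 1) \<le> exp (norm a + norm b)" by (simp add: exp_add)
  have "?X - ?Y = (h * h) *\<^sub>R (a * b)" by (simp add: algebra_simps)
  then have XY: "norm (?X - ?Y) \<le> h * h * (norm a * norm b)"
    using h norm_mult_ineq[of a b] by (simp add: mult_left_mono)
  have "norm (?X ^ n - ?Y ^ n) \<le> real n * c ^ (n - 1) * norm (?X - ?Y)"
    by (rule norm_power_diff_le[OF X Y])
  also have "\<dots> \<le> real n * exp (norm a + norm b) * (h * h * (norm a * norm b))"
    using c_exp XY c1 by (intro mult_mono) auto
  also have "\<dots> = exp (norm a + norm b) * (norm a * norm b) / real n"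
    using assms by (simp add: h_def field_simps)
  finally show ?thesis by (simp add: euler_power_def h_def)
qed

text \<open>Plays the role of one algebra of the filtration. Closure under \<open>star\<close> is
  left out: the self-adjointness of the elements that occur is recorded separately.\<close>

definition unital_subalgebra :: "'a::unital_normed_algebra set \<Rightarrow> bool" where
  "unital_subalgebra B \<longleftrightarrow> 1 \<in> B \<and> (\<forall>x\<in>B. \<forall>y\<in>B. x + y \<in> B \<and> x * y \<in> B) \<and> (\<forall>c. \<forall>x\<in>B. c *\<^sub>R x \<in> B)"

lemma unital_subalgebraD:
  assumes "unital_subalgebra B"
  shows "1 \<in> B" "0 \<in> B" "x \<in> B \<Longrightarrow> y \<in> B \<Longrightarrow> x + y \<in> B" "x \<in> B \<Longrightarrow> y \<in> B \<Longrightarrow> x * y \<in> B"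
    "x \<in> B \<Longrightarrow> c *\<^sub>R x \<in> B" "x \<in> B \<Longrightarrow> y \<in> B \<Longrightarrow> x - y \<in> B" "x \<in> B \<Longrightarrow> x ^ n \<in> B"
proof -
  show *: "1 \<in> B" "x \<in> B \<Longrightarrow> y \<in> B \<Longrightarrow> x + y \<in> B" "x \<in> B \<Longrightarrow> y \<in> B \<Longrightarrow> x * y \<in> B"
    "x \<in> B \<Longrightarrow> c *\<^sub>R x \<in> B" for x y c
    using assms by (auto simp: unital_subalgebra_def)
  show "0 \<in> B" using *(4)[OF *(1), of 0] by simp
  show "x \<in> B \<Longrightarrow> y \<in> B \<Longrightarrow> x - y \<in> B"
    using *(2)[of x "-1 *\<^sub>R y"] *(4)[of y "-1"] by simp
  show "x \<in> B \<Longrightarrow> x ^ n \<in> B" by (induction n) (auto simp: *)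
qed

lemma unital_subalgebra_sum:
  assumes "unital_subalgebra B" "\<And>i. i \<in> I \<Longrightarrow> f i \<in> B"
  shows "sum f I \<in> B"
  using assms(2)
  by (induction I rule: infinite_finite_induct) (auto intro: unital_subalgebraD[OF assms(1)])

context tracial_star_algebra
begin

lemma unital_subalgebra_carrier: "unital_subalgebra A"
  by (simp add: unital_subalgebra_def mem_intros)

lemma euler_power_mem: "a \<in> A \<Longrightarrow> euler_power n a \<in> A"
  by (simp add: euler_power_def mem_intros)

lemma star_sum: "star (sum f I) = (\<Sum>i\<in>I. star (f i))"
proof -
  have "star 0 = 0" using star_scale[of 0 0] by simp
  then show ?thesis
    by (induction I rule: infinite_finite_induct) (auto simp: star_add)
qed

lemma Golden_Thompson_euler_power:
  assumes a: "a \<in> A" "star a = a" and b: "b \<in> A" "star b = b"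
  shows "tr (euler_power (2 ^ k) (a + b)) \<le> tr (euler_power (2 ^ k) a * euler_power (2 ^ k) b)
    + exp (norm a + norm b) * (norm a * norm b) / 2 ^ k"
proof -
  let ?n = "2 ^ k :: nat"
  let ?a = "1 + (1 / real ?n) *\<^sub>R a" and ?b = "1 + (1 / real ?n) *\<^sub>R b"
  let ?P = "(?a * ?b) ^ ?n"
  have mem: "?P \<in> A" "euler_power ?n (a + b) \<in> A"
    using a b by (auto simp: mem_intros euler_power_mem)
  have "\<bar>tr (?P - euler_power ?n (a + b))\<bar> \<le> norm (?P - euler_power ?n (a + b))"
    using mem by (intro abs_tr_le_norm diff_mem)
  also have "\<dots> \<le> exp (norm a + norm b) * (norm a * norm b) / real ?n"
    by (rule euler_power_add_approx) simp
  finally have "tr (euler_power ?n (a + b)) \<le> tr ?P + exp (norm a + norm b) * (norm a * norm b) / 2 ^ k"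
    using mem by (simp add: tr_diff abs_le_iff)
  moreover have "tr ?P \<le> tr (?a ^ ?n * ?b ^ ?n)"
    using a b by (intro Golden_Thompson mem_intros) (auto simp: star_add star_one star_scale)
  ultimately show ?thesis by (simp add: euler_power_def)
qed

text \<open>In operator terms \<open>v \<le> norm d ^ 2\<close>, hence
  \<open>v * v \<le> norm d ^ 2 * v\<close>. Without an order the same follows from Cauchy--Schwarz:
  \<open>Q * Q * v\<close> lies in \<open>B\<close>, so one factor \<open>v\<close> in
  \<open>w\<close> may be exchanged for \<open>d * d\<close>, which bounds \<open>w^2\<close> by
  \<open>w\<close> times the desired bound.\<close>

lemma tr_variance_square_le:
  assumes B: "unital_subalgebra B" "B \<subseteq> A"
    and Q: "Q \<in> B" "star Q = Q" and d: "d \<in> A" "star d = d" and v: "v \<in> B" "star v = v"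
    and var: "\<And>y. y \<in> B \<Longrightarrow> tr (y * (d * d)) = tr (y * v)"
  shows "tr (Q * Q * (v * v)) \<le> (norm d)\<^sup>2 * tr (Q * Q * v)" and "0 \<le> tr (Q * Q * v)"
proof -
  note Bi = unital_subalgebraD[OF B(1)]
  have mA: "Q \<in> A" "v \<in> A" using B Q v by auto
  define p w where "p = tr (Q * Q * v)" and "w = tr (Q * Q * (v * v))"
  have "p = tr (Q * (Q * (d * d)))"
    using var[of "Q * Q"] Q by (simp add: p_def Bi mult.assoc)
  also have "\<dots> = tr (star (d * Q) * (d * Q))"
    using tr_commute[of Q "Q * (d * d)"] mA d Q by (simp add: mem_intros star_mult mult.assoc)
  finally have p: "p = tr (star (d * Q) * (d * Q))" .
  then show "0 \<le> tr (Q * Q * v)" using tr_pos[of "d * Q"] mA d by (simp add: p_def mem_intros)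
  have w': "w = tr (star (Q * v) * (Q * v))"
    using tr_commute[of "v" "Q * Q * v"] mA d Q v
    by (simp add: w_def mem_intros star_mult mult.assoc)
  then have w0: "0 \<le> w" using tr_pos[of "Q * v"] mA by (simp add: mem_intros)
  have "w = tr (Q * Q * v * (d * d))"
    using var[of "Q * Q * v"] Q v by (simp add: w_def Bi mult.assoc)
  also have "\<dots> = tr ((Q * v) * (d * (d * Q)))"
    using tr_commute[of Q "Q * v * (d * d)"] mA d by (simp add: mem_intros mult.assoc)
  finally have "w\<^sup>2 \<le> w * tr (star (d * (d * Q)) * (d * (d * Q)))"
    using tr_Cauchy_Schwarz[of "Q * v" "d * (d * Q)"] mA d w' by (simp add: mem_intros)
  also have "\<dots> \<le> w * ((norm d)\<^sup>2 * p)"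
    unfolding p using w0 mA d by (intro mult_left_mono tr_mult_bound mem_intros)
  finally have "w * w \<le> w * ((norm d)\<^sup>2 * p)" by (simp add: power2_eq_square)
  moreover have "0 \<le> (norm d)\<^sup>2 * p" using p tr_pos[of "d * Q"] mA d by (simp add: mem_intros)
  ultimately have "w \<le> (norm d)\<^sup>2 * p" using w0
    by (cases "w = 0") auto
  then show "tr (Q * Q * (v * v)) \<le> (norm d)\<^sup>2 * tr (Q * Q * v)" by (simp add: p_def w_def)
qed

lemma binom_remainder_mem: "z \<in> A \<Longrightarrow> binom_remainder z n \<in> A"
  by (induction n) (auto simp: mem_intros)

text \<open>Second-order Taylor expansion under the trace. The weight is a square
  \<open>Q * Q\<close>, so cyclicity places one \<open>Q\<close> at each end and the remainder
  becomes \<open>star (b * Q) * R * (b * Q)\<close>, ready for the sandwich bound.\<close>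

lemma tr_mult_euler_power_le:
  assumes Q: "Q \<in> A" "star Q = Q" and b: "b \<in> A" "star b = b" and n: "n > 0"
  shows "tr (Q * Q * euler_power n b) \<le> tr (Q * Q) + tr (Q * Q * b) + exp (norm b) / 2 * tr (Q * Q * (b * b))"
proof -
  define z where "z = (1 / real n) *\<^sub>R b"
  define R where "R = binom_remainder z n"
  have R: "R \<in> A" using b by (simp add: R_def z_def binom_remainder_mem mem_intros)
  have "norm R \<le> (real n)\<^sup>2 / 2 * (1 + norm z) ^ n"
    unfolding R_def by (rule norm_binom_remainder)
  also have "\<dots> \<le> (real n)\<^sup>2 / 2 * exp (norm b)"
    using n exp_ge_one_plus_x_over_n_power_n[of n "norm b"] norm_ge_zero[of b]
    by (intro mult_left_mono) (auto simp: z_def intro: order_trans)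
  finally have nR: "norm R / (real n)\<^sup>2 \<le> exp (norm b) / 2"
    using n by (simp add: field_simps)
  have "euler_power n b = 1 + b + (1 / (real n)\<^sup>2) *\<^sub>R (b * R * b)"
    using one_plus_power_expansion[of z n] n
    by (simp add: euler_power_def z_def R_def power2_eq_square)
  then have "tr (Q * Q * euler_power n b) = tr (Q * Q) + tr (Q * Q * b) + 1 / (real n)\<^sup>2 * tr (Q * (Q * b * R * b))"
    using Q b R by (simp add: distrib_left tr_add tr_scale mem_intros mult.assoc)
  also have "tr (Q * (Q * b * R * b)) = tr (star (b * Q) * R * (b * Q))"
    using tr_commute[of Q "Q * b * R * b"] Q b R by (simp add: mem_intros star_mult mult.assoc)
  also have "1 / (real n)\<^sup>2 * \<dots> \<le> 1 / (real n)\<^sup>2 * (norm R * tr (star (b * Q) * (b * Q)))"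
    using Q b R by (intro mult_left_mono tr_sandwich_bound mem_intros) auto
  also have "\<dots> = norm R / (real n)\<^sup>2 * tr (star (b * Q) * (b * Q))" by simp
  also have "\<dots> \<le> exp (norm b) / 2 * tr (star (b * Q) * (b * Q))"
    using Q b by (intro mult_right_mono nR tr_pos mem_intros)
  also have "tr (star (b * Q) * (b * Q)) = tr (Q * Q * (b * b))"
    using tr_commute[of Q "Q * (b * b)"] Q b by (simp add: mem_intros star_mult mult.assoc)
  finally show ?thesis by simp
qed

text \<open>With \<open>p = tr (Q * Q * v)\<close>, the linear term contributes
  \<open>- (2/3) l^2 p\<close> and the quadratic one at most
  \<open>(57/100) (101/100) l^2 p\<close>, which is smaller. The true second-order constant is 1/2;
  the gap up to 2/3 pays for the exponential in the remainder and for the square of the compensator,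
  both kept small by \<open>\<bar>l\<bar> * norm d \<le> 1 / 10\<close>.\<close>

lemma tr_euler_power_increment_le:
  assumes B: "unital_subalgebra B" "B \<subseteq> A"
    and Q: "Q \<in> B" "star Q = Q" and d: "d \<in> A" "star d = d" and v: "v \<in> B" "star v = v"
    and orth: "\<And>y. y \<in> B \<Longrightarrow> tr (y * d) = 0"
    and var: "\<And>y. y \<in> B \<Longrightarrow> tr (y * (d * d)) = tr (y * v)"
    and v_le: "norm v \<le> (norm d)\<^sup>2" and small: "\<bar>l\<bar> * norm d \<le> 1 / 10" and n: "n > 0"
  shows "tr (Q * Q * euler_power n (l *\<^sub>R d - (2 / 3 * l\<^sup>2) *\<^sub>R v)) \<le> tr (Q * Q)"
proof -
  note Bi = unital_subalgebraD[OF B(1)]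
  have mA: "Q \<in> A" "v \<in> A" using B Q v by auto
  define g where "g = 2 / 3 * l\<^sup>2"
  define b where "b = l *\<^sub>R d - g *\<^sub>R v"
  have b: "b \<in> A" "star b = b"
    using mA d v by (auto simp: b_def mem_intros star_diff star_scale)
  define p where "p = tr (Q * Q * v)"
  have sq: "tr (Q * Q * (v * v)) \<le> (norm d)\<^sup>2 * p" "0 \<le> p"
    unfolding p_def by (rule tr_variance_square_le[OF B Q d v var]; assumption)+
  have small2: "l\<^sup>2 * (norm d)\<^sup>2 \<le> 1 / 100"
    using power_mono[OF small, of 2] by (simp add: power_mult_distrib power_one_over)
  have "norm b \<le> \<bar>l\<bar> * norm d + g * norm v"
    unfolding b_def by (rule order_trans[OF norm_triangle_ineq4]) (simp add: g_def)
  also have "g * norm v \<le> g * (norm d)\<^sup>2"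
    by (intro mult_left_mono v_le) (simp add: g_def)
  also have "\<bar>l\<bar> * norm d + g * (norm d)\<^sup>2 \<le> 11 / 100"
    using small small2 by (simp add: g_def)
  finally have nb: "norm b \<le> 11 / 100" by simp
  have "exp (norm b) \<le> exp (11 / 100)" using nb by simp
  also have "\<dots> \<le> 1 + 11 / 100 + (11 / 100)\<^sup>2" by (rule exp_bound) auto
  finally have eb: "exp (norm b) / 2 \<le> 57 / 100" by (simp add: power2_eq_square)
  have lin: "tr (Q * Q * b) = - g * p"
  proof -
    have "tr (Q * Q * b) = l * tr (Q * Q * d) - g * p"
      using mA d by (simp add: b_def right_diff_distrib tr_diff tr_scale mem_intros p_def)
    then show ?thesis using orth[of "Q * Q"] Q by (simp add: Bi)
  qed
  have quad: "tr (Q * Q * (b * b)) = l\<^sup>2 * p + g\<^sup>2 * tr (Q * Q * (v * v))"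
  proof -
    have "tr (Q * Q * (v * d)) = 0"
      using orth[of "Q * Q * v"] Q v by (simp add: Bi mult.assoc)
    \<comment> \<open>Here \<open>v\<close> stands to the right of \<open>d\<close>; cyclicity
      brings it to the left, where it merges with \<open>Q * Q\<close> into an element of
      \<open>B\<close>.\<close>
    moreover have "tr (Q * Q * (d * v)) = 0"
      using orth[of "v * (Q * Q)"] tr_commute[of v "Q * Q * d"] Q v mA d by (simp add: Bi mem_intros mult.assoc)
    moreover have "tr (Q * Q * (d * d)) = p"
      using var[of "Q * Q"] Q by (simp add: Bi p_def)
    moreover have "b * b = l\<^sup>2 *\<^sub>R (d * d) - (l * g) *\<^sub>R (v * d) - (l * g) *\<^sub>R (d * v) + g\<^sup>2 *\<^sub>R (v * v)"
      by (simp add: b_def algebra_simps power2_eq_square)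
    ultimately show ?thesis
      using mA d by (simp add: distrib_left right_diff_distrib tr_add tr_diff tr_scale mem_intros)
  qed
  have lp: "0 \<le> l\<^sup>2 * p" using sq(2) by simp
  have "g\<^sup>2 * tr (Q * Q * (v * v)) \<le> g\<^sup>2 * ((norm d)\<^sup>2 * p)"
    by (rule mult_left_mono[OF sq(1)]) simp
  also have "\<dots> = (4 / 9 * l\<^sup>2 * p) * (l\<^sup>2 * (norm d)\<^sup>2)"
    by (simp add: g_def power2_eq_square)
  also have "\<dots> \<le> (4 / 9 * l\<^sup>2 * p) * (1 / 100)"
    using sq(2) by (intro mult_left_mono small2) auto
  finally have quad_le: "tr (Q * Q * (b * b)) \<le> 101 / 100 * (l\<^sup>2 * p)"
    using quad lp by (simp add: mult.commute)
  have "tr (Q * Q * (b * b)) = tr (star (b * Q) * (b * Q))"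
    using tr_commute[of Q "Q * (b * b)"] mA Q b by (simp add: mem_intros star_mult mult.assoc)
  then have quad_nn: "0 \<le> tr (Q * Q * (b * b))"
    using tr_pos[of "b * Q"] b mA by (simp add: mem_intros)
  have "tr (Q * Q * euler_power n b) \<le> tr (Q * Q) + tr (Q * Q * b) + exp (norm b) / 2 * tr (Q * Q * (b * b))"
    by (rule tr_mult_euler_power_le[OF mA(1) Q(2) b n])
  also have "\<dots> \<le> tr (Q * Q) - g * p + 57 / 100 * (101 / 100 * (l\<^sup>2 * p))"
    using lin eb quad_le quad_nn by (intro add_mono mult_mono) auto
  also have "\<dots> \<le> tr (Q * Q)"
    using lp by (simp add: g_def mult.commute)
  finally show ?thesis by (simp add: b_def g_def)
qed

text \<open>An even exponent makes the Euler power the square of a self-adjoint element of the same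
  algebra, which provides a positive weight \<open>Q * Q\<close> without spectral theory.\<close>

lemma euler_power_even:
  assumes "k > 0" "unital_subalgebra B" "a \<in> B" "star a = a"
  obtains Q where "Q \<in> B" "star Q = Q" "euler_power (2 ^ k) a = Q * Q"
proof -
  let ?y = "1 + (1 / real (2 ^ k)) *\<^sub>R a"
  have "2 ^ k = 2 ^ (k - 1) + (2 ^ (k - 1) :: nat)"
    using assms(1) by (metis Suc_pred' mult_2 power_Suc)
  then have "euler_power (2 ^ k) a = ?y ^ (2 ^ (k - 1)) * ?y ^ (2 ^ (k - 1))"
    unfolding euler_power_def by (metis power_add)
  moreover have "?y ^ (2 ^ (k - 1)) \<in> B"
    using assms by (intro unital_subalgebraD)
  moreover have "star (?y ^ (2 ^ (k - 1))) = ?y ^ (2 ^ (k - 1))"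
    using assms by (simp add: star_power star_add star_one star_scale)
  ultimately show ?thesis using that by blast
qed

text \<open>\<open>orth\<close> and \<open>var\<close> say weakly that \<open>x\<close> is a
  martingale and \<open>v\<close> its conditional variance. Each step adds an error whose constant
  depends on \<open>N\<close> and \<open>l\<close>, hence \<open>C\<close> is chosen before
  \<open>k\<close>. The compensator is removed only at the end, by one more Golden--Thompson step
  against \<open>h\<close>, where the bound \<open>K\<close> on its norm enters.\<close>

lemma martingale_exponential_bound:
  fixes B :: "nat \<Rightarrow> 'a set" and x v :: "nat \<Rightarrow> 'a"
  assumes B: "\<And>j. unital_subalgebra (B j)" "\<And>j. B j \<subseteq> A" "mono B"
    and x: "x 0 = 0" "\<And>j. x j \<in> B j" "\<And>j. star (x j) = x j"
    and v: "\<And>j. v j \<in> B j" "\<And>j. star (v j) = v j"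
    and orth: "\<And>j y. y \<in> B j \<Longrightarrow> tr (y * (x (Suc j) - x j)) = 0"
    and var: "\<And>j y. y \<in> B j \<Longrightarrow> tr (y * ((x (Suc j) - x j) * (x (Suc j) - x j))) = tr (y * v j)"
    and v_le: "\<And>j. norm (v j) \<le> (norm (x (Suc j) - x j))\<^sup>2"
    and small: "\<And>j. j < N \<Longrightarrow> \<bar>l\<bar> * norm (x (Suc j) - x j) \<le> 1 / 10"
    and K: "norm (\<Sum>j<N. v j) \<le> K"
  shows "\<exists>C. \<forall>k>0. tr (euler_power (2 ^ k) (l *\<^sub>R x N)) \<le> exp (2 / 3 * l\<^sup>2 * K) + C / 2 ^ k"
proof -
  define g where "g = 2 / 3 * l\<^sup>2"
  define V where "V j = (\<Sum>i<j. v i)" for j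
  define a where "a j = l *\<^sub>R x j - g *\<^sub>R V j" for j
  define b where "b j = l *\<^sub>R (x (Suc j) - x j) - g *\<^sub>R v j" for j
  have V: "V j \<in> B j" "star (V j) = V j" for j
  proof -
    have "v i \<in> B j" if "i < j" for i
      using v(1)[of i] monoD[OF B(3), of i j] that by auto
    then show "V j \<in> B j" unfolding V_def by (intro unital_subalgebra_sum[OF B(1)]) auto
    show "star (V j) = V j" by (simp add: V_def star_sum v)
  qed
  have a: "a j \<in> B j" "star (a j) = a j" for j
    using x V by (auto simp: a_def star_diff star_scale intro!: unital_subalgebraD[OF B(1)])
  have inA: "x j \<in> A" "v j \<in> A" "a j \<in> A" "V j \<in> A" for j
    using x(2) v(1) a(1) V(1) B(2) by blast+
  have b: "b j \<in> A" "star (b j) = b j" for j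
    using inA x v by (auto simp: b_def star_diff star_scale intro!: mem_intros)
  have T: "\<exists>C. \<forall>k>0. tr (euler_power (2 ^ k) (a j)) \<le> 1 + C / 2 ^ k" if "j \<le> N" for j
    using that
  proof (induction j)
    case 0
    have "tr (euler_power (2 ^ k) (a 0)) = 1" for k
      by (simp add: a_def x V_def euler_power_def tr_one)
    then show ?case by (intro exI[of _ 0]) simp
  next
    case (Suc j)
    then obtain C where C: "\<And>k. k > 0 \<Longrightarrow> tr (euler_power (2 ^ k) (a j)) \<le> 1 + C / 2 ^ k" by auto
    define C' where "C' = exp (norm (a j) + norm (b j)) * (norm (a j) * norm (b j))"
    have "tr (euler_power (2 ^ k) (a (Suc j))) \<le> 1 + (C + C') / 2 ^ k" if k: "k > 0" for k
    proof -
      obtain Q where Q: "Q \<in> B j" "star Q = Q" "euler_power (2 ^ k) (a j) = Q * Q"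
        using euler_power_even[OF k B(1) a] .
      have "a (Suc j) = a j + b j"
        by (simp add: a_def b_def V_def algebra_simps)
      then have "tr (euler_power (2 ^ k) (a (Suc j))) \<le> tr (Q * Q * euler_power (2 ^ k) (b j)) + C' / 2 ^ k"
        using Golden_Thompson_euler_power[OF inA(3) a(2) b, of k j j] by (simp add: Q C'_def)
      also have "tr (Q * Q * euler_power (2 ^ k) (b j)) \<le> tr (Q * Q)"
        unfolding b_def g_def
      proof (rule tr_euler_power_increment_le[OF B(1) B(2) Q(1,2) _ _ v orth var v_le small])
        show "x (Suc j) - x j \<in> A" using inA by (simp add: mem_intros)
        show "star (x (Suc j) - x j) = x (Suc j) - x j" using x by (simp add: star_diff)
      qed (use Suc in auto)
      also have "tr (Q * Q) \<le> 1 + C / 2 ^ k" using C[OF k] Q by simp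
      finally show ?thesis by (simp add: add_divide_distrib)
    qed
    then show ?case by blast
  qed
  then obtain C where C: "\<And>k. k > 0 \<Longrightarrow> tr (euler_power (2 ^ k) (a N)) \<le> 1 + C / 2 ^ k" by blast
  define h where "h = g *\<^sub>R V N"
  have h: "h \<in> A" "star h = h" using inA V by (auto simp: h_def star_scale mem_intros)
  have nh: "norm h \<le> 2 / 3 * l\<^sup>2 * K"
    using K by (simp add: h_def V_def g_def mult_left_mono)
  define C' where "C' = exp (norm (a N) + norm h) * (norm (a N) * norm h)"
  define e where "e = exp (2 / 3 * l\<^sup>2 * K)"
  have "tr (euler_power (2 ^ k) (l *\<^sub>R x N)) \<le> e + (e * C + C') / 2 ^ k" if k: "k > 0" for k
  proof -
    obtain Q where Q: "Q \<in> B N" "star Q = Q" "euler_power (2 ^ k) (a N) = Q * Q"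
      using euler_power_even[OF k B(1) a] .
    have QA: "Q \<in> A" using Q B by auto
    let ?H = "euler_power (2 ^ k) h"
    have HA: "?H \<in> A" using h by (simp add: euler_power_mem)
    have "l *\<^sub>R x N = a N + h" by (simp add: a_def h_def)
    then have "tr (euler_power (2 ^ k) (l *\<^sub>R x N)) \<le> tr (Q * (Q * ?H)) + C' / 2 ^ k"
      using Golden_Thompson_euler_power[OF inA(3) a(2) h, of k N] by (simp add: Q C'_def mult.assoc)
    also have "tr (Q * (Q * ?H)) = tr (star Q * ?H * Q)"
      using tr_commute[of Q "Q * ?H"] QA HA Q by (simp add: mem_intros)
    also have "\<dots> \<le> norm ?H * tr (star Q * Q)"
      by (rule tr_sandwich_bound[OF HA QA])
    also have "\<dots> \<le> e * tr (star Q * Q)"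
    proof (rule mult_right_mono)
      show "norm ?H \<le> e"
        using norm_euler_power_le[of "2 ^ k" h] nh by (auto simp: e_def intro: order_trans)
    qed (rule tr_pos[OF QA])
    also have "\<dots> \<le> e * (1 + C / 2 ^ k)"
      using C[OF k] Q by (intro mult_left_mono) (auto simp: e_def)
    finally show ?thesis by (simp add: algebra_simps add_divide_distrib)
  qed
  then show ?thesis unfolding e_def by blast
qed

end

section \<open>Operators on a Hilbert space\<close>

text \<open>The representing vector minimizes \<open>norm y ^ 2 - 2 * f y\<close>. The parallelogram
  identity \<open>par\<close> makes a minimizing sequence Cauchy, and varying the minimizer along a
  line gives the representation.\<close>

lemma Riesz_representation:
  fixes f :: "'h::{real_inner, complete_space} \<Rightarrow> real"
  assumes "bounded_linear f"
  obtains y where "\<And>x. f x = inner y x"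
proof -
  interpret f: bounded_linear f by fact
  define G where "G y = (norm y)\<^sup>2 - 2 * f y" for y
  obtain K where K: "\<And>x. norm (f x) \<le> norm x * K" "K > 0" using f.pos_bounded by blast
  have G_ge: "- K\<^sup>2 \<le> G y" for y
  proof -
    have "f y \<le> norm y * K" using K(1)[of y] by simp
    moreover have "0 \<le> (norm y - K)\<^sup>2" by simp
    ultimately show ?thesis by (simp add: G_def power2_diff mult.commute)
  qed
  define m where "m = (INF y. G y)"
  have bdd: "bdd_below (range G)" using G_ge by (intro bdd_belowI[of _ "- K\<^sup>2"]) auto
  have m_le: "m \<le> G y" for y unfolding m_def by (rule cINF_lower[OF bdd]) simp
  have "\<exists>y. G y < m + 1 / real (Suc n)" for n
    using cINF_less_iff[OF _ bdd, of "m + 1 / real (Suc n)"] by (simp add: m_def)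
  then obtain Y where Y: "\<And>n. G (Y n) < m + 1 / real (Suc n)" by metis
  have par: "(norm (y - z))\<^sup>2 = 2 * G y + 2 * G z - 4 * G ((1/2) *\<^sub>R (y + z))" for y z
    by (simp add: G_def f.add f.scaleR power2_norm_eq_inner inner_add inner_diff inner_commute field_simps)
  have close: "(norm (Y i - Y j))\<^sup>2 < 4 / real (Suc n)" if "n \<le> i" "n \<le> j" for i j n
  proof -
    have "1 / real (Suc i) \<le> 1 / real (Suc n)" "1 / real (Suc j) \<le> 1 / real (Suc n)"
      using that by (auto simp: frac_le)
    then show ?thesis
      using par[of "Y i" "Y j"] Y[of i] Y[of j] m_le[of "(1/2) *\<^sub>R (Y i + Y j)"] by (simp add: add.commute)
  qed
  have "Cauchy Y"
  proof (rule metric_CauchyI)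
    fix e :: real assume e: "0 < e"
    then obtain n where n: "inverse (real (Suc n)) < e\<^sup>2 / 4"
      using reals_Archimedean[of "e\<^sup>2 / 4"] by auto
    have "dist (Y i) (Y j) < e" if "n \<le> i" "n \<le> j" for i j
    proof -
      have "(norm (Y i - Y j))\<^sup>2 < e\<^sup>2"
        using close[OF that] n by (simp add: inverse_eq_divide)
      then show ?thesis using e by (simp add: dist_norm power_less_imp_less_base)
    qed
    then show "\<exists>M. \<forall>i\<ge>M. \<forall>j\<ge>M. dist (Y i) (Y j) < e" by blast
  qed
  then obtain y where y: "Y \<longlonglongrightarrow> y" using Cauchy_convergent convergent_def by blast
  have "(\<lambda>n. G (Y n)) \<longlonglongrightarrow> G y"
    unfolding G_def by (intro tendsto_intros f.tendsto y)
  moreover have "(\<lambda>n. m + 1 / real (Suc n)) \<longlonglongrightarrow> m + 0"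
    using LIMSEQ_Suc[OF lim_1_over_n] by (intro tendsto_intros) simp
  ultimately have "G y \<le> m"
    using Y by (intro LIMSEQ_le[of "\<lambda>n. G (Y n)" _ "\<lambda>n. m + 1 / real (Suc n)"]) (auto intro: less_imp_le)
  then have min: "G y \<le> G z" for z using m_le[of z] by simp
  have "f x = inner y x" for x
  proof -
    define q where "q = inner y x - f x"
    have *: "0 \<le> 2 * t * q + t\<^sup>2 * (norm x)\<^sup>2" for t
    proof -
      have "(norm (y + t *\<^sub>R x))\<^sup>2 = (norm y)\<^sup>2 + 2 * t * inner y x + t\<^sup>2 * (norm x)\<^sup>2"
        unfolding power2_norm_eq_inner
        by (simp add: inner_add inner_commute power2_eq_square algebra_simps)
      then show ?thesis
        using min[of "y + t *\<^sub>R x"] by (simp add: G_def q_def f.add f.scaleR algebra_simps)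
    qed
    have "q = 0"
    proof (cases "x = 0")
      case False
      \<comment> \<open>The chosen parameter minimizes the quadratic in \<open>t\<close>.\<close>
      have "0 \<le> - (q\<^sup>2 / (norm x)\<^sup>2)"
        using *[of "- q / (norm x)\<^sup>2"] False
        by (simp add: field_simps power2_eq_square)
      then show ?thesis using False by (simp add: divide_le_0_iff)
    qed (simp add: q_def f.zero)
    then show ?thesis by (simp add: q_def)
  qed
  then show ?thesis using that by blast
qed

text \<open>\<open>adj\<close> is a definite description; Riesz representation at each
  \<open>y\<close> discharges its existence.\<close>

lemma adj_inner:
  fixes T :: "'h::{real_inner, complete_space} op"
  shows "inner (T x) y = inner x (adj T y)"
proof -
  have "\<exists>w. \<forall>x. inner (T x) y = inner w x" for y
  proof -
    have "bounded_linear (\<lambda>x. inner (T x) y)"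
      by (intro bounded_linear_compose[OF bounded_linear_inner_left] blinfun.bounded_linear_right)
    then show ?thesis using Riesz_representation by blast
  qed
  then obtain S where S: "\<And>x y. inner (T x) y = inner x (S y)"
    by (metis inner_commute)
  have "bounded_linear S"
  proof (rule bounded_linear_intro[of _ "norm T"])
    show "S (y + z) = S y + S z" for y z
      by (subst vector_eq_ldot[symmetric]) (simp add: inner_add_right S[symmetric])
    show "S (c *\<^sub>R y) = c *\<^sub>R S y" for c y
      by (subst vector_eq_ldot[symmetric]) (simp add: S[symmetric])
    show "norm (S y) \<le> norm y * norm T" for y
    proof (cases "S y = 0")
      case False
      have "(norm (S y))\<^sup>2 = inner (T (S y)) y" by (simp add: S power2_norm_eq_inner)
      also have "\<dots> \<le> norm (T (S y)) * norm y" by (rule norm_cauchy_schwarz)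
      also have "\<dots> \<le> norm T * norm (S y) * norm y"
        by (intro mult_right_mono norm_blinfun) simp
      finally show ?thesis using False by (simp add: power2_eq_square field_simps)
    qed simp
  qed
  then have S': "blinfun_apply (Blinfun S) = S" by (rule bounded_linear_Blinfun_apply)
  have "\<exists>!S'. \<forall>x y. inner (T x) y = inner x (blinfun_apply S' y)"
  proof (rule ex1I[of _ "Blinfun S"])
    show "R = Blinfun S" if "\<forall>x y. inner (T x) y = inner x (blinfun_apply R y)" for R
      using that S S' by (intro blinfun_eqI) (metis vector_eq_ldot)
  qed (simp add: S S')
  from theI'[OF this] show ?thesis unfolding adj_def by blast
qed

section \<open>The normed algebra of bounded endomorphisms\<close>

text \<open>The type constructor of bounded operators has two arguments, so it cannot be made an instance of
  the algebra classes; hence a copy for endomorphisms.\<close>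

typedef (overloaded) 'a endo = "UNIV :: ('a::real_normed_vector \<Rightarrow>\<^sub>L 'a) set"
  morphisms op_of of_op by simp

lemma op_of_of_op [simp]: "op_of (of_op T) = T"
  by (simp add: of_op_inverse)

lemma of_op_op_of [simp]: "of_op (op_of T) = T"
  by (simp add: op_of_inverse)

definition ap :: "'a::real_normed_vector endo \<Rightarrow> 'a \<Rightarrow> 'a" where
  "ap T = blinfun_apply (op_of T)"

lemma endo_eqI: "(\<And>x. ap S x = ap T x) \<Longrightarrow> S = T"
  unfolding ap_def by (metis blinfun_eqI op_of_inject)

instantiation endo :: (real_normed_vector) unital_normed_algebra
begin

definition "0 = of_op 0"
definition "1 = of_op id_blinfun"
definition "S + T = of_op (op_of S + op_of T)"
definition "S - T = of_op (op_of S - op_of T)"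
definition "- T = of_op (- op_of T)"
definition "S * T = of_op (op_of S o\<^sub>L op_of T)"
definition "c *\<^sub>R T = of_op (c *\<^sub>R op_of T)"
definition "norm T = norm (op_of T)"
definition "dist S T = norm (S - T)" for S T :: "'a endo"
definition "sgn T = inverse (norm T) *\<^sub>R T" for T :: "'a endo"
definition "(uniformity :: ('a endo \<times> 'a endo) filter) = (INF e\<in>{0<..}. principal {(x, y). dist x y < e})"
definition "open U = (\<forall>x\<in>U. eventually (\<lambda>(x', y). x' = x \<longrightarrow> y \<in> U) uniformity)" for U :: "'a endo set"

lemma ap_simps [simp]:
  "ap 0 x = 0" "ap 1 x = x" "ap (S + T) x = ap S x + ap T x" "ap (S - T) x = ap S x - ap T x"
  "ap (- T) x = - ap T x" "ap (S * T) x = ap S (ap T x)" "ap (c *\<^sub>R T) x = c *\<^sub>R ap T x"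
  by (simp_all add: ap_def zero_endo_def one_endo_def plus_endo_def minus_endo_def uminus_endo_def
      times_endo_def scaleR_endo_def blinfun.bilinear_simps)

lemma ap_linear [simp]:
  "ap T 0 = 0" "ap T (x + y) = ap T x + ap T y" "ap T (x - y) = ap T x - ap T y"
  "ap T (- x) = - ap T x" "ap T (c *\<^sub>R x) = c *\<^sub>R ap T x"
  by (simp_all add: ap_def blinfun.bilinear_simps)

lemma norm_ap: "norm (ap T x) \<le> norm T * norm x"
  by (simp add: ap_def norm_endo_def norm_blinfun)

lemma norm_endo_bound: "0 \<le> K \<Longrightarrow> (\<And>x. norm (ap T x) \<le> K * norm x) \<Longrightarrow> norm T \<le> K"
  by (simp add: ap_def norm_endo_def norm_blinfun_bound)

instance
proof
  fix S T U :: "'a endo" and c e :: real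
  show "(c + e) *\<^sub>R S = c *\<^sub>R S + e *\<^sub>R S" by (rule endo_eqI) (simp add: scaleR_add_left)
  show "norm (S * T) \<le> norm S * norm T"
    by (simp add: norm_endo_def times_endo_def norm_blinfun_compose)
  show "norm (S + T) \<le> norm S + norm T"
    by (simp add: norm_endo_def plus_endo_def norm_triangle_ineq)
  show "norm (c *\<^sub>R S) = \<bar>c\<bar> * norm S" by (simp add: norm_endo_def scaleR_endo_def)
  show "(norm S = 0) = (S = 0)"
    by (metis norm_endo_def norm_eq_zero of_op_op_of op_of_of_op zero_endo_def)
  show "norm (1 :: 'a endo) \<le> 1" by (rule norm_endo_bound) auto
  show "uniformity = (INF e\<in>{0<..}. principal {(x :: 'a endo, y). dist x y < e})"
    by (fact uniformity_endo_def)
  show "open V = (\<forall>x\<in>V. eventually (\<lambda>(x', y). x' = x \<longrightarrow> y \<in> V) uniformity)" for V :: "'a endo set"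
    by (fact open_endo_def)
qed (simp_all add: dist_endo_def sgn_endo_def endo_eqI algebra_simps)

end

lemma bounded_linear_ap: "bounded_linear (ap T)"
  by (rule bounded_linear_intro[of _ "norm T"]) (simp_all add: norm_ap mult.commute[of "norm _" "norm T"])

lemmas tendsto_ap = bounded_linear.tendsto[OF bounded_linear_ap]

lemma ap_sum: "ap (sum f I) x = (\<Sum>i\<in>I. ap (f i) x)"
  by (induction I rule: infinite_finite_induct) auto

lemma endo_ofI:
  fixes f :: "'a::real_normed_vector \<Rightarrow> 'a"
  assumes "\<And>x y. f (x + y) = f x + f y" "\<And>c x. f (c *\<^sub>R x) = c *\<^sub>R f x"
    "\<And>x. norm (f x) \<le> K * norm x" "0 \<le> K"
  obtains T where "ap T = f" "norm T \<le> K"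
proof -
  have "bounded_linear f"
    by (rule bounded_linear_intro[of _ K]) (auto simp: assms mult.commute)
  then have "ap (of_op (Blinfun f)) = f" by (simp add: ap_def bounded_linear_Blinfun_apply)
  then show ?thesis
    using that[of "of_op (Blinfun f)"] norm_endo_bound[of K "of_op (Blinfun f)"] assms by auto
qed

section \<open>Adjoints and positive operators\<close>

definition star :: "'h::real_inner endo \<Rightarrow> 'h endo" where
  "star T = of_op (adj (op_of T))"

lemma inner_ap:
  fixes T :: "'h::{real_inner, complete_space} endo"
  shows "inner (ap T x) y = inner x (ap (star T) y)"
  by (simp add: ap_def star_def adj_inner)

lemma star_unique:
  fixes T :: "'h::{real_inner, complete_space} endo"
  assumes "\<And>x y. inner (ap T x) y = inner x (ap S y)"
  shows "star T = S"
  using assms by (intro endo_eqI) (metis inner_ap vector_eq_ldot)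

lemma star_simps:
  fixes S T :: "'h::{real_inner, complete_space} endo"
  shows "star (S + T) = star S + star T" "star (S - T) = star S - star T" "star (- T) = - star T"
    "star (c *\<^sub>R T) = c *\<^sub>R star T" "star (S * T) = star T * star S" "star (star T) = T"
    "star 1 = (1 :: 'h endo)" "star 0 = (0 :: 'h endo)"
proof -
  have "inner (ap (star T) x) y = inner x (ap T y)" for x y
    by (metis inner_ap inner_commute)
  then show "star (star T) = T" by (rule star_unique)
qed (auto intro!: star_unique simp: inner_simps inner_ap)

lemma star_power: "star (T ^ n) = star T ^ n" for T :: "'h::{real_inner, complete_space} endo"
  by (induction n) (simp_all add: star_simps power_commutes)

text \<open>Over the reals a nonnegative quadratic form does not force symmetry, so
  \<open>star T = T\<close> is part of the notion.\<close>

definition pos :: "'h::real_inner endo \<Rightarrow> bool" where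
  "pos T \<longleftrightarrow> star T = T \<and> (\<forall>x. 0 \<le> inner (ap T x) x)"

lemma posD: "pos T \<Longrightarrow> star T = T" "pos T \<Longrightarrow> 0 \<le> inner (ap T x) x"
  by (auto simp: pos_def)

lemma pos_add: "pos S \<Longrightarrow> pos T \<Longrightarrow> pos (S + T)" for S T :: "'h::{real_inner, complete_space} endo"
  by (auto simp: pos_def star_simps inner_simps)

lemma pos_scale: "0 \<le> c \<Longrightarrow> pos T \<Longrightarrow> pos (c *\<^sub>R T)" for T :: "'h::{real_inner, complete_space} endo"
  by (auto simp: pos_def star_simps)

lemma pos_sandwich: "pos T \<Longrightarrow> pos (star S * T * S)" for S T :: "'h::{real_inner, complete_space} endo"
  by (auto simp: pos_def star_simps mult.assoc inner_ap[of "star S"])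

lemma pos_star_mult: "pos (star S * S)" for S :: "'h::{real_inner, complete_space} endo"
  by (simp add: pos_def star_simps inner_ap[of "star S"])

lemma pos_norm_square_diff:
  fixes S :: "'h::{real_inner, complete_space} endo"
  shows "pos ((norm S)\<^sup>2 *\<^sub>R 1 - star S * S)"
  unfolding pos_def
proof (intro conjI allI)
  fix h
  have "inner (ap (star S * S) h) h = (norm (ap S h))\<^sup>2"
    using inner_ap[of "star S" "ap S h" h] by (simp add: star_simps power2_norm_eq_inner)
  also have "\<dots> \<le> (norm S * norm h)\<^sup>2" by (intro power_mono norm_ap) simp
  finally show "0 \<le> inner (ap ((norm S)\<^sup>2 *\<^sub>R 1 - star S * S) h) h"
    by (simp add: inner_simps power2_norm_eq_inner power_mult_distrib)
qed (simp add: star_simps)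

lemma pos_one: "pos (1 :: 'h::{real_inner, complete_space} endo)"
  by (simp add: pos_def star_simps)

lemma pos_Cauchy_Schwarz:
  fixes T :: "'h::{real_inner, complete_space} endo"
  assumes "pos T"
  shows "(inner (ap T x) y)\<^sup>2 \<le> inner (ap T x) x * inner (ap T y) y"
proof -
  define p q r where "p = inner (ap T x) x" and "q = inner (ap T x) y" and "r = inner (ap T y) y"
  have "inner (ap T y) x = q"
    using posD(1)[OF assms] inner_ap[of T y x] by (simp add: q_def inner_commute)
  moreover have "0 \<le> inner (ap T (s *\<^sub>R x + t *\<^sub>R y)) (s *\<^sub>R x + t *\<^sub>R y)" for s t
    by (rule posD(2)[OF assms])
  ultimately have quad: "0 \<le> s\<^sup>2 * p + 2 * s * t * q + t\<^sup>2 * r" for s t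
    by (simp add: inner_simps algebra_simps p_def q_def r_def power2_eq_square)
  have "q\<^sup>2 \<le> p * r" by (rule nonneg_quadratic_form[OF quad])
  then show ?thesis by (simp add: p_def q_def r_def)
qed

text \<open>Cauchy--Schwarz for the form of \<open>T\<close>, applied to \<open>x\<close> and
  \<open>ap T x\<close>, with the square of \<open>norm (ap T x)\<close> cancelled. It upgrades
  convergence of quadratic forms to convergence of vectors.\<close>

lemma norm_ap_pos_le:
  fixes T :: "'h::{real_inner, complete_space} endo"
  assumes "pos T" "norm T \<le> K"
  shows "(norm (ap T x))\<^sup>2 \<le> K * inner (ap T x) x"
proof (cases "ap T x = 0")
  case False
  have "((norm (ap T x))\<^sup>2)\<^sup>2 \<le> inner (ap T x) x * inner (ap T (ap T x)) (ap T x)"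
    using pos_Cauchy_Schwarz[OF assms(1), of x "ap T x"] by (simp add: power2_norm_eq_inner)
  also have "\<dots> \<le> inner (ap T x) x * ((K * norm (ap T x)) * norm (ap T x))"
  proof (rule mult_left_mono)
    have "inner (ap T (ap T x)) (ap T x) \<le> norm (ap T (ap T x)) * norm (ap T x)"
      by (rule norm_cauchy_schwarz)
    also have "\<dots> \<le> (K * norm (ap T x)) * norm (ap T x)"
      using assms(2) by (intro mult_right_mono order_trans[OF norm_ap]) auto
    finally show "inner (ap T (ap T x)) (ap T x) \<le> (K * norm (ap T x)) * norm (ap T x)" .
  qed (rule posD(2)[OF assms(1)])
  finally have "(norm (ap T x))\<^sup>2 * (norm (ap T x))\<^sup>2 \<le> (K * inner (ap T x) x) * (norm (ap T x))\<^sup>2"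
    by (simp add: power2_eq_square algebra_simps)
  then show ?thesis by (rule mult_right_le_imp_le) (simp add: False)
qed (use posD(2)[OF assms(1), of x] in simp)

lemma norm_pos_le:
  fixes T :: "'h::{real_inner, complete_space} endo"
  assumes "pos T" "0 \<le> K" "\<And>x. inner (ap T x) x \<le> K * (norm x)\<^sup>2"
  shows "norm T \<le> K"
proof (rule norm_endo_bound[OF assms(2)])
  fix x
  show "norm (ap T x) \<le> K * norm x"
  proof (cases "ap T x = 0")
    case False
    have "((norm (ap T x))\<^sup>2)\<^sup>2 \<le> inner (ap T x) x * inner (ap T (ap T x)) (ap T x)"
      using pos_Cauchy_Schwarz[OF assms(1), of x "ap T x"] by (simp add: power2_norm_eq_inner)
    also have "\<dots> \<le> (K * (norm x)\<^sup>2) * (K * (norm (ap T x))\<^sup>2)"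
      using assms posD(2)[OF assms(1)] by (intro mult_mono) auto
    finally have "(norm (ap T x))\<^sup>2 * (norm (ap T x))\<^sup>2 \<le> (K * norm x)\<^sup>2 * (norm (ap T x))\<^sup>2"
      by (simp add: power2_eq_square algebra_simps)
    then have "(norm (ap T x))\<^sup>2 \<le> (K * norm x)\<^sup>2"
      by (rule mult_right_le_imp_le) (simp add: False)
    then show ?thesis by (rule power2_le_imp_le) (simp add: assms)
  qed (simp add: assms)
qed

lemma norm_pos_mono:
  fixes S T :: "'h::{real_inner, complete_space} endo"
  assumes "pos S" "pos (T - S)"
  shows "norm S \<le> norm T"
proof (rule norm_pos_le[OF assms(1)])
  fix x
  have "inner (ap S x) x \<le> inner (ap T x) x" using posD(2)[OF assms(2), of x] by (simp add: inner_simps)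
  also have "\<dots> \<le> norm (ap T x) * norm x" by (rule norm_cauchy_schwarz)
  also have "\<dots> \<le> norm T * norm x * norm x" by (intro mult_right_mono norm_ap) simp
  finally show "inner (ap S x) x \<le> norm T * (norm x)\<^sup>2" by (simp add: power2_eq_square)
qed simp

lemma pos_power:
  fixes T :: "'h::{real_inner, complete_space} endo"
  assumes "pos T"
  shows "pos (T ^ n)"
proof -
  have s: "star (T ^ (n div 2)) = T ^ (n div 2)" using assms by (simp add: star_power posD)
  show ?thesis
  proof (cases "even n")
    case True
    then have "T ^ n = star (T ^ (n div 2)) * T ^ (n div 2)"
      by (metis s dvd_mult_div_cancel mult_2 power_add)
    then show ?thesis using pos_star_mult[of "T ^ (n div 2)"] by simp
  next
    case False
    then have "T ^ n = T ^ (n div 2 + Suc (n div 2))"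
      by (metis add_Suc_right mult_2 odd_two_times_div_two_succ Suc_eq_plus1)
    also have "\<dots> = star (T ^ (n div 2)) * T * T ^ (n div 2)"
      by (simp only: s power_add power_Suc mult.assoc)
    finally show ?thesis using pos_sandwich[OF assms, of "T ^ (n div 2)"] by simp
  qed
qed

section \<open>Strong limits and spectral projections\<close>

definition strong_limit :: "(nat \<Rightarrow> 'h::real_normed_vector endo) \<Rightarrow> 'h endo \<Rightarrow> bool" where
  "strong_limit T L \<longleftrightarrow> (\<forall>x. (\<lambda>n. ap (T n) x) \<longlonglongrightarrow> ap L x)"

lemma strong_limitD: "strong_limit T L \<Longrightarrow> (\<lambda>n. ap (T n) x) \<longlonglongrightarrow> ap L x"
  by (simp add: strong_limit_def)

lemma strong_limit_unique: "strong_limit T L \<Longrightarrow> strong_limit T L' \<Longrightarrow> L = L'"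
  unfolding strong_limit_def by (intro endo_eqI) (meson LIMSEQ_unique)

lemma strong_limit_const: "strong_limit (\<lambda>n. T) T"
  by (simp add: strong_limit_def)

lemma strong_limit_add: "strong_limit S L \<Longrightarrow> strong_limit T M \<Longrightarrow> strong_limit (\<lambda>n. S n + T n) (L + M)"
  by (auto simp: strong_limit_def intro!: tendsto_intros)

lemma strong_limit_diff: "strong_limit S L \<Longrightarrow> strong_limit T M \<Longrightarrow> strong_limit (\<lambda>n. S n - T n) (L - M)"
  by (auto simp: strong_limit_def intro!: tendsto_intros)

lemma strong_limit_scale: "strong_limit T M \<Longrightarrow> strong_limit (\<lambda>n. c *\<^sub>R T n) (c *\<^sub>R M)"
  by (auto simp: strong_limit_def intro!: tendsto_intros)

lemma strong_limit_mult_left: "strong_limit T M \<Longrightarrow> strong_limit (\<lambda>n. S * T n) (S * M)"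
  by (auto simp: strong_limit_def intro!: tendsto_ap)

lemma strong_limit_mult_right: "strong_limit T M \<Longrightarrow> strong_limit (\<lambda>n. T n * S) (M * S)"
  by (auto simp: strong_limit_def)

lemma strong_limit_mult:
  assumes "strong_limit S L" "strong_limit T M" "\<And>n. norm (S n) \<le> K"
  shows "strong_limit (\<lambda>n. S n * T n) (L * M)"
  unfolding strong_limit_def
proof
  fix x
  have "(\<lambda>n. ap (S n) (ap (T n) x - ap M x)) \<longlonglongrightarrow> 0"
  proof (rule Lim_null_comparison)
    show "\<forall>\<^sub>F n in sequentially. norm (ap (S n) (ap (T n) x - ap M x)) \<le> K * norm (ap (T n) x - ap M x)"
      using assms(3) by (intro always_eventually allI order_trans[OF norm_ap] mult_right_mono) auto
    have "(\<lambda>n. K * norm (ap (T n) x - ap M x)) \<longlonglongrightarrow> K * norm (ap M x - ap M x)"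
      by (intro tendsto_intros strong_limitD assms)
    then show "(\<lambda>n. K * norm (ap (T n) x - ap M x)) \<longlonglongrightarrow> 0" by simp
  qed
  from tendsto_add[OF this strong_limitD[OF assms(1), of "ap M x"]]
  show "(\<lambda>n. ap (S n * T n) x) \<longlonglongrightarrow> ap (L * M) x" by simp
qed

lemma strong_limit_subseq: "strong_limit T L \<Longrightarrow> strict_mono f \<Longrightarrow> strong_limit (\<lambda>n. T (f n)) L"
  unfolding strong_limit_def using LIMSEQ_subseq_LIMSEQ[unfolded comp_def] by blast

lemma strong_limit_commute:
  assumes "strong_limit T L" "\<And>n. C * T n = T n * C"
  shows "C * L = L * C"
  using strong_limit_mult_left[OF assms(1), of C] strong_limit_mult_right[OF assms(1), of C] assms(2)
  by (simp add: strong_limit_unique)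

lemma strong_limit_star:
  fixes T :: "nat \<Rightarrow> 'h::{real_inner, complete_space} endo"
  assumes "strong_limit T L" "\<And>n. star (T n) = T n"
  shows "star L = L"
proof (rule star_unique)
  fix x y
  have "(\<lambda>n. inner (ap (T n) x) y) \<longlonglongrightarrow> inner (ap L x) y"
    by (intro tendsto_intros strong_limitD assms)
  moreover have "(\<lambda>n. inner x (ap (T n) y)) \<longlonglongrightarrow> inner x (ap L y)"
    by (intro tendsto_intros strong_limitD assms)
  moreover have "inner (ap (T n) x) y = inner x (ap (T n) y)" for n
    using inner_ap[of "T n" x y] assms(2) by simp
  ultimately show "inner (ap L x) y = inner x (ap L y)" by (simp add: LIMSEQ_unique)
qed

lemma strong_limit_pos:
  fixes T :: "nat \<Rightarrow> 'h::{real_inner, complete_space} endo"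
  assumes "strong_limit T L" "\<And>n. n \<ge> N \<Longrightarrow> pos (T n)"
  shows "pos L"
  unfolding pos_def
proof (intro conjI allI)
  show "star L = L"
    by (rule strong_limit_star[OF strong_limit_subseq[OF assms(1), of "\<lambda>n. n + N"]])
      (auto simp: strict_mono_def posD assms)
  fix x
  have "(\<lambda>n. inner (ap (T n) x) x) \<longlonglongrightarrow> inner (ap L x) x"
    by (intro tendsto_intros strong_limitD assms)
  then show "0 \<le> inner (ap L x) x"
    by (rule LIMSEQ_le_const) (use assms(2) posD(2) in blast)
qed

lemma strong_limit_exists:
  fixes T :: "nat \<Rightarrow> 'h::{real_inner, complete_space} endo"
  assumes "\<And>x. Cauchy (\<lambda>n. ap (T n) x)" "\<And>n. norm (T n) \<le> K"
  obtains L where "strong_limit T L" "norm L \<le> K"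
proof -
  define f where "f x = lim (\<lambda>n. ap (T n) x)" for x
  have f: "(\<lambda>n. ap (T n) x) \<longlonglongrightarrow> f x" for x
    unfolding f_def using assms(1) by (simp add: Cauchy_convergent_iff convergent_LIMSEQ_iff)
  have K: "0 \<le> K" using assms(2)[of 0] norm_ge_zero order_trans by blast
  have 1: "f (x + y) = f x + f y" for x y
    using tendsto_add[OF f[of x] f[of y]] f[of "x + y"] by (simp add: LIMSEQ_unique)
  have 2: "f (c *\<^sub>R x) = c *\<^sub>R f x" for c x
    using tendsto_scaleR[OF tendsto_const f[of x], of c] f[of "c *\<^sub>R x"] by (simp add: LIMSEQ_unique)
  have 3: "norm (f x) \<le> K * norm x" for x
  proof (rule LIMSEQ_le_const2[OF tendsto_norm[OF f[of x]]])
    have "norm (ap (T n) x) \<le> K * norm x" for n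
      using norm_ap[of "T n" x] mult_right_mono[OF assms(2)[of n], of "norm x"] by simp
    then show "\<exists>N. \<forall>n\<ge>N. norm (ap (T n) x) \<le> K * norm x" by blast
  qed
  from endo_ofI[OF 1 2 3 K] obtain L where "ap L = f" "norm L \<le> K" by blast
  then show ?thesis using that[of L] f by (simp add: strong_limit_def)
qed

text \<open>The quadratic forms decrease and are bounded below, so they converge;
  \<open>norm_ap_pos_le\<close>, applied to the positive differences, makes the vectors
  Cauchy.\<close>

lemma decreasing_strong_limit:
  fixes T :: "nat \<Rightarrow> 'h::{real_inner, complete_space} endo"
  assumes "\<And>n. pos (T n)" "\<And>n. pos (T n - T (Suc n))"
  obtains L where "strong_limit T L"
proof -
  have le: "pos (T m - T n)" if "m \<le> n" for m n
    using that
  proof (induction rule: dec_induct)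
    case base
    show ?case by (simp add: pos_def star_simps)
  next
    case (step n)
    then show ?case using pos_add[OF step.IH assms(2)[of n]] by simp
  qed
  define K where "K = norm (T 0)"
  have nK: "norm (T n) \<le> K" for n
    unfolding K_def using norm_pos_mono[OF assms(1) le[of 0 n]] by simp
  have "Cauchy (\<lambda>n. ap (T n) x)" for x
  proof -
    define a where "a n = inner (ap (T n) x) x" for n
    have "decseq a"
      unfolding decseq_def a_def using posD(2)[OF le] by (auto simp: inner_simps)
    moreover have "0 \<le> a n" for n unfolding a_def by (rule posD(2)[OF assms(1)])
    ultimately obtain l where l: "a \<longlonglongrightarrow> l" using decseq_convergent[of a 0] by blast
    have est: "(norm (ap (T m) x - ap (T n) x))\<^sup>2 \<le> 2 * K * (a m - a n)" if "m \<le> n" for m n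
    proof -
      have "norm (T m - T n) \<le> 2 * K"
        using norm_triangle_ineq4[of "T m" "T n"] nK[of m] nK[of n] by simp
      from norm_ap_pos_le[OF le[OF that] this, of x] show ?thesis
        by (simp add: a_def inner_simps)
    qed
    show ?thesis
    proof (rule CauchyI')
      fix e :: real assume e: "0 < e"
      \<comment> \<open>\<open>2 * K + 1\<close> keeps the denominator positive when
        \<open>K = 0\<close>.\<close>
      then have e': "0 < e\<^sup>2 / (2 * K + 1)" by (simp add: K_def add_nonneg_pos)
      from LIMSEQ_imp_Cauchy[OF l] obtain M where M: "\<And>m n. m \<ge> M \<Longrightarrow> n \<ge> M \<Longrightarrow> norm (a m - a n) < e\<^sup>2 / (2 * K + 1)"
        using CauchyD e' by blast
      have "norm (ap (T m) x - ap (T n) x) < e" if "m \<ge> M" "n > m" for m n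
      proof -
        have am: "a m - a n < e\<^sup>2 / (2 * K + 1)" using M[of m n] that by simp
        have an: "0 \<le> a m - a n" using \<open>decseq a\<close> that by (simp add: decseq_def)
        have "(norm (ap (T m) x - ap (T n) x))\<^sup>2 \<le> 2 * K * (a m - a n)" using est that by simp
        also have "\<dots> \<le> (2 * K + 1) * (a m - a n)" using an by (simp add: algebra_simps)
        also have "\<dots> < e\<^sup>2"
          using am by (simp add: K_def add_nonneg_pos pos_less_divide_eq mult.commute)
        finally show ?thesis using e by (simp add: power_less_imp_less_base)
      qed
      then show "\<exists>M. \<forall>m\<ge>M. \<forall>n>m. dist (ap (T m) x) (ap (T n) x) < e"
        unfolding dist_norm by blast
    qed
  qed
  from strong_limit_exists[of T, OF this nK] obtain L where "strong_limit T L" by blast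
  then show ?thesis by (rule that)
qed

section \<open>Square roots, kernel projections and spectral projections\<close>

text \<open>The iterates converge to \<open>1 - sqrt (1 - z)\<close>, dominated in norm by the scalar iteration at \<open>z = 1\<close>.\<close>

primrec sqrt_iter :: "'a::unital_normed_algebra \<Rightarrow> nat \<Rightarrow> 'a" where
  "sqrt_iter z 0 = 0"
| "sqrt_iter z (Suc n) = (1/2) *\<^sub>R (z + sqrt_iter z n * sqrt_iter z n)"

text \<open>\<open>S\<close> is the modulus of \<open>B\<close>. The limit \<open>W\<close> solves
  \<open>W = (z + W * W) / 2\<close> with \<open>z = 1 - B * B\<close>, so \<open>1 - W\<close>
  squares to \<open>B * B\<close>. The iterates are polynomials in \<open>B\<close>, so whatever
  commutes with \<open>B\<close> commutes with \<open>S\<close>.\<close>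

lemma pos_square_root:
  fixes B :: "'h::{real_inner, complete_space} endo"
  assumes B: "star B = B" "norm B \<le> 1"
  obtains S where "pos S" "S * S = B * B" "\<And>C. C * B = B * C \<Longrightarrow> C * S = S * C"
proof -
  define z where "z = 1 - B * B"
  have z_form: "inner (ap z x) x = (norm x)\<^sup>2 - (norm (ap B x))\<^sup>2" for x
    using inner_ap[of B "ap B x" x] B(1)
    by (simp add: z_def inner_simps power2_norm_eq_inner inner_commute)
  have nB: "(norm (ap B x))\<^sup>2 \<le> (norm x)\<^sup>2" for x
    using norm_ap[of B x] mult_right_mono[OF B(2), of "norm x"] by (intro power_mono) auto
  have z: "pos z" unfolding pos_def using nB by (auto simp: z_form) (simp add: z_def star_simps B)
  have nz: "norm z \<le> 1" by (rule norm_pos_le[OF z]) (auto simp: z_form)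
  define t where "t = rec_nat (0 :: real) (\<lambda>_ t. (1 + t * t) / 2)"
  have t_simps: "t 0 = 0" "t (Suc n) = (1 + t n * t n) / 2" for n by (simp_all add: t_def)
  have "0 \<le> t n \<and> t n \<le> 1" for n
    by (induction n) (auto simp: t_simps mult_le_one)
  then have t: "0 \<le> t n" "t n \<le> 1" for n by auto
  define w where "w = sqrt_iter z"
  have w_simps: "w 0 = 0" "w (Suc n) = (1/2) *\<^sub>R (z + w n * w n)" for n by (simp_all add: w_def)
  have nw: "norm (w n) \<le> t n" for n
  proof (induction n)
    case (Suc n)
    have "norm (w n * w n) \<le> t n * t n"
      using Suc t by (intro order_trans[OF norm_mult_ineq] mult_mono) auto
    then have "norm (z + w n * w n) \<le> 1 + t n * t n"
      using nz by (intro norm_triangle_le) simp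
    then show ?case by (simp add: w_simps t_simps)
  qed (simp add: w_simps t_simps)
  \<comment> \<open>The scalar iteration majorizes the increments, not only the iterates;
    telescoping makes the operators Cauchy as soon as \<open>t\<close> is.\<close>
  have step: "norm (w (Suc n) - w n) \<le> t (Suc n) - t n" for n
  proof (induction n)
    case 0
    show ?case using nw[of 1] by (simp add: w_simps t_simps)
  next
    case (Suc n)
    let ?d = "w (Suc n) - w n"
    have "t n \<le> t (Suc n)" using order_trans[OF norm_ge_zero Suc] by simp
    have "w (Suc (Suc n)) - w (Suc n) = (1/2) *\<^sub>R (w (Suc n) * ?d + ?d * w n)"
      by (simp add: w_simps(2)[of "Suc n"] w_simps(2)[of n] algebra_simps flip: scaleR_add_right scaleR_diff_right)
    then have "norm (w (Suc (Suc n)) - w (Suc n)) \<le> (norm (w (Suc n) * ?d) + norm (?d * w n)) / 2"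
      using norm_triangle_ineq[of "w (Suc n) * ?d" "?d * w n"] by simp
    also have "\<dots> \<le> (t (Suc n) * (t (Suc n) - t n) + (t (Suc n) - t n) * t n) / 2"
      using Suc nw t \<open>t n \<le> t (Suc n)\<close>
      by (intro divide_right_mono add_mono order_trans[OF norm_mult_ineq] mult_mono) auto
    also have "\<dots> = t (Suc (Suc n)) - t (Suc n)"
      by (simp add: t_simps(2)[of "Suc n"] t_simps(2)[of n] field_simps)
    finally show ?case .
  qed
  have tele: "norm (w n - w m) \<le> t n - t m" if "m \<le> n" for m n
    using that
  proof (induction rule: dec_induct)
    case (step n)
    have "norm (w (Suc n) - w m) \<le> norm (w (Suc n) - w n) + norm (w n - w m)"
      using norm_triangle_ineq[of "w (Suc n) - w n" "w n - w m"] by simp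
    then show ?case using step.IH \<open>\<And>n. norm (w (Suc n) - w n) \<le> t (Suc n) - t n\<close>[of n] by simp
  qed simp
  have "incseq t" by (rule incseq_SucI) (metis step norm_ge_zero order_trans diff_ge_0_iff_ge)
  then obtain l where "t \<longlonglongrightarrow> l" using incseq_convergent[of t 1] t(2) by blast
  then have Ct: "Cauchy t" by (rule LIMSEQ_imp_Cauchy)
  have "Cauchy (\<lambda>n. ap (w n) x)" for x
  proof (rule CauchyI')
    fix e :: real assume "0 < e"
    then have "0 < e / (norm x + 1)" by (simp add: add_nonneg_pos)
    then obtain M where M: "\<And>m n. m \<ge> M \<Longrightarrow> n \<ge> M \<Longrightarrow> norm (t m - t n) < e / (norm x + 1)"
      using CauchyD[OF Ct] by blast
    have "norm (ap (w m) x - ap (w n) x) < e" if "m \<ge> M" "n > m" for m n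
    proof -
      have "norm (ap (w m) x - ap (w n) x) = norm (ap (w n - w m) x)" by (simp add: norm_minus_commute)
      also have "\<dots> \<le> (t n - t m) * norm x"
        using that by (intro order_trans[OF norm_ap] mult_right_mono tele) auto
      also have "\<dots> \<le> norm (t n - t m) * (norm x + 1)" by (intro mult_mono) auto
      also have "\<dots> < e" using M[of n m] that by (simp add: pos_less_divide_eq add_nonneg_pos)
      finally show ?thesis .
    qed
    then show "\<exists>M. \<forall>m\<ge>M. \<forall>n>m. dist (ap (w m) x) (ap (w n) x) < e"
        unfolding dist_norm by blast
  qed
  moreover have nw1: "norm (w n) \<le> 1" for n using nw[of n] t(2)[of n] by simp
  ultimately obtain W where W: "strong_limit w W" "norm W \<le> 1" using strong_limit_exists by metis
  have "strong_limit (\<lambda>n. (1/2) *\<^sub>R (z + w n * w n)) ((1/2) *\<^sub>R (z + W * W))"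
    by (intro strong_limit_scale strong_limit_add strong_limit_const strong_limit_mult[OF W(1) W(1) nw1])
  moreover have "strong_limit (\<lambda>n. w (Suc n)) W"
    by (rule strong_limit_subseq[OF W(1)]) (simp add: strict_mono_def)
  ultimately have W_eq: "W = (1/2) *\<^sub>R (z + W * W)"
    by (simp add: w_simps strong_limit_unique)
  have "star (w n) = w n" for n
    by (induction n) (simp_all add: w_simps star_simps posD[OF z])
  then have sW: "star W = W" by (rule strong_limit_star[OF W(1)])
  show ?thesis
  proof (rule that[of "1 - W"])
    show "pos (1 - W)"
      unfolding pos_def
    proof (intro conjI allI)
      fix x
      have "inner (ap W x) x \<le> norm (ap W x) * norm x" by (rule norm_cauchy_schwarz)
      also have "\<dots> \<le> (1 * norm x) * norm x"
        using W(2) by (intro mult_right_mono order_trans[OF norm_ap]) auto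
      finally show "0 \<le> inner (ap (1 - W) x) x"
        by (simp add: inner_simps power2_norm_eq_inner flip: power2_eq_square)
    qed (simp add: star_simps sW)
    have "2 *\<^sub>R W = z + W * W" using arg_cong[OF W_eq, of "scaleR 2"] by simp
    then have "z + W * W - (W + W) = 0" by (simp add: scaleR_2)
    then show "(1 - W) * (1 - W) = B * B"
      by (simp add: z_def algebra_simps)
    fix C assume C: "C * B = B * C"
    have Cz: "C * z = z * C"
      using C by (simp add: z_def algebra_simps) (metis mult.assoc)
    have "C * w n = w n * C" for n
    proof (induction n)
      case (Suc n)
      have "C * (w n * w n) = (w n * w n) * C" using Suc by (metis mult.assoc)
      then show ?case using Cz by (simp add: w_simps algebra_simps)
    qed (simp add: w_simps)
    then have "C * W = W * C" by (rule strong_limit_commute[OF W(1)])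
    then show "C * (1 - W) = (1 - W) * C" by (simp add: algebra_simps)
  qed
qed


text \<open>\<open>p\<close> projects onto the kernel of \<open>P\<close> and is the strong limit of
  the powers of \<open>1 - P * P\<close>, which decrease because consecutive ones differ by
  \<open>P * T ^ n * P\<close>. The same telescoping writes \<open>1 - T ^ n\<close> as a sum of
  terms starting with \<open>P\<close>, so an operator annihilating \<open>P\<close> from the left
  also annihilates \<open>1 - p\<close>.\<close>

lemma kernel_projection:
  fixes P :: "'h::{real_inner, complete_space} endo"
  assumes P: "star P = P" "norm P \<le> 1"
  obtains p where "star p = p" "p * p = p" "P * p = 0"
    "\<And>C. C * P = P * C \<Longrightarrow> C * p = p * C" "\<And>C. C * P = 0 \<Longrightarrow> C * (1 - p) = 0"
proof -
  define T where "T = 1 - P * P"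
  have T_form: "inner (ap T x) x = (norm x)\<^sup>2 - (norm (ap P x))\<^sup>2" for x
    using inner_ap[of P "ap P x" x] P(1)
    by (simp add: T_def inner_simps power2_norm_eq_inner inner_commute)
  have nP: "(norm (ap P x))\<^sup>2 \<le> (norm x)\<^sup>2" for x
    using norm_ap[of P x] mult_right_mono[OF P(2), of "norm x"] by (intro power_mono) auto
  have T: "pos T" unfolding pos_def using nP by (auto simp: T_form) (simp add: T_def star_simps P)
  have nT: "norm T \<le> 1" by (rule norm_pos_le[OF T]) (auto simp: T_form)
  have nTn: "norm (T ^ n) \<le> 1" for n
    using norm_power_le[of T n] power_mono[OF nT, of n] by simp
  have TP: "T ^ n * P = P * T ^ n" for n
  proof (induction n)
    case (Suc n)
    have "T * P = P * T" by (simp add: T_def algebra_simps)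
    then show ?case using Suc by (metis mult.assoc power_Suc)
  qed simp
  have T_step: "T ^ n - T ^ Suc n = star P * T ^ n * P" for n
  proof -
    have "T ^ n - T ^ Suc n = T ^ n * P * P"
      unfolding power_Suc2 by (simp add: T_def algebra_simps)
    then show ?thesis by (simp add: TP P)
  qed
  have "pos (T ^ n - T ^ Suc n)" for n
    unfolding T_step by (rule pos_sandwich[OF pos_power[OF T]])
  then obtain p where p: "strong_limit (\<lambda>n. T ^ n) p"
    using decreasing_strong_limit[of "\<lambda>n. T ^ n"] pos_power[OF T] by blast
  have sp: "star p = p"
    by (rule strong_limit_star[OF p]) (simp add: star_power posD[OF T])
  have "strong_limit (\<lambda>n. T ^ n * T ^ n) (p * p)" by (rule strong_limit_mult[OF p p nTn])
  moreover have "strong_limit (\<lambda>n. T ^ (2 * n)) p"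
    by (rule strong_limit_subseq[OF p]) (simp add: strict_mono_def)
  ultimately have pp: "p * p = p"
    by (simp add: mult_2 power_add strong_limit_unique)
  have "strong_limit (\<lambda>n. T ^ Suc n) (T * p)"
    using strong_limit_mult_left[OF p, of T] by simp
  moreover have "strong_limit (\<lambda>n. T ^ Suc n) p"
    by (rule strong_limit_subseq[OF p]) (simp add: strict_mono_def)
  ultimately have "T * p = p" by (rule strong_limit_unique)
  then have PPp: "P * (P * p) = 0" by (simp add: T_def algebra_simps)
  have "P * p = 0"
  proof (rule endo_eqI)
    fix x
    have "inner (ap P (ap p x)) (ap P (ap p x)) = inner (ap p x) (ap (P * (P * p)) x)"
      using inner_ap[of P "ap p x" "ap P (ap p x)"] P(1) by simp
    then show "ap (P * p) x = ap 0 x" by (simp only: PPp) simp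
  qed
  moreover have "C * p = p * C" if "C * P = P * C" for C
  proof (rule strong_limit_commute[OF p])
    have "C * T = T * C"
      using that by (simp add: T_def algebra_simps) (metis mult.assoc)
    then show "C * T ^ n = T ^ n * C" for n
      by (induction n) (simp_all, metis mult.assoc)
  qed
  moreover have "C * (1 - p) = 0" if C: "C * P = 0" for C
  proof -
    have "C * (1 - T ^ n) = 0" for n
    proof (induction n)
      case (Suc n)
      have "C * (1 - T ^ Suc n) = C * (1 - T ^ n) + C * (T ^ n - T ^ Suc n)"
        by (simp add: algebra_simps)
      also have "\<dots> = C * P * T ^ n * P"
        unfolding T_step Suc by (simp add: P mult.assoc)
      finally show ?case by (simp add: C)
    qed simp
    moreover have "strong_limit (\<lambda>n. C * (1 - T ^ n)) (C * (1 - p))"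
      by (intro strong_limit_mult_left strong_limit_diff strong_limit_const p)
    ultimately have "strong_limit (\<lambda>n. 0) (C * (1 - p))" by simp
    then show ?thesis by (rule strong_limit_unique[OF _ strong_limit_const])
  qed
  ultimately show ?thesis using that sp pp by blast
qed

text \<open>Normalize \<open>A - t\<close> to a contraction \<open>B\<close> with modulus
  \<open>S\<close>, and let \<open>p\<close> be the kernel projection of the positive part
  \<open>(S + B) / 2\<close>. On the range of \<open>p\<close> this gives \<open>B = - S\<close>,
  and \<open>(S - B) * (S + B) = 0\<close> forces \<open>B = S\<close> on the complement. So
  \<open>p\<close> is the spectral projection of \<open>A\<close> for the half-line up to
  \<open>t\<close>.\<close>

lemma spectral_projection:
  fixes A :: "'h::{real_inner, complete_space} endo"
  assumes A: "star A = A"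
  obtains p where "star p = p" "p * p = p" "\<And>C. C * A = A * C \<Longrightarrow> C * p = p * C"
    "pos (t *\<^sub>R p - p * A * p)" "pos ((1 - p) * A * (1 - p) - t *\<^sub>R (1 - p))"
proof -
  \<comment> \<open>The added 1 avoids a zero denominator when \<open>A\<close> is the scalar
    \<open>t\<close>.\<close>
  define s where "s = 1 / (norm (A - t *\<^sub>R 1) + 1)"
  have s: "s > 0" by (simp add: s_def add_nonneg_pos)
  define B where "B = s *\<^sub>R (A - t *\<^sub>R 1)"
  have B: "star B = B" by (simp add: B_def star_simps A)
  have "norm B = s * norm (A - t *\<^sub>R 1)" using s by (simp add: B_def)
  also have "\<dots> \<le> 1" by (simp add: s_def divide_le_eq add_nonneg_pos)
  finally have nB: "norm B \<le> 1" .
  have A_eq: "A = t *\<^sub>R 1 + (1 / s) *\<^sub>R B" using s by (simp add: B_def)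
  obtain S where S: "pos S" "S * S = B * B" and S_comm: "\<And>C. C * B = B * C \<Longrightarrow> C * S = S * C"
    using pos_square_root[OF B nB] by blast
  have BS: "B * S = S * B" by (rule S_comm) simp
  have nS: "norm S \<le> 1"
  proof (rule norm_endo_bound)
    fix x
    have "(norm (ap S x))\<^sup>2 = inner x (ap (S * S) x)"
      using inner_ap[of S x "ap S x"] posD(1)[OF S(1)] by (simp add: power2_norm_eq_inner)
    also have "\<dots> = (norm (ap B x))\<^sup>2"
      using inner_ap[of B x "ap B x"] B by (simp add: S power2_norm_eq_inner)
    finally have "norm (ap S x) = norm (ap B x)" by (simp add: power2_eq_iff_nonneg)
    also have "\<dots> \<le> norm B * norm x" by (rule norm_ap)
    also have "\<dots> \<le> 1 * norm x" by (intro mult_right_mono nB) simp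
    finally show "norm (ap S x) \<le> 1 * norm x" .
  qed simp
  define P where "P = (1/2) *\<^sub>R (S + B)"
  have P: "star P = P" by (simp add: P_def star_simps B posD[OF S(1)])
  have nP: "norm P \<le> 1"
    using norm_triangle_ineq[of S B] nS nB by (simp add: P_def)
  obtain p where p: "star p = p" "p * p = p" "P * p = 0"
    and p_comm: "\<And>C. C * P = P * C \<Longrightarrow> C * p = p * C" and p_null: "\<And>C. C * P = 0 \<Longrightarrow> C * (1 - p) = 0"
    using kernel_projection[OF P nP] by blast
  have "S * p + B * p = 2 *\<^sub>R (P * p)" by (simp add: P_def algebra_simps)
  then have Bp: "B * p = - (S * p)" using p by (simp add: eq_neg_iff_add_eq_0 add.commute)
  have "(S - B) * P = 0" by (simp add: P_def algebra_simps S BS)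
  then have "(S - B) * (1 - p) = 0" by (rule p_null)
  then have Bq: "B * (1 - p) = S * (1 - p)" by (simp add: left_diff_distrib)
  have "t *\<^sub>R p - p * A * p = (1 / s) *\<^sub>R (star p * S * p)"
    by (simp add: A_eq p Bp algebra_simps mult.assoc)
  then have 1: "pos (t *\<^sub>R p - p * A * p)"
    using s by (simp add: pos_scale pos_sandwich S)
  have q: "(1 - p) * (1 - p) = 1 - p" by (simp add: algebra_simps p)
  have "(1 - p) * A * (1 - p) - t *\<^sub>R (1 - p) = (1 / s) *\<^sub>R ((1 - p) * (B * (1 - p)))"
    unfolding A_eq by (simp add: distrib_left distrib_right q mult.assoc)
  also have "\<dots> = (1 / s) *\<^sub>R (star (1 - p) * S * (1 - p))"
    unfolding Bq by (simp add: star_simps p mult.assoc)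
  finally have 2: "pos ((1 - p) * A * (1 - p) - t *\<^sub>R (1 - p))"
    using s by (simp add: pos_scale pos_sandwich S)
  have "C * p = p * C" if "C * A = A * C" for C
  proof (rule p_comm)
    have CB: "C * B = B * C" using that by (simp add: B_def algebra_simps)
    show "C * P = P * C" using CB S_comm[OF CB] by (simp add: P_def algebra_simps)
  qed
  then show ?thesis using that p 1 2 by blast
qed

section \<open>Von Neumann algebras and traces\<close>

definition endos :: "'h::real_normed_vector op set \<Rightarrow> 'h endo set" where
  "endos N = {T. op_of T \<in> N}"

lemma selfadj_iff_star: "selfadj (op_of T) \<longleftrightarrow> star T = T"
  by (metis op_of_of_op of_op_op_of selfadj_def star_def)

lemma positive_op_iff_pos: "positive_op (op_of T) \<longleftrightarrow> pos T"
  by (simp add: positive_op_def pos_def selfadj_iff_star ap_def)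

lemma op_of_simps:
  "op_of (S + T) = op_of S + op_of T" "op_of (S - T) = op_of S - op_of T"
  "op_of (S * T) = op_of S o\<^sub>L op_of T" "op_of (c *\<^sub>R T) = c *\<^sub>R op_of T" "op_of 1 = id_blinfun"
  by (simp_all add: plus_endo_def minus_endo_def times_endo_def scaleR_endo_def one_endo_def)

lemma of_op_sum: "of_op (sum f I) = (\<Sum>i\<in>I. of_op (f i))"
proof (induction I rule: infinite_finite_induct)
  case (insert i I)
  then show ?case by (simp add: plus_endo_def flip: insert.IH)
qed (simp_all add: zero_endo_def)

lemma of_op_mult: "of_op (S o\<^sub>L T) = of_op S * of_op T"
  by (simp add: times_endo_def)

lemma of_op_diff: "of_op (S - T) = of_op S - of_op T"
  by (simp add: minus_endo_def)

lemma op_le_iff_pos: "op_le (op_of S) (op_of T) \<longleftrightarrow> pos (T - S)"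
  by (simp add: op_le_def positive_op_iff_pos flip: op_of_simps)

lemma op_eq_iff: "op_of S = op_of T \<longleftrightarrow> S = T"
  by (rule op_of_inject)

text \<open>The bicommutant condition in terms of \<open>endo\<close>. Commutation of
  \<open>T\<close> with \<open>J\<close> is absorbed into the quantifier: \<open>N\<close> consists
  of operators commuting with \<open>J\<close>, so \<open>J\<close> itself is one of the admissible
  \<open>C\<close>.\<close>

lemma von_neumann_algebra_endos_iff:
  assumes "von_neumann_algebra J N"
  shows "T \<in> endos N \<longleftrightarrow>
    (\<forall>C. C * of_op J = of_op J * C \<longrightarrow> (\<forall>S\<in>endos N. C * S = S * C) \<longrightarrow> T * C = C * T)"
proof -
  have comm: "R \<in> commutant J X \<longleftrightarrow>
      of_op R * of_op J = of_op J * of_op R \<and> (\<forall>S\<in>endos X. of_op R * S = S * of_op R)" for R X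
    unfolding commutant_def cops_def endos_def op_eq_iff[symmetric] op_of_simps
    by auto (metis op_of_of_op)
  have sub: "N \<subseteq> cops J" and N: "N = commutant J (commutant J N)"
    using assms by (auto simp: von_neumann_algebra_def)
  have J: "J \<in> commutant J N"
    using sub by (auto simp: commutant_def cops_def)
  have "T \<in> endos N \<longleftrightarrow> op_of T \<in> commutant J (commutant J N)"
    using N by (simp add: endos_def)
  also have "\<dots> \<longleftrightarrow> T * of_op J = of_op J * T \<and> (\<forall>S\<in>endos (commutant J N). T * S = S * T)"
    by (simp add: comm)
  also have "\<dots> \<longleftrightarrow> (\<forall>S\<in>endos (commutant J N). T * S = S * T)"
    using J by (auto simp: endos_def)
  also have "\<dots> \<longleftrightarrow> (\<forall>C. C * of_op J = of_op J * C \<longrightarrow> (\<forall>S\<in>endos N. C * S = S * C) \<longrightarrow> T * C = C * T)"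
    by (auto simp: endos_def[of "commutant J N"] comm)
  finally show ?thesis .
qed

context
  fixes J :: "'h::{real_inner, complete_space} op" and N :: "'h op set"
  assumes vN: "von_neumann_algebra J N"
begin

lemma endos_memI:
  "(\<And>C. C * of_op J = of_op J * C \<Longrightarrow> (\<And>S. S \<in> endos N \<Longrightarrow> C * S = S * C) \<Longrightarrow> T * C = C * T) \<Longrightarrow> T \<in> endos N"
  by (subst von_neumann_algebra_endos_iff[OF vN]) blast

lemma endos_commute:
  assumes "T \<in> endos N" "C * of_op J = of_op J * C" "\<And>S. S \<in> endos N \<Longrightarrow> C * S = S * C"
  shows "T * C = C * T"
  using assms von_neumann_algebra_endos_iff[OF vN] by blast

lemma endos_subalgebra: "unital_subalgebra (endos N)"
  unfolding unital_subalgebra_def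
proof (intro conjI ballI allI)
  fix x y c assume "x \<in> endos N" "y \<in> endos N"
  note c = endos_commute[OF this(1)] endos_commute[OF this(2)]
  show "x + y \<in> endos N" by (rule endos_memI) (simp add: c distrib_left distrib_right)
  show "x * y \<in> endos N"
  proof (rule endos_memI)
    fix C assume C: "C * of_op J = of_op J * C" "\<And>S. S \<in> endos N \<Longrightarrow> C * S = S * C"
    show "x * y * C = C * (x * y)" using c(1)[OF C] c(2)[OF C] by (metis mult.assoc)
  qed
next
  fix x c assume "x \<in> endos N"
  note c = endos_commute[OF this]
  show "c *\<^sub>R x \<in> endos N" by (rule endos_memI) (simp add: c)
qed (rule endos_memI, simp)

lemma endos_star: "T \<in> endos N \<Longrightarrow> star T \<in> endos N"
  using vN by (simp add: von_neumann_algebra_def endos_def star_def)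

lemma endos_complex_structure: "of_op J \<in> endos N"
  by (rule endos_memI) simp

lemma endos_strong_limit:
  assumes "strong_limit T L" "\<And>n. T n \<in> endos N"
  shows "L \<in> endos N"
proof (rule endos_memI)
  fix C assume C: "C * of_op J = of_op J * C" "\<And>S. S \<in> endos N \<Longrightarrow> C * S = S * C"
  have "C * L = L * C" by (rule strong_limit_commute[OF assms(1)]) (rule C(2)[OF assms(2)])
  then show "L * C = C * L" ..
qed

text \<open>Keeps spectral projections inside the algebra: commuting with everything that commutes
  with \<open>A\<close> puts \<open>p\<close> into the bicommutant.\<close>

lemma endos_bicommutant:
  assumes "A \<in> endos N" "\<And>C. C * A = A * C \<Longrightarrow> C * p = p * C"
  shows "p \<in> endos N"
proof (rule endos_memI)
  fix C assume "C * of_op J = of_op J * C" "\<And>S. S \<in> endos N \<Longrightarrow> C * S = S * C"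
  then show "p * C = C * p" using assms by metis
qed

end

locale nc_probability =
  fixes J :: "'h::{real_inner, complete_space} op" and M :: "'h op set" and \<tau> :: "'h op \<Rightarrow> complex"
  assumes nc_prob_space: "nc_prob_space J M \<tau>"
begin

definition tr :: "'h endo \<Rightarrow> real" where
  "tr T = Re (\<tau> (op_of T))"

lemma vN: "von_neumann_algebra J M"
  using nc_prob_space by (simp add: nc_prob_space_def)

lemma state: "normal_faithful_tracial_state J M \<tau>"
  using nc_prob_space by (simp add: nc_prob_space_def)

lemma tr_pos_nonneg: "T \<in> endos M \<Longrightarrow> pos T \<Longrightarrow> 0 \<le> tr T"
  using state by (simp add: normal_faithful_tracial_state_def tr_def endos_def positive_op_iff_pos)

lemma tr_faithful: "T \<in> endos M \<Longrightarrow> pos T \<Longrightarrow> tr T = 0 \<Longrightarrow> T = 0"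
proof -
  assume T: "T \<in> endos M" "pos T" "tr T = 0"
  then have "Im (\<tau> (op_of T)) = 0" "Re (\<tau> (op_of T)) = 0"
    using state by (simp_all add: normal_faithful_tracial_state_def tr_def endos_def positive_op_iff_pos)
  then have "\<tau> (op_of T) = 0" by (simp add: complex_eq_iff)
  then have "op_of T = 0"
    using state T by (simp add: normal_faithful_tracial_state_def endos_def positive_op_iff_pos)
  then show "T = 0" by (metis of_op_op_of zero_endo_def)
qed

lemma tr_add': "S \<in> endos M \<Longrightarrow> T \<in> endos M \<Longrightarrow> tr (S + T) = tr S + tr T"
  using state by (simp add: normal_faithful_tracial_state_def tr_def endos_def op_of_simps)

lemma tr_scale': "T \<in> endos M \<Longrightarrow> tr (c *\<^sub>R T) = c * tr T"
proof -
  assume T: "T \<in> endos M"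
  have "op_of (c *\<^sub>R T) = csmult J (complex_of_real c) (op_of T)"
    by (simp add: csmult_def op_of_simps)
  then show ?thesis
    using state T by (simp add: normal_faithful_tracial_state_def tr_def endos_def)
qed

lemma complex_structure_simps: "star (of_op J) = - of_op J" "of_op J * of_op J = - 1"
proof -
  have J: "J o\<^sub>L J = - id_blinfun" "inner (J x) (J y) = inner x y" for x y
    using nc_prob_space by (auto simp: nc_prob_space_def complex_structure_def)
  show *: "of_op J * of_op J = - 1"
    by (simp add: J(1) one_endo_def uminus_endo_def flip: of_op_mult)
  have JJ: "ap (of_op J) (ap (of_op J) y) = - y" for y
    by (metis * ap_simps(2,5,6))
  have "inner (ap (of_op J) x) (ap (of_op J) y) = inner x y" for x y
    using J(2) by (simp add: ap_def)
  from this[of _ "ap (of_op J) _"]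
  have "inner (ap (of_op J) x) y = inner x (ap (- of_op J) y)" for x y
    by (simp add: JJ) (metis minus_minus)
  then show "star (of_op J) = - of_op J" by (rule star_unique)
qed

text \<open>Multiplying a skew-adjoint element by the imaginary unit makes it self-adjoint, so its
  trace is purely imaginary.\<close>

lemma tr_skew:
  assumes T: "T \<in> endos M" "star T = - T"
  shows "tr T = 0"
proof -
  note alg = unital_subalgebraD[OF endos_subalgebra[OF vN]]
  let ?j = "of_op J"
  have j: "?j \<in> endos M" by (rule endos_complex_structure[OF vN])
  have "op_of T \<in> cops J"
    using T(1) vN by (auto simp: von_neumann_algebra_def endos_def)
  then have jT: "?j * T = T * ?j" by (simp add: cops_def times_endo_def)
  define S where "S = ?j * T"
  have S: "S \<in> endos M" "star S = S"
    using j T jT by (simp_all add: S_def alg star_simps complex_structure_simps)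
  have Im_pos: "Im (\<tau> (op_of R)) = 0" if "R \<in> endos M" "pos R" for R
    using state that by (simp add: normal_faithful_tracial_state_def endos_def positive_op_iff_pos)
  \<comment> \<open>Reality of the state is given on positive elements only; adding a multiple of 1
    reduces the self-adjoint \<open>S\<close> to that case.\<close>
  have "pos (S + norm S *\<^sub>R 1)"
    unfolding pos_def
  proof (intro conjI allI)
    fix x
    have "- inner (ap S x) x \<le> norm (ap S x) * norm x"
      using Cauchy_Schwarz_ineq2[of "ap S x" x] by simp
    also have "\<dots> \<le> norm S * norm x * norm x" by (intro mult_right_mono norm_ap) simp
    finally show "0 \<le> inner (ap (S + norm S *\<^sub>R 1) x) x"
      by (simp add: inner_simps dot_square_norm power2_eq_square mult.assoc)
  qed (simp add: star_simps S)
  moreover have "pos (norm S *\<^sub>R (1 :: 'h endo))" by (simp add: pos_scale pos_one)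
  ultimately have "Im (\<tau> (op_of (S + norm S *\<^sub>R 1))) = 0" "Im (\<tau> (op_of (norm S *\<^sub>R 1))) = 0"
    using S by (auto intro!: Im_pos alg)
  moreover have "\<tau> (op_of (S + norm S *\<^sub>R 1)) = \<tau> (op_of S) + \<tau> (op_of (norm S *\<^sub>R 1))"
    using state S alg(1) alg(5)[OF alg(1), of "norm S"]
    by (simp add: normal_faithful_tracial_state_def endos_def op_of_simps)
  ultimately have "Im (\<tau> (op_of S)) = 0" by simp
  moreover have "op_of S = csmult J \<i> (op_of T)"
    by (simp add: S_def csmult_def op_of_simps)
  then have "\<tau> (op_of S) = \<i> * \<tau> (op_of T)"
    using state T by (simp add: normal_faithful_tracial_state_def endos_def)
  ultimately show ?thesis by (simp add: tr_def)
qed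

sublocale tracial_star_algebra "endos M" star tr
proof
  note alg = unital_subalgebraD[OF endos_subalgebra[OF vN]]
  fix x y :: "'h endo" and c :: real
  show "1 \<in> endos M" by (rule alg)
  show "tr 1 = 1"
    using state by (simp add: tr_def normal_faithful_tracial_state_def op_of_simps)
  show "star (star x) = x" "star (x + y) = star x + star y" "star (x * y) = star y * star x"
    "star (c *\<^sub>R x) = c *\<^sub>R star x"
    by (simp_all add: star_simps)
  assume x: "x \<in> endos M"
  show "c *\<^sub>R x \<in> endos M" "star x \<in> endos M" "tr (c *\<^sub>R x) = c * tr x"
    using x by (simp_all add: alg endos_star[OF vN] tr_scale')
  show "0 \<le> tr (star x * x)"
    by (intro tr_pos_nonneg pos_star_mult alg endos_star[OF vN] x)
  have "tr (x - star x) = 0"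
    using x by (intro tr_skew alg endos_star[OF vN]) (simp_all add: star_simps)
  moreover have "tr (star x + (x - star x)) = tr (star x) + tr (x - star x)"
    using x by (intro tr_add' alg endos_star[OF vN])
  ultimately show "tr (star x) = tr x" by simp
  assume y: "y \<in> endos M"
  show "x + y \<in> endos M" "x * y \<in> endos M" "tr (x + y) = tr x + tr y"
    using x y by (simp_all add: alg tr_add')
  show "tr (x * y) = tr (y * x)"
    using state x y by (simp add: tr_def normal_faithful_tracial_state_def endos_def op_of_simps)
  \<comment> \<open>Conjugating this positive element by \<open>y\<close> gives
    \<open>tr_mult_bound\<close>.\<close>
  have "pos ((norm x)\<^sup>2 *\<^sub>R 1 - star x * x)" by (rule pos_norm_square_diff)
  moreover define D where "D = star y * ((norm x)\<^sup>2 *\<^sub>R 1 - star x * x) * y"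
  ultimately have "0 \<le> tr D"
    unfolding D_def by (intro tr_pos_nonneg pos_sandwich alg endos_star[OF vN] x y)
  moreover have "tr (D + star (x * y) * (x * y)) = tr D + tr (star (x * y) * (x * y))"
    unfolding D_def by (intro tr_add' alg endos_star[OF vN] x y)
  moreover have "D + star (x * y) * (x * y) = (norm x)\<^sup>2 *\<^sub>R (star y * y)"
    by (simp add: D_def star_simps algebra_simps)
  moreover have "tr ((norm x)\<^sup>2 *\<^sub>R (star y * y)) = (norm x)\<^sup>2 * tr (star y * y)"
    by (intro tr_scale' alg endos_star[OF vN] y)
  ultimately show "tr (star (x * y) * (x * y)) \<le> (norm x)\<^sup>2 * tr (star y * y)" by simp
qed

end

context nc_probability
begin

lemma tr_sandwich_nonneg: "S \<in> endos M \<Longrightarrow> T \<in> endos M \<Longrightarrow> pos T \<Longrightarrow> 0 \<le> tr (star S * T * S)"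
  by (intro tr_pos_nonneg pos_sandwich mem_intros)

lemma star_mult_self_eq_0:
  assumes "w \<in> endos M" "tr (star w * w) = 0"
  shows "w = 0"
proof -
  have "star w * w = 0"
    using assms by (intro tr_faithful pos_star_mult mem_intros)
  then have "inner (ap w x) (ap w x) = 0" for x
    using inner_ap[of w x "ap w x"] by (metis ap_simps(1,6) inner_zero_right)
  then show ?thesis by (intro endo_eqI) simp
qed

lemma tr_projection_nonneg:
  assumes "T \<in> endos M" "pos T" "r \<in> endos M" "star r = r" "r * r = r"
  shows "0 \<le> tr (r * T)"
proof -
  have "tr (star r * T * r) = tr (r * (r * T))"
    using assms tr_commute[of "r * T" r] by (simp add: mem_intros)
  also have "\<dots> = tr (r * T)" using assms by (simp flip: mult.assoc)
  finally show ?thesis using tr_sandwich_nonneg[of r T] assms by simp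
qed

end

section \<open>Conditional expectations\<close>

text \<open>The expectation is encoded by its defining trace identity. Linearity, the bimodule
  property, compatibility with \<open>star\<close> and positivity are derived from it below by
  faithfulness, mostly through \<open>F_unique\<close>.\<close>

locale trace_cond_exp = nc_probability +
  fixes N :: "'a op set" and F :: "'a endo \<Rightarrow> 'a endo"
  assumes vN_sub: "von_neumann_algebra J N" and sub: "N \<subseteq> M"
    and F_mem: "T \<in> endos M \<Longrightarrow> F T \<in> endos N"
    and tr_F: "a \<in> endos N \<Longrightarrow> T \<in> endos M \<Longrightarrow> tr (a * F T) = tr (a * T)"
begin

lemma sub_mem: "T \<in> endos N \<Longrightarrow> T \<in> endos M"
  using sub by (auto simp: endos_def)

lemmas sub_intros = unital_subalgebraD[OF endos_subalgebra[OF vN_sub]] endos_star[OF vN_sub]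

text \<open>The difference of two candidates lies in \<open>N\<close>, so it may be tested against
  its own adjoint; faithfulness makes it vanish.\<close>

lemma F_unique:
  assumes T: "T \<in> endos M" and y: "y \<in> endos N" and eq: "\<And>a. a \<in> endos N \<Longrightarrow> tr (a * y) = tr (a * T)"
  shows "F T = y"
proof -
  define w where "w = F T - y"
  have w: "w \<in> endos N" using T y by (simp add: w_def sub_intros F_mem)
  have "tr (star w * w) = tr (star w * F T) - tr (star w * y)"
    using w F_mem[OF T] y
    by (subst w_def(1)[symmetric, THEN sym]) (simp add: w_def right_diff_distrib tr_diff mult_mem sub_mem sub_intros)
  also have "\<dots> = 0" using w by (simp add: tr_F T eq sub_intros)
  finally have "w = 0" using w by (intro star_mult_self_eq_0) (auto intro: sub_mem)
  then show ?thesis by (simp add: w_def)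
qed

lemma F_id: "T \<in> endos N \<Longrightarrow> F T = T"
  by (rule F_unique) (auto intro: sub_mem)

lemma F_diff: "S \<in> endos M \<Longrightarrow> T \<in> endos M \<Longrightarrow> F (S - T) = F S - F T"
  by (rule F_unique) (simp_all add: mem_intros sub_intros F_mem right_diff_distrib tr_diff sub_mem tr_F)

lemma F_add: "S \<in> endos M \<Longrightarrow> T \<in> endos M \<Longrightarrow> F (S + T) = F S + F T"
  by (rule F_unique) (simp_all add: mem_intros sub_intros F_mem distrib_left tr_add sub_mem tr_F)

lemma F_scale: "T \<in> endos M \<Longrightarrow> F (c *\<^sub>R T) = c *\<^sub>R F T"
  by (rule F_unique) (simp_all add: mem_intros sub_intros F_mem tr_scale sub_mem tr_F)

lemma F_sum: "(\<And>i. i \<in> I \<Longrightarrow> f i \<in> endos M) \<Longrightarrow> F (sum f I) = (\<Sum>i\<in>I. F (f i))"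
proof (induction I rule: infinite_finite_induct)
  case (insert i I)
  then show ?case
    using unital_subalgebra_sum[OF unital_subalgebra_carrier, of I f] by (simp add: F_add)
qed (auto intro!: F_id sub_intros)

lemma F_mult:
  assumes "a \<in> endos N" "b \<in> endos N" "T \<in> endos M"
  shows "F (a * T * b) = a * F T * b"
proof (rule F_unique)
  fix c assume c: "c \<in> endos N"
  have "tr (c * (a * F T * b)) = tr (b * (c * a * F T))"
    using tr_commute[of "c * a * F T" b] assms c by (simp add: mem_intros sub_mem F_mem mult.assoc)
  also have "\<dots> = tr (b * (c * a * T))"
    using tr_F[of "b * c * a" T] assms c by (simp add: sub_intros mult.assoc)
  also have "\<dots> = tr (c * (a * T * b))"
    using tr_commute[of "c * a * T" b] assms c by (simp add: mem_intros sub_mem mult.assoc)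
  finally show "tr (c * (a * F T * b)) = tr (c * (a * T * b))" .
qed (use assms in \<open>auto intro: mem_intros sub_mem sub_intros F_mem\<close>)

lemma F_star:
  assumes "T \<in> endos M"
  shows "F (star T) = star (F T)"
proof (rule F_unique)
  fix a assume a: "a \<in> endos N"
  have "tr (a * star (F T)) = tr (F T * star a)"
    using tr_star[of "F T * star a"] a assms by (simp add: mem_intros sub_mem F_mem star_mult star_star)
  also have "\<dots> = tr (star a * T)"
    using tr_commute[of "F T" "star a"] a assms tr_F by (simp add: mem_intros sub_mem F_mem sub_intros)
  also have "\<dots> = tr (star (star a * T))"
    using tr_star[of "star a * T"] a assms by (simp add: mem_intros sub_mem)
  also have "\<dots> = tr (a * star T)"
    using tr_commute[of a "star T"] a assms by (simp add: mem_intros sub_mem star_mult star_star)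
  finally show "tr (a * star (F T)) = tr (a * star T)" .
qed (use assms in \<open>auto intro: mem_intros sub_mem sub_intros F_mem\<close>)

text \<open>The spectral projection \<open>p\<close> of \<open>F T\<close> on the negative half-line satisfies
  \<open>0 \<le> tr (p T p) = tr (p (F T) p) \<le> 0\<close>, so faithfulness kills the negative part.\<close>

lemma F_pos:
  assumes T: "T \<in> endos M" "pos T"
  shows "pos (F T)"
proof -
  have s: "star (F T) = F T" using F_star[OF T(1)] posD[OF T(2)] by simp
  obtain p where p: "star p = p" "p * p = p" "\<And>C. C * F T = F T * C \<Longrightarrow> C * p = p * C"
    and le: "pos (0 *\<^sub>R p - p * F T * p)" and ge: "pos ((1 - p) * F T * (1 - p) - 0 *\<^sub>R (1 - p))"
    using spectral_projection[OF s, of 0] by blast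
  have pN: "p \<in> endos N" by (rule endos_bicommutant[OF vN_sub F_mem[OF T(1)]]) (rule p)
  have "tr (p * F T * p) = tr (p * T * p)"
    using tr_F[of 1 "p * T * p"] F_mult[OF pN pN T(1)] T pN
    by (simp add: sub_intros mem_intros sub_mem)
  also have "\<dots> \<ge> 0" using tr_sandwich_nonneg[of p T] p(1) T pN by (simp add: sub_mem)
  finally have "tr (- (p * F T * p)) \<le> 0"
    using tr_scale[of "p * F T * p" "-1"] T pN by (simp add: mem_intros sub_mem F_mem)
  moreover have neg: "pos (- (p * F T * p))" using le by simp
  moreover have mem: "- (p * F T * p) \<in> endos M" using T pN by (simp add: mem_intros sub_mem F_mem)
  ultimately have "- (p * F T * p) = 0"
    by (intro tr_faithful) (auto intro: antisym tr_pos_nonneg)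
  then have "p * F T * p = 0" by simp
  moreover have "F T * p = p * F T" by (rule p) simp
  ultimately have pF: "p * F T = 0" "F T * p = 0" by (metis mult.assoc p(2))+
  then have "(1 - p) * F T * (1 - p) = F T" by (simp add: algebra_simps pF)
  then show ?thesis using ge by simp
qed

text \<open>Kadison--Schwarz: positivity of \<open>F\<close> on the square of
  \<open>T - F T\<close>.\<close>

lemma F_square_ge:
  assumes T: "T \<in> endos M" "star T = T"
  shows "pos (F (T * T) - F T * F T)"
proof -
  define y where "y = F T"
  have y: "y \<in> endos N" "star y = y" using F_mem[OF T(1)] F_star[OF T(1)] T(2) by (simp_all add: y_def)
  have "pos (F (star (T - y) * (T - y)))"
    using T y by (intro F_pos pos_star_mult) (simp add: mem_intros sub_mem)
  \<comment> \<open>The factors 1 bring the cross terms into the form \<open>a * T * b\<close> of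
    \<open>F_mult\<close>.\<close>
  also have "star (T - y) * (T - y) = T * T - y * T * 1 - 1 * T * y + y * y"
    by (simp add: star_simps T y algebra_simps)
  also have "F \<dots> = F (T * T) - F (y * T * 1) - F (1 * T * y) + F (y * y)"
    using T y by (simp add: F_diff F_add mem_intros sub_mem)
  also have "F (y * T * 1) = y * F T * 1" by (rule F_mult) (simp_all add: y T sub_intros)
  also have "F (1 * T * y) = 1 * F T * y" by (rule F_mult) (simp_all add: y T sub_intros)
  also have "F (y * y) = y * y" by (rule F_id) (simp add: y sub_intros)
  finally show ?thesis by (simp add: y_def)
qed

lemma norm_F_square_le:
  assumes T: "T \<in> endos M" "star T = T"
  shows "norm (F (T * T)) \<le> (norm T)\<^sup>2"
proof (rule norm_pos_le)
  have TT: "pos (T * T)" using pos_star_mult[of T] T by simp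
  show "pos (F (T * T))" using T TT by (intro F_pos mem_intros)
  have "pos ((norm T)\<^sup>2 *\<^sub>R 1 - T * T)" using pos_norm_square_diff[of T] T by simp
  then have "pos (F ((norm T)\<^sup>2 *\<^sub>R 1 - T * T))" using T by (intro F_pos mem_intros)
  also have "F ((norm T)\<^sup>2 *\<^sub>R 1 - T * T) = (norm T)\<^sup>2 *\<^sub>R 1 - F (T * T)"
    using T F_id[of 1] by (simp add: F_diff F_scale mem_intros sub_intros)
  finally show "inner (ap (F (T * T)) h) h \<le> (norm T)\<^sup>2 * (norm h)\<^sup>2" for h
    using posD(2)[of "(norm T)\<^sup>2 *\<^sub>R 1 - F (T * T)" h] by (simp add: inner_simps power2_norm_eq_inner)
qed simp

end

section \<open>Cuculescu's construction and limits of projections\<close>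

context nc_probability
begin

text \<open>One step of Cuculescu's construction: cut \<open>q\<close> down to the part of \<open>q Y q\<close> below level \<open>t\<close>.\<close>

lemma Cuculescu_step:
  assumes N: "von_neumann_algebra J N" "N \<subseteq> M"
    and q: "q \<in> endos N" "star q = q" "q * q = q" and Y: "Y \<in> endos N" "star Y = Y"
  obtains r where "r \<in> endos N" "star r = r" "r * r = r" "q * r = r" "r * q = r"
    "pos (t *\<^sub>R r - r * Y * r)" "t * tr (q - r) \<le> tr ((q - r) * Y)"
proof -
  note N_intros = unital_subalgebraD[OF endos_subalgebra[OF N(1)]] endos_star[OF N(1)]
  have NM: "T \<in> endos M" if "T \<in> endos N" for T using N(2) that by (auto simp: endos_def)
  define A where "A = q * Y * q"
  have A: "A \<in> endos N" "star A = A" using q Y by (simp_all add: A_def N_intros star_simps mult.assoc)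
  have qA: "q * A = A" "A * q = A"
    using q(3) by (simp_all add: A_def mult.assoc) (simp add: q flip: mult.assoc)
  obtain p where p: "star p = p" "p * p = p" and p_comm: "\<And>C. C * A = A * C \<Longrightarrow> C * p = p * C"
    and le: "pos (t *\<^sub>R p - p * A * p)" and ge: "pos ((1 - p) * A * (1 - p) - t *\<^sub>R (1 - p))"
    using spectral_projection[OF A(2)] by blast
  have pN: "p \<in> endos N" by (rule endos_bicommutant[OF N(1) A(1)]) (rule p_comm)
  have qp: "q * p = p * q" by (rule p_comm) (simp add: qA)
  \<comment> \<open>\<open>A\<close> is compressed by \<open>q\<close>, so \<open>p\<close> commutes
    with \<open>q\<close> and \<open>r\<close> projects onto the common range.\<close>
  define r where "r = q * p"
  have rN: "r \<in> endos N" using q pN by (simp add: r_def N_intros)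
  have r_star: "star r = r" by (simp add: r_def star_simps q p qp)
  have qr: "q * r = r" by (simp add: r_def q flip: mult.assoc)
  have rq: "r * q = r" by (metis r_def qp qr mult.assoc)
  have rr: "r * r = r" by (metis r_def qp qr mult.assoc p(2))
  have "q * (t *\<^sub>R p - p * A * p) * q = t *\<^sub>R r - r * Y * r"
  proof -
    have "q * p * q = r" using rq by (simp add: r_def)
    moreover have "q * (p * A * p) * q = r * Y * r"
      by (metis A_def r_def qp mult.assoc q(3))
    ultimately show ?thesis by (simp add: algebra_simps mult.assoc)
  qed
  then have 1: "pos (t *\<^sub>R r - r * Y * r)" using pos_sandwich[OF le, of q] q by simp
  \<comment> \<open>The removed part is cut out of \<open>q\<close> by \<open>1 - p\<close>; there
    the form of \<open>Y\<close> is at least \<open>t\<close>, which gives the Chebyshev-type trace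
    bound.\<close>
  define u where "u = q - r"
  have u: "u = q * (1 - p)" "u = (1 - p) * q" by (simp_all add: u_def r_def algebra_simps qp)
  have uu: "u * u = u" by (simp add: u_def algebra_simps q qr rq rr)
  have us: "star u = u" by (simp add: u_def star_simps q r_star)
  have uN: "u \<in> endos N" using q rN by (simp add: u_def N_intros)
  have "q * ((1 - p) * A * (1 - p) - t *\<^sub>R (1 - p)) * q = u * Y * u - t *\<^sub>R u"
  proof -
    have "q * (1 - p) * q = u" by (metis u mult.assoc q(3))
    moreover have "q * ((1 - p) * A * (1 - p)) * q = u * Y * u"
      by (metis A_def u mult.assoc q(3))
    ultimately show ?thesis by (simp add: right_diff_distrib left_diff_distrib mult.assoc)
  qed
  then have "pos (u * Y * u - t *\<^sub>R u)" using pos_sandwich[OF ge, of q] q by simp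
  then have "0 \<le> tr (u * Y * u - t *\<^sub>R u)"
    using uN Y by (intro tr_pos_nonneg mem_intros NM)
  also have "\<dots> = tr (u * Y * u) - t * tr u"
    using uN Y by (simp add: tr_diff tr_scale mem_intros NM)
  also have "tr (u * Y * u) = tr (u * (u * Y))"
    using tr_commute[of "u * Y" u] uN Y by (simp add: mem_intros NM)
  also have "\<dots> = tr (u * Y)" by (simp add: uu flip: mult.assoc)
  finally have 2: "t * tr (q - r) \<le> tr ((q - r) * Y)" by (simp add: u_def)
  show ?thesis using that[OF rN r_star rr qr rq 1 2] .
qed

text \<open>Convergence of the projections is only strong, and normality of the state carries the
  trace bound to the limit: it is applied to the increasing family \<open>1 - q n\<close>, whose
  least upper bound is \<open>1 - e\<close>.\<close>

lemma tr_decreasing_projections: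
  fixes q :: "nat \<Rightarrow> 'h endo"
  assumes q: "\<And>n. q n \<in> endos M" "\<And>n. star (q n) = q n" "\<And>n. q n * q n = q n"
    and dec: "\<And>n. q n * q (Suc n) = q (Suc n)" "\<And>n. q (Suc n) * q n = q (Suc n)"
    and c: "\<And>n. tr (1 - q n) \<le> c"
  obtains e where "e \<in> endos M" "star e = e" "e * e = e" "\<And>n. q n * e = e" "tr (1 - e) \<le> c"
proof -
  have le: "q m * q n = q n \<and> q n * q m = q n" if "m \<le> n" for m n
    using that
  proof (induction rule: dec_induct)
    case (step n)
    then show ?case using dec by (metis mult.assoc)
  qed (simp add: q)
  have pos_q: "pos p" if "star p = p" "p * p = p" for p :: "'h endo"
    using pos_star_mult[of p] that by simp
  have diff: "pos (q m - q n)" if "m \<le> n" for m n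
    using le[OF that] by (intro pos_q) (simp_all add: star_simps q algebra_simps)
  obtain e where e: "strong_limit q e"
    using decreasing_strong_limit[of q] pos_q[OF q(2,3)] diff[of _ "Suc _"] by (metis lessI less_imp_le)
  have eM: "e \<in> endos M" by (rule endos_strong_limit[OF vN e q(1)])
  have es: "star e = e" by (rule strong_limit_star[OF e q(2)])
  have qe: "q m * e = e" for m
  proof -
    have "strong_limit (\<lambda>n. q m * q (n + m)) (q m * e)"
      by (intro strong_limit_mult_left strong_limit_subseq[OF e]) (simp add: strict_mono_def)
    moreover have "strong_limit (\<lambda>n. q (n + m)) e"
      by (intro strong_limit_subseq[OF e]) (simp add: strict_mono_def)
    ultimately show ?thesis using le[of m] by (simp add: strong_limit_unique)
  qed
  have "strong_limit (\<lambda>n. q n * e) (e * e)" by (rule strong_limit_mult_right[OF e])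
  then have ee: "e * e = e" by (simp add: qe) (metis strong_limit_unique strong_limit_const)
  define D where "D = range (\<lambda>n. op_of (1 - q n))"
  have qe_diff: "pos (q n - e)" for n
  proof -
    have "strong_limit (\<lambda>k. q n - q k) (q n - e)"
      by (intro strong_limit_diff strong_limit_const e)
    then show ?thesis by (rule strong_limit_pos[where N = n]) (rule diff)
  qed
  have normal: "\<forall>D x. D \<subseteq> M \<longrightarrow> D \<noteq> {} \<longrightarrow> (\<forall>d\<in>D. positive_op d) \<longrightarrow>
        (\<forall>a\<in>D. \<forall>b\<in>D. \<exists>c\<in>D. op_le a c \<and> op_le b c) \<longrightarrow>
        x \<in> M \<longrightarrow> (\<forall>d\<in>D. op_le d x) \<longrightarrow>
        (\<forall>y\<in>M. selfadj y \<longrightarrow> (\<forall>d\<in>D. op_le d y) \<longrightarrow> op_le x y) \<longrightarrow>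
        Re (\<tau> x) = (SUP d\<in>D. Re (\<tau> d))"
    using state unfolding normal_faithful_tracial_state_def by (elim conjE)
  have mem: "1 - q n \<in> endos M" "1 - e \<in> endos M" for n using q eM by (auto intro: mem_intros)
  have "Re (\<tau> (op_of (1 - e))) = (SUP d\<in>D. Re (\<tau> d))"
  proof (rule normal[rule_format])
    show "D \<subseteq> M" using mem by (auto simp: D_def endos_def)
    show "D \<noteq> {}" by (simp add: D_def)
    show "positive_op a" if a: "a \<in> D" for a
      using a by (auto simp: D_def positive_op_iff_pos intro!: pos_q) (simp_all add: star_simps q algebra_simps)
    show "\<exists>c\<in>D. op_le a c \<and> op_le b c" if ab: "a \<in> D" "b \<in> D" for a b
    proof -
      obtain m n where "a = op_of (1 - q m)" "b = op_of (1 - q n)" using ab unfolding D_def by blast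
      then show ?thesis
        using diff[of m "max m n"] diff[of n "max m n"]
        by (intro bexI[of _ "op_of (1 - q (max m n))"]) (auto simp: D_def op_le_iff_pos)
    qed
    show "op_of (1 - e) \<in> M" using mem by (simp add: endos_def)
    show "op_le a (op_of (1 - e))" if "a \<in> D" for a
      using that qe_diff by (auto simp: D_def op_le_iff_pos)
    show "op_le (op_of (1 - e)) y" if y: "\<And>d. d \<in> D \<Longrightarrow> op_le d y" for y
    proof -
      have "pos (of_op y - (1 - q n))" for n
        using y op_le_iff_pos[of "1 - q n" "of_op y"] by (simp add: D_def)
      moreover have "strong_limit (\<lambda>n. of_op y - (1 - q n)) (of_op y - (1 - e))"
        by (intro strong_limit_diff strong_limit_const e)
      ultimately have "pos (of_op y - (1 - e))" by (rule strong_limit_pos[rotated])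
      then show ?thesis using op_le_iff_pos[of "1 - e" "of_op y"] by simp
    qed
  qed
  then have "tr (1 - e) = (SUP n. tr (1 - q n))"
    by (simp add: D_def tr_def image_image)
  also have "\<dots> \<le> c" by (rule cSUP_least) (auto simp: c)
  finally have "tr (1 - e) \<le> c" .
  then show ?thesis using that eM es ee qe by blast
qed

end

section \<open>Maximal inequality\<close>

lemma power_scaleR:
  fixes z :: "'a::unital_normed_algebra"
  shows "(c *\<^sub>R z) ^ n = c ^ n *\<^sub>R z ^ n"
  by (induction n) (simp_all add: mult.commute)

lemma one_plus_power_binomial:
  fixes z :: "'a::unital_normed_algebra"
  shows "(1 + z) ^ n = (\<Sum>j\<le>n. real (n choose j) *\<^sub>R z ^ j)"
proof (induction n)
  case (Suc n)
  let ?f = "\<lambda>j. real (n choose j) *\<^sub>R z ^ j" and ?g = "\<lambda>j. real (n choose j) *\<^sub>R z ^ Suc j"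
  have "(1 + z) ^ Suc n = sum ?f {..n} + z * sum ?f {..n}"
    by (simp only: power_Suc Suc distrib_right mult_1_left)
  also have "z * sum ?f {..n} = sum ?g {..n}" by (simp add: sum_distrib_left)
  also have "sum ?f {..n} = sum ?f {..Suc n}" by simp
  also have "sum ?f {..Suc n} = ?f 0 + (\<Sum>j\<le>n. ?f (Suc j))"
    by (rule sum.atMost_Suc_shift)
  also have "?f 0 + (\<Sum>j\<le>n. ?f (Suc j)) + sum ?g {..n} = 1 + (\<Sum>j\<le>n. ?g j + ?f (Suc j))"
    by (simp add: sum.distrib add.assoc add.commute)
  also have "\<dots> = (\<Sum>j\<le>Suc n. real (Suc n choose j) *\<^sub>R z ^ j)"
    by (subst sum.atMost_Suc_shift) (simp add: scaleR_add_left)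
  finally show ?case .
qed simp

text \<open>Lets the scalar threshold be given by the same Euler powers, evaluated at a real
  number.\<close>

instance real :: unital_normed_algebra
  by standard simp

text \<open>The coefficient of \<open>z ^ j\<close> in
  \<open>(1 + l z / n) ^ n + (1 - l z / n) ^ n\<close>, a polynomial version of
  \<open>2 cosh (l z)\<close>: odd powers cancel, the others have nonnegative coefficients.\<close>

definition cosh_coeff :: "nat \<Rightarrow> real \<Rightarrow> nat \<Rightarrow> real" where
  "cosh_coeff n l j = (if even j then 2 * real (n choose j) * (l / real n) ^ j else 0)"

lemma cosh_coeff_nonneg: "0 \<le> cosh_coeff n l j"
  by (auto simp: cosh_coeff_def)

lemma euler_power_symmetric_sum:
  fixes z :: "'a::unital_normed_algebra"
  shows "euler_power n (l *\<^sub>R z) + euler_power n ((- l) *\<^sub>R z)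
    = (\<Sum>j\<le>n. cosh_coeff n l j *\<^sub>R (z * z) ^ (j div 2))"
proof -

  have "real (n choose j) *\<^sub>R ((1 / real n) *\<^sub>R l *\<^sub>R z) ^ j + real (n choose j) *\<^sub>R ((1 / real n) *\<^sub>R (- l) *\<^sub>R z) ^ j
      = cosh_coeff n l j *\<^sub>R (z * z) ^ (j div 2)" for j
  proof (cases "even j")
    case True
    then obtain i where "j = 2 * i" by blast
    then show ?thesis
      by (simp add: cosh_coeff_def power_scaleR power_mult power2_eq_square flip: scaleR_add_left)
  next
    case False
    then have "(- (l / real n)) ^ j = - ((l / real n) ^ j)" by (rule power_minus_odd)
    then show ?thesis
      using False by (simp only: scaleR_scaleR power_scaleR) (simp add: cosh_coeff_def)
  qed
  then show ?thesis
    by (simp only: euler_power_def one_plus_power_binomial flip: sum.distrib)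
qed

lemma pos_sum:
  fixes f :: "'i \<Rightarrow> 'h::{real_inner, complete_space} endo"
  shows "(\<And>i. i \<in> I \<Longrightarrow> pos (f i)) \<Longrightarrow> pos (sum f I)"
  by (induction I rule: infinite_finite_induct) (simp_all add: pos_add, simp_all add: pos_def star_simps)

text \<open>Bernoulli's inequality for operators: the tangent of \<open>z ^ i\<close> at \<open>A\<close>.\<close>

lemma pos_tangent:
  fixes y :: "'h::{real_inner, complete_space} endo"
  assumes y: "star y = y" and A: "0 \<le> A"
  shows "pos ((y * y) ^ i - A ^ i *\<^sub>R 1 - (real i * A ^ (i - 1)) *\<^sub>R (y * y - A *\<^sub>R 1))"
proof (cases i)
  case 0
  then show ?thesis by (simp add: pos_def star_simps)
next
  case (Suc k)
  define Z where "Z = y * y"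
  define G where "G k = Z ^ Suc k - (real (Suc k) * A ^ k) *\<^sub>R Z + (real k * A ^ Suc k) *\<^sub>R 1" for k
  have Zy: "Z ^ m * y = y * Z ^ m" for m
    by (induction m) (simp_all add: Z_def mult.assoc)
  have "pos (G k)"
  proof (induction k)
    case 0
    show ?case by (simp add: G_def pos_def star_simps)
  next
    case (Suc k)
    let ?D = "Z - A *\<^sub>R 1"
    have "G k * y = y * G k" using Zy[of "Suc k"] Zy[of 1]
      by (simp add: G_def algebra_simps)
    then have "star y * G k * y = Z * G k" by (simp add: y Z_def mult.assoc)
    \<comment> \<open>Both summands are positive: \<open>Z * G k\<close> is a sandwich because
      \<open>y\<close> commutes with \<open>G k\<close>, and the other is a square with a
      nonnegative factor.\<close>
    moreover have "G (Suc k) = Z * G k + (real (Suc k) * A ^ k) *\<^sub>R (?D * ?D)"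
      by (simp add: G_def algebra_simps flip: scaleR_add_left)
    moreover have "star ?D = ?D" by (simp add: Z_def star_simps y)
    ultimately show ?case
      using pos_sandwich[OF Suc, of y] pos_star_mult[of ?D] A by (auto intro!: pos_add pos_scale)
  qed
  moreover have "(y * y) ^ i - A ^ i *\<^sub>R 1 - (real i * A ^ (i - 1)) *\<^sub>R (y * y - A *\<^sub>R 1) = G k"
    by (simp add: G_def Suc Z_def algebra_simps)
  ultimately show ?thesis by simp
qed

context trace_cond_exp
begin

text \<open>Jensen's inequality at a single vector \<open>h\<close>. \<open>F\<close> is not
  multiplicative, so the polynomial is replaced by its tangent at \<open>A\<close>, which
  \<open>F\<close> respects; comparison with \<open>le\<close> leaves
  \<open>\<kappa> * (f (X * X) - A * norm h ^ 2) \<le> 0\<close>, where \<kappa> is the derivative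
  at \<open>A\<close>. The index \<open>j0\<close> supplies a nonconstant term and thus
  \<open>\<kappa> > 0\<close>.\<close>

lemma norm_F_le_of_even_polynomial:
  assumes X: "X \<in> endos M" "star X = X" and A: "0 < A" and I: "finite I"
    and c: "\<And>j. j \<in> I \<Longrightarrow> 0 \<le> c j" and c0: "j0 \<in> I" "0 < c j0" "0 < k j0"
    and le: "inner (ap (F (\<Sum>j\<in>I. c j *\<^sub>R (X * X) ^ k j)) h) h \<le> (\<Sum>j\<in>I. c j * A ^ k j) * (norm h)\<^sup>2"
  shows "(norm (ap (F X) h))\<^sup>2 \<le> A * (norm h)\<^sup>2"
proof -
  define \<kappa> where "\<kappa> = (\<Sum>j\<in>I. c j * (real (k j) * A ^ (k j - 1)))"
  have "0 < \<kappa>"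
    unfolding \<kappa>_def using I c0 c A by (intro sum_pos2[of I j0]) auto
  define R where "R j = (X * X) ^ k j - A ^ k j *\<^sub>R 1 - (real (k j) * A ^ (k j - 1)) *\<^sub>R (X * X - A *\<^sub>R 1)" for j
  have R: "R j \<in> endos M" "pos (R j)" for j
    unfolding R_def using X A by (simp_all only: mem_intros pos_tangent less_imp_le)
  have memX: "X * X \<in> endos M" using X by (simp add: mem_intros)
  have F1: "F 1 = 1" by (rule F_id) (rule sub_intros)
  have FR: "F (R j) = F ((X * X) ^ k j) - A ^ k j *\<^sub>R 1 - (real (k j) * A ^ (k j - 1)) *\<^sub>R (F (X * X) - A *\<^sub>R 1)" for j
    using memX by (simp add: R_def F_diff F_scale F1 mem_intros)
  define f where "f T = inner (ap (F T) h) h" for T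
  have "0 \<le> f (R j)" for j unfolding f_def by (intro posD F_pos R)
  then have "0 \<le> (\<Sum>j\<in>I. c j * f (R j))"
    using c by (intro sum_nonneg mult_nonneg_nonneg) auto
  also have "\<dots> = (\<Sum>j\<in>I. c j * f ((X * X) ^ k j) - c j * A ^ k j * (norm h)\<^sup>2
      - c j * (real (k j) * A ^ (k j - 1)) * (f (X * X) - A * (norm h)\<^sup>2))"
    by (intro sum.cong refl) (simp add: f_def FR inner_simps power2_norm_eq_inner algebra_simps)
  also have "\<dots> = (\<Sum>j\<in>I. c j * f ((X * X) ^ k j)) - (\<Sum>j\<in>I. c j * A ^ k j) * (norm h)\<^sup>2
      - \<kappa> * (f (X * X) - A * (norm h)\<^sup>2)"
    by (simp add: sum_subtractf sum_distrib_right \<kappa>_def)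
  also have "(\<Sum>j\<in>I. c j * f ((X * X) ^ k j)) = inner (ap (F (\<Sum>j\<in>I. c j *\<^sub>R (X * X) ^ k j)) h) h"
    using memX by (simp add: f_def F_sum F_scale mem_intros ap_sum inner_sum_left)
  finally have "\<kappa> * (f (X * X) - A * (norm h)\<^sup>2) \<le> 0" using le by linarith
  then have "f (X * X) \<le> A * (norm h)\<^sup>2" using \<open>0 < \<kappa>\<close> by (simp add: mult_le_0_iff)
  moreover have "(norm (ap (F X) h))\<^sup>2 \<le> f (X * X)"
  proof -
    have "star (F X) = F X" using F_star[OF X(1)] X(2) by simp
    then have "(norm (ap (F X) h))\<^sup>2 = inner (ap (F X * F X) h) h"
      using inner_ap[of "F X" "ap (F X) h" h] by (simp add: power2_norm_eq_inner)
    then show ?thesis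
      using posD(2)[OF F_square_ge[OF X], of h] by (simp add: f_def inner_simps)
  qed
  ultimately show ?thesis by linarith
qed

end

context nc_probability
begin

text \<open>Turns the exponential bound into a weight \<open>W\<close> and a level \<open>t\<close>
  for the stopping construction. The last clause ranges over all conditional expectations because
  one weight serves every time in a block. The factor 8 collects the two signs of \<open>l\<close>,
  an approximation error below \<open>1 \<le> E\<close> for each, and a loss of 2 in the
  level.\<close>

lemma exponential_weight:
  assumes X: "X \<in> endos M" "star X = X" and l: "0 < l" and a: "0 < a" and E: "1 \<le> E"
    and bound: "\<exists>C. \<forall>k>0. tr (euler_power (2 ^ k) (l *\<^sub>R X)) \<le> E + C / 2 ^ k"
      "\<exists>C. \<forall>k>0. tr (euler_power (2 ^ k) ((- l) *\<^sub>R X)) \<le> E + C / 2 ^ k"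
  shows "\<exists>W t. W \<in> endos M \<and> pos W \<and> 0 < t \<and> tr W / t \<le> 8 * E * exp (- (l * a)) \<and>
    (\<forall>N F h. trace_cond_exp J M \<tau> N F \<longrightarrow> inner (ap (F W) h) h \<le> t * (norm h)\<^sup>2 \<longrightarrow>
      norm (ap (F X) h) \<le> a * norm h)"
proof -
  obtain C C' where C: "\<And>k. k > 0 \<Longrightarrow> tr (euler_power (2 ^ k) (l *\<^sub>R X)) \<le> E + C / 2 ^ k"
    "\<And>k. k > 0 \<Longrightarrow> tr (euler_power (2 ^ k) ((- l) *\<^sub>R X)) \<le> E + C' / 2 ^ k"
    using bound by blast
  have pow: "filterlim (\<lambda>k. 2 ^ k :: nat) at_top sequentially"
    by (rule filterlim_subseq) (simp add: strict_mono_def)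
  have "(\<lambda>k. (1 + l * a / real (2 ^ k)) ^ (2 ^ k)) \<longlonglongrightarrow> exp (l * a)"
    using filterlim_compose[OF tendsto_exp_limit_sequentially[of "l * a"] pow] by simp
  then have ev1: "eventually (\<lambda>k. exp (l * a) / 2 < (1 + l * a / real (2 ^ k)) ^ (2 ^ k)) sequentially"
    by (rule order_tendstoD) simp
  have small: "(\<lambda>k. D / 2 ^ k) \<longlonglongrightarrow> 0" for D :: real
    by (rule LIMSEQ_divide_realpow_zero) simp
  from ev1 order_tendstoD(2)[OF small[of C] zero_less_one] order_tendstoD(2)[OF small[of C'] zero_less_one]
    eventually_gt_at_top[of 0]
  have "eventually (\<lambda>k. exp (l * a) / 2 < (1 + l * a / real (2 ^ k)) ^ (2 ^ k) \<and> C / 2 ^ k < 1 \<and> C' / 2 ^ k < 1 \<and> 0 < k) sequentially"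
    by eventually_elim simp
  then obtain k where k: "exp (l * a) / 2 < (1 + l * a / real (2 ^ k)) ^ (2 ^ k)" "C / 2 ^ k < 1" "C' / 2 ^ k < 1" "0 < k"
    using eventually_happens sequentially_bot by blast
  define n :: nat where "n = 2 ^ k"
  define W where "W = euler_power n (l *\<^sub>R X) + euler_power n ((- l) *\<^sub>R X)"
  define t where "t = euler_power n (l *\<^sub>R a) + euler_power n ((- l) *\<^sub>R a)"
  \<comment> \<open>Evenness makes the Euler power at \<open>- l * a\<close> nonnegative even if its
    base is negative; \<open>2 \<le> n\<close> makes the coefficient of the square positive.\<close>
  have n: "even n" "2 \<le> n"
    using k(4) by (auto simp: n_def) (metis One_nat_def Suc_leI one_le_numeral power_increasing power_one_right)
  have W_eq: "W = (\<Sum>j\<le>n. cosh_coeff n l j *\<^sub>R (X * X) ^ (j div 2))"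
    unfolding W_def by (rule euler_power_symmetric_sum)
  have t_eq: "t = (\<Sum>j\<le>n. cosh_coeff n l j * (a\<^sup>2) ^ (j div 2))"
    unfolding t_def by (subst euler_power_symmetric_sum) (simp add: power2_eq_square)
  have t_ge: "exp (l * a) / 2 \<le> t"
  proof -
    have "0 \<le> euler_power n ((- l) *\<^sub>R a)" using n by (simp add: euler_power_def zero_le_even_power)
    then show ?thesis using k(1) by (simp add: t_def euler_power_def n_def)
  qed
  then have t0: "0 < t" using exp_gt_zero[of "l * a"] by linarith
  have WM: "W \<in> endos M" using X by (simp add: W_def euler_power_mem mem_intros)
  have WP: "pos W"
  proof -
    have "pos (cosh_coeff n l j *\<^sub>R (X * X) ^ (j div 2))" for j
      using pos_power[OF pos_star_mult[of X]] X by (simp add: pos_scale cosh_coeff_nonneg)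
    then show ?thesis unfolding W_eq by (rule pos_sum)
  qed
  have "tr W = tr (euler_power n (l *\<^sub>R X)) + tr (euler_power n ((- l) *\<^sub>R X))"
    unfolding W_def using X by (intro tr_add euler_power_mem mem_intros)
  also have "\<dots> \<le> 4 * E" using C[OF k(4)] k(2,3) E unfolding n_def by linarith
  finally have trW: "tr W \<le> 4 * E" .
  have "tr W / t \<le> (4 * E) / (exp (l * a) / 2)"
    using trW t_ge t0 tr_pos_nonneg[OF WM WP] by (intro frac_le) auto
  also have "\<dots> = 8 * E * exp (- (l * a))" by (simp add: exp_minus field_simps)
  finally have ratio: "tr W / t \<le> 8 * E * exp (- (l * a))" .
  have "norm (ap (F X) h) \<le> a * norm h"
    if F: "trace_cond_exp J M \<tau> N F" and le: "inner (ap (F W) h) h \<le> t * (norm h)\<^sup>2" for N F h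
  proof -
    interpret F: trace_cond_exp J M \<tau> N F by fact
    have "0 < cosh_coeff n l 2" using n l by (simp add: cosh_coeff_def)
    then have "(norm (ap (F X) h))\<^sup>2 \<le> a\<^sup>2 * (norm h)\<^sup>2"
      using X a n le by (intro F.norm_F_le_of_even_polynomial[where I = "{..n}" and c = "cosh_coeff n l" and k = "\<lambda>j. j div 2" and ?j0.0 = 2])
        (auto simp: cosh_coeff_nonneg W_eq t_eq)
    also have "\<dots> = (a * norm h)\<^sup>2" by (simp add: power_mult_distrib)
    finally show ?thesis by (rule power2_le_imp_le) (use a in simp)
  qed
  then show ?thesis using WM WP t0 ratio by blast
qed

text \<open>\<open>b n\<close> is the block of time \<open>n\<close>. Each cut \<open>d n\<close> is
  charged to the weight of its block. The cuts are projections adding up to \<open>1 - q R\<close>,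
  so all charges to block \<open>m\<close> together cost at most \<open>tr (W m) / T m\<close>,
  however many times belong to it.\<close>

lemma maximal_inequality:
  fixes Nk :: "nat \<Rightarrow> 'h op set" and F :: "nat \<Rightarrow> 'h endo \<Rightarrow> 'h endo"
    and W :: "nat \<Rightarrow> 'h endo" and T :: "nat \<Rightarrow> real" and b :: "nat \<Rightarrow> nat"
  assumes F: "\<And>n. trace_cond_exp J M \<tau> (Nk n) (F n)" and Nk: "mono Nk"
    and W: "\<And>m. W m \<in> endos M" "\<And>m. pos (W m)" and T: "\<And>m. 0 < T m"
    and c: "\<And>R. (\<Sum>m<R. tr (W m) / T m) \<le> c"
  obtains e where "e \<in> endos M" "star e = e" "e * e = e" "tr (1 - e) \<le> c"
    "\<And>n h. n > 0 \<Longrightarrow> inner (ap (F n (W (b n))) (ap e h)) (ap e h) \<le> T (b n) * (norm (ap e h))\<^sup>2"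
proof -
  have vNk: "von_neumann_algebra J (Nk n)" "Nk n \<subseteq> M" for n
    using F[of n] by (auto simp: trace_cond_exp_def trace_cond_exp_axioms_def)
  have Nk_mem: "y \<in> endos M" if "y \<in> endos (Nk n)" for y n
    using vNk(2)[of n] that by (auto simp: endos_def)
  have Nk_Suc: "y \<in> endos (Nk (Suc n))" if "y \<in> endos (Nk n)" for y n
    using monoD[OF Nk, of n "Suc n"] that by (auto simp: endos_def)
  define Y where "Y n = F n (W (b n))" for n
  have Y: "Y n \<in> endos (Nk n)" "star (Y n) = Y n" for n
    using trace_cond_exp.F_mem[OF F W(1)] posD(1)[OF trace_cond_exp.F_pos[OF F W]] by (auto simp: Y_def)
  \<comment> \<open>The construction starts at 1 and cuts at the times \<open>Suc n\<close>, so it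
    gives control for positive times.\<close>
  define P where "P n q \<longleftrightarrow> q \<in> endos (Nk n) \<and> star q = q \<and> q * q = q \<and> (n = 0 \<longrightarrow> q = 1)" for n and q :: "'h endo"
  define Q where "Q n q r \<longleftrightarrow> q * r = r \<and> r * q = r \<and>
      pos (T (b (Suc n)) *\<^sub>R r - r * Y (Suc n) * r) \<and> T (b (Suc n)) * tr (q - r) \<le> tr ((q - r) * Y (Suc n))" for n q r
  have "\<exists>q. \<forall>n. P n (q n) \<and> Q n (q n) (q (Suc n))"
  proof (rule dependent_nat_choice)
    show "\<exists>q. P 0 q"
      using unital_subalgebraD(1)[OF endos_subalgebra[OF vNk(1)]] by (intro exI[of _ 1]) (simp add: P_def star_simps)
    fix q n assume "P n q"
    then have "q \<in> endos (Nk (Suc n))" "star q = q" "q * q = q" by (auto simp: P_def Nk_Suc)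
    from Cuculescu_step[OF vNk this Y, of "T (b (Suc n))"]
    show "\<exists>r. P (Suc n) r \<and> Q n q r" unfolding P_def Q_def by (metis nat.distinct(1))
  qed
  then obtain q where q: "\<And>n. P n (q n)" and qq: "\<And>n. Q n (q n) (q (Suc n))" by blast
  have q_simps: "q n \<in> endos (Nk n)" "star (q n) = q n" "q n * q n = q n" "q 0 = 1" for n
    using q[of n] q[of 0] by (auto simp: P_def)
  have q_dec: "q n * q (Suc n) = q (Suc n)" "q (Suc n) * q n = q (Suc n)" for n
    using qq[of n] by (auto simp: Q_def)
  define d where "d n = q n - q (Suc n)" for n
  have d: "d n \<in> endos (Nk (Suc n))" "star (d n) = d n" "d n * d n = d n" for n
    using unital_subalgebraD(6)[OF endos_subalgebra[OF vNk(1)] Nk_Suc[OF q_simps(1)] q_simps(1)]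
    by (simp_all add: d_def star_simps q_simps algebra_simps q_dec)
  \<comment> \<open>Charges are recorded against every \<open>m\<close>, also unrelated ones; being
    nonnegative they only enlarge the double sum, whose order can be exchanged.\<close>
  define g where "g n m = tr (d n * W m) / T m" for n m
  have g_nn: "0 \<le> g n m" for n m
    unfolding g_def using tr_projection_nonneg[OF W Nk_mem[OF d(1)] d(2,3)] T[of m] by simp
  have step: "tr (d n) \<le> g n (b (Suc n))" for n
  proof -
    have "T (b (Suc n)) * tr (d n) \<le> tr (d n * Y (Suc n))"
      using qq[of n] by (simp add: Q_def d_def)
    also have "\<dots> = tr (d n * W (b (Suc n)))"
      unfolding Y_def by (rule trace_cond_exp.tr_F[OF F d(1) W(1)])
    finally show ?thesis using T[of "b (Suc n)"] by (simp add: g_def pos_le_divide_eq mult.commute)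
  qed
  have mem: "q n \<in> endos M" "d n \<in> endos M" for n
    using Nk_mem q_simps(1) d(1) by blast+
  have tele: "1 - q R = (\<Sum>n<R. d n)" for R
  proof (induction R)
    case (Suc R)
    have "1 - q (Suc R) = (1 - q R) + d R" by (simp add: d_def)
    then show ?case by (simp add: Suc)
  qed (simp add: q_simps)
  have tr_sum: "tr (sum f {..<R}) = (\<Sum>n<R. tr (f n))" if "\<And>n. f n \<in> endos M" for f and R :: nat
  proof (induction R)
    case 0
    show ?case using tr_scale[OF one_mem, of 0] by simp
  next
    case (Suc R)
    then show ?case
      using that unital_subalgebra_sum[OF unital_subalgebra_carrier, of "{..<R}" f] by (simp add: tr_add)
  qed
  have tr_q: "tr (1 - q R) \<le> c" for R
  proof -
    define S where "S = Suc (\<Sum>n<R. b (Suc n))"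
    have bS: "b (Suc n) < S" if "n < R" for n
      using member_le_sum[of n "{..<R}" "\<lambda>n. b (Suc n)"] that by (simp add: S_def)
    have "tr (1 - q R) = (\<Sum>n<R. tr (d n))" by (simp add: tele tr_sum mem)
    also have "\<dots> \<le> (\<Sum>n<R. \<Sum>m<S. g n m)"
      using bS g_nn
      by (intro sum_mono order_trans[OF step] member_le_sum[where f = "g _"]) auto
    also have "\<dots> = (\<Sum>m<S. \<Sum>n<R. g n m)" by (rule sum.swap)
    also have "\<dots> \<le> (\<Sum>m<S. tr (W m) / T m)"
    proof (rule sum_mono)
      fix m
      have "(\<Sum>n<R. tr (d n * W m)) = tr ((1 - q R) * W m)"
        using mem W by (simp add: tele sum_distrib_right tr_sum mem_intros)
      also have "\<dots> = tr (W m) - tr (q R * W m)"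
        using mem W by (simp add: left_diff_distrib tr_diff mem_intros)
      also have "\<dots> \<le> tr (W m)"
        using tr_projection_nonneg[OF W mem(1) q_simps(2,3)] by simp
      finally show "(\<Sum>n<R. g n m) \<le> tr (W m) / T m"
        using T[of m] by (simp add: g_def divide_right_mono flip: sum_divide_distrib)
    qed
    also have "\<dots> \<le> c" by (rule c)
    finally show ?thesis .
  qed
  obtain e where e: "e \<in> endos M" "star e = e" "e * e = e" "\<And>n. q n * e = e" "tr (1 - e) \<le> c"
    using tr_decreasing_projections[where q = q and c = c, OF mem(1) q_simps(2,3) q_dec tr_q] by blast
  have "inner (ap (F n (W (b n))) (ap e h)) (ap e h) \<le> T (b n) * (norm (ap e h))\<^sup>2" if "n > 0" for n h
  proof -
    obtain m where n: "n = Suc m" using gr0_implies_Suc[OF \<open>n > 0\<close>] by blast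
    define y where "y = ap e h"
    have qy: "ap (q n) y = y" unfolding y_def ap_simps(6)[symmetric] e(4) ..
    have "0 \<le> inner (ap (T (b n) *\<^sub>R q n - q n * Y n * q n) y) y"
      using qq[of m] by (intro posD) (simp add: Q_def n)
    also have "\<dots> = T (b n) * (norm y)\<^sup>2 - inner (ap (Y n) y) y"
      using inner_ap[of "q n" "ap (Y n) y" y] by (simp add: inner_simps qy q_simps power2_norm_eq_inner)
    finally show ?thesis by (simp add: y_def Y_def)
  qed
  then show ?thesis using that e by blast
qed

end

section \<open>Law of the iterated logarithm\<close>

lemma LL_ge: "1 \<le> LL t" "ln (ln t) \<le> LL t"
  by (simp_all add: LL_def)

text \<open>The hypothesis involves the iterated logarithm at \<open>V j\<close>, but block
  \<open>k\<close> needs it at the end of the block, also for early \<open>j\<close>. The split is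
  at \<open>r k\<close>, the square root of \<open>(9/8) ^ k\<close>. Above it the iterated
  logarithm has dropped by at most \<open>ln 2\<close>, hence at most by half, and
  \<open>\<alpha> j\<close> is small. Below it the crude bounds \<open>V j \<le> r k\<close> and
  \<open>\<Lambda> k \<le> k\<close> win, since \<open>r k\<close> outgrows
  \<open>k\<close>.\<close>

lemma eventually_increments_small:
  fixes V \<delta> \<alpha> :: "nat \<Rightarrow> real"
  assumes V: "incseq V" "\<And>j. 0 \<le> V j" and \<alpha>: "\<alpha> \<longlonglongrightarrow> 0" and \<theta>: "0 < \<theta>"
    and \<delta>: "\<And>j. j \<ge> 1 \<Longrightarrow> 0 \<le> \<delta> j" "\<And>j. j \<ge> 1 \<Longrightarrow> \<delta> j \<le> \<alpha> j * sqrt (V j) / sqrt (LL (V j))"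
  shows "\<forall>\<^sub>F k in sequentially. \<forall>j\<ge>1. V j \<le> (9/8) ^ k \<longrightarrow>
    (\<delta> j)\<^sup>2 * ln (real k * ln (9/8)) \<le> \<theta> * (9/8) ^ k"
proof -
  define y r :: "nat \<Rightarrow> real" where "y k = (9/8) ^ k" and "r k = sqrt (9/8) ^ k" for k
  define \<Lambda> where "\<Lambda> k = ln (real k * ln (9/8))" for k :: nat
  have ln98: "0 < ln (9/8 :: real)" "ln (9/8 :: real) \<le> 1/8"
    using ln_le_minus_one[of "9/8 :: real"] by simp_all
  have yr: "y k = r k * r k" "1 \<le> r k" "0 < r k" for k
    by (simp_all add: y_def r_def flip: power_mult_distrib)
  have ln_r: "ln (r k) = real k * ln (9/8) / 2" for k
    by (simp add: r_def ln_realpow ln_sqrt)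
  obtain A where A: "\<And>j. (\<alpha> j)\<^sup>2 \<le> A" "0 < A"
  proof -
    have "Bseq \<alpha>" using \<alpha> convergentI convergent_imp_Bseq by blast
    then obtain K where K: "0 < K" "\<And>j. norm (\<alpha> j) \<le> K" by (auto simp: Bseq_def)
    have "(\<alpha> j)\<^sup>2 \<le> K\<^sup>2" for j using power_mono[OF K(2)[of j], of 2] by simp
    then show ?thesis using that[of "K\<^sup>2"] K(1) by simp
  qed
  have "(\<lambda>j. (\<alpha> j)\<^sup>2) \<longlonglongrightarrow> 0\<^sup>2" by (intro tendsto_intros \<alpha>)
  then have "eventually (\<lambda>j. (\<alpha> j)\<^sup>2 < \<theta> / 2) sequentially"
    using \<theta> by (intro order_tendstoD(2)[where y = 0]) simp_all
  then obtain J where J: "\<And>j. j \<ge> J \<Longrightarrow> (\<alpha> j)\<^sup>2 < \<theta> / 2"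
    by (auto simp: eventually_sequentially)
  have sq: "(\<delta> j)\<^sup>2 * LL (V j) \<le> (\<alpha> j)\<^sup>2 * V j" if "j \<ge> 1" for j
  proof -
    have "(\<delta> j)\<^sup>2 \<le> (\<alpha> j * sqrt (V j) / sqrt (LL (V j)))\<^sup>2"
      by (intro power_mono \<delta> that)
    also have "\<dots> = (\<alpha> j)\<^sup>2 * V j / LL (V j)"
      using V(2)[of j] LL_ge(1)[of "V j"] by (simp add: power_divide power_mult_distrib)
    finally show ?thesis using LL_ge(1)[of "V j"] by (simp add: pos_le_divide_eq)
  qed
  have "filterlim (\<lambda>k. real k * ln (9/8)) at_top sequentially"
    using ln98 by (intro filterlim_at_top_mult_tendsto_pos[OF tendsto_const] filterlim_real_sequentially)
  then have "filterlim \<Lambda> at_top sequentially"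
    unfolding \<Lambda>_def by (rule filterlim_compose[OF ln_at_top])
  then have ev1: "eventually (\<lambda>k. 2 * ln 2 \<le> \<Lambda> k) sequentially"
    by (simp add: filterlim_at_top)
  have "filterlim r at_top sequentially"
    unfolding r_def
    by (intro filterlim_at_infinity_imp_filterlim_at_top filterlim_realpow_sequentially_gt1) simp_all
  then have ev2: "eventually (\<lambda>k. V J < r k) sequentially"
    by (simp add: filterlim_at_top_dense)
  have "(\<lambda>k. real k * (1 / sqrt (9/8)) ^ k) \<longlonglongrightarrow> 0"
    using powser_times_n_limit_0[of "1 / sqrt (9/8) :: real"] by simp
  then have "eventually (\<lambda>k. real k * (1 / sqrt (9/8)) ^ k < \<theta> / A) sequentially"
    by (rule order_tendstoD) (simp add: \<theta> A)
  then have ev3: "eventually (\<lambda>k. A * real k \<le> \<theta> * r k) sequentially"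
  proof (rule eventually_mono)
    fix k assume "real k * (1 / sqrt (9/8)) ^ k < \<theta> / A"
    then have "real k / r k < \<theta> / A" by (simp add: r_def power_divide)
    then show "A * real k \<le> \<theta> * r k" using yr(3)[of k] A(2) by (simp add: field_simps)
  qed
  show ?thesis
    using ev1 ev2 ev3 eventually_gt_at_top[of 0]
  proof eventually_elim
    case (elim k)
    have \<Lambda>0: "0 < \<Lambda> k" using elim(1) ln_gt_zero[of "2 :: real"] by linarith
    have kpos: "0 < real k * ln (9/8)" using elim(4) ln98 by simp
    have "\<Lambda> k \<le> real k * ln (9/8)"
      using ln_le_minus_one[OF kpos] by (simp add: \<Lambda>_def)
    also have "\<dots> \<le> real k" using ln98 by (intro mult_left_le) auto
    finally have \<Lambda>k: "\<Lambda> k \<le> real k" .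
    have "(\<delta> j)\<^sup>2 * \<Lambda> k \<le> \<theta> * y k" if j: "j \<ge> 1" "V j \<le> y k" for j
    proof (cases "V j \<le> r k")
      case True
      have "(\<delta> j)\<^sup>2 \<le> (\<delta> j)\<^sup>2 * LL (V j)" using LL_ge(1)[of "V j"] by (simp add: mult_left_le_imp_le mult_le_cancel_left1)
      also have "\<dots> \<le> (\<alpha> j)\<^sup>2 * V j" by (rule sq[OF j(1)])
      also have "\<dots> \<le> A * r k" using A True V(2) by (intro mult_mono) auto
      finally have "(\<delta> j)\<^sup>2 * \<Lambda> k \<le> (A * r k) * real k"
        using \<Lambda>0 \<Lambda>k A(2) yr(3)[of k] by (intro mult_mono) auto
      also have "\<dots> \<le> \<theta> * y k"
        using mult_right_mono[OF elim(3), of "r k"] yr(3)[of k] by (simp add: yr(1) mult.commute mult.left_commute)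
      finally show ?thesis .
    next
      case False
      then have "j \<ge> J" using elim(2) incseqD[OF V(1), of j J] by (cases "j \<ge> J") auto
      have "0 < ln (r k)" using kpos by (simp add: ln_r)
      moreover have "ln (r k) \<le> ln (V j)" using False yr(3)[of k] by simp
      ultimately have "ln (ln (r k)) \<le> ln (ln (V j))" by simp
      moreover have "ln (ln (r k)) = \<Lambda> k - ln 2"
        using kpos ln98 elim(4) by (simp add: ln_r \<Lambda>_def ln_div ln_mult)
      ultimately have "\<Lambda> k / 2 \<le> LL (V j)" using elim(1) LL_ge(2)[of "V j"] by linarith
      then have "(\<delta> j)\<^sup>2 * (\<Lambda> k / 2) \<le> (\<delta> j)\<^sup>2 * LL (V j)" by (intro mult_left_mono) auto
      also have "\<dots> \<le> (\<alpha> j)\<^sup>2 * V j" by (rule sq[OF j(1)])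
      also have "\<dots> \<le> (\<theta> / 2) * y k"
        using J[OF \<open>j \<ge> J\<close>] j(2) V(2) \<theta> by (intro mult_mono) auto
      finally show ?thesis by simp
    qed
    then show ?case by (simp add: y_def \<Lambda>_def)
  qed
qed

context nc_probability
begin

text \<open>\<open>V\<close> is the square of \<open>s\<close>. The bound holds with the constant 2
  itself from some time on, and is stated for vectors in the range of \<open>e\<close>, the form
  that the stopping construction delivers.\<close>

theorem law_of_iterated_logarithm:
  fixes Nk :: "nat \<Rightarrow> 'h op set" and F :: "nat \<Rightarrow> 'h endo \<Rightarrow> 'h endo"
    and x :: "nat \<Rightarrow> 'h endo" and V \<alpha> :: "nat \<Rightarrow> real"
  assumes F: "\<And>n. trace_cond_exp J M \<tau> (Nk n) (F n)" and Nk: "mono Nk"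
    and x0: "x 0 = 0" and x: "\<And>n. x n \<in> endos (Nk n)" "\<And>n. star (x n) = x n"
    and mart: "\<And>n. F n (x (Suc n)) = x n"
    and V: "\<And>n. V n = norm (\<Sum>j<n. F j ((x (Suc j) - x j) * (x (Suc j) - x j)))"
    and V_lim: "filterlim V at_top sequentially"
    and \<alpha>: "\<alpha> \<longlonglongrightarrow> 0"
    and bound: "\<And>n. norm (x (Suc n) - x n) \<le> \<alpha> (Suc n) * sqrt (V (Suc n)) / sqrt (LL (V (Suc n)))"
    and \<epsilon>: "0 < \<epsilon>"
  obtains e where "e \<in> endos M" "star e = e" "e * e = e" "tr (1 - e) < \<epsilon>"
    "\<forall>\<^sub>F n in sequentially. \<forall>h. norm (ap (x n) (ap e h)) \<le> 2 * sqrt (V n) * sqrt (LL (V n)) * norm (ap e h)"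
proof -
  have vNk: "von_neumann_algebra J (Nk n)" "Nk n \<subseteq> M" for n
    using F[of n] by (auto simp: trace_cond_exp_def trace_cond_exp_axioms_def)
  have sub: "unital_subalgebra (endos (Nk n))" "endos (Nk n) \<subseteq> endos M" for n
    using endos_subalgebra[OF vNk(1)] vNk(2)[of n] by (auto simp: endos_def)
  have mono_endos: "mono (\<lambda>n. endos (Nk n))"
    using Nk by (auto simp: mono_def endos_def)
  have xM: "x n \<in> endos M" for n using x(1) sub(2) by blast
  define D where "D j = x (Suc j) - x j" for j
  define v where "v j = F j (D j * D j)" for j
  have D: "D j \<in> endos M" "star (D j) = D j" for j
    using xM x(2) by (auto simp: D_def mem_intros star_simps)
  have DD: "D j * D j \<in> endos M" "pos (D j * D j)" for j
    using D pos_star_mult[of "D j"] by (simp_all add: mem_intros)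
  have v: "v j \<in> endos (Nk j)" "pos (v j)" "norm (v j) \<le> (norm (D j))\<^sup>2" for j
    unfolding v_def
    using trace_cond_exp.F_mem[OF F DD(1)] trace_cond_exp.F_pos[OF F DD]
      trace_cond_exp.norm_F_square_le[OF F D] by blast+
  have V_eq: "V n = norm (\<Sum>j<n. v j)" for n by (simp add: V v_def D_def)
  have "incseq V"
  proof (rule incseq_SucI)
    fix n
    have "pos (\<Sum>j<n. v j)" "pos ((\<Sum>j<Suc n. v j) - (\<Sum>j<n. v j))"
      using v(2) by (auto intro: pos_sum)
    then show "V n \<le> V (Suc n)" unfolding V_eq by (rule norm_pos_mono)
  qed
  have V0: "V 0 = 0" "0 \<le> V n" for n by (simp_all add: V)
  have tr_F: "tr (y * F j T) = tr (y * T)" if "y \<in> endos (Nk j)" "T \<in> endos M" for y j T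
    using trace_cond_exp.tr_F[OF F that] .
  have exp_bound: "\<exists>C. \<forall>k>0. tr (euler_power (2 ^ k) (l *\<^sub>R x N)) \<le> exp (2 / 3 * l\<^sup>2 * K) + C / 2 ^ k"
    if "\<And>j. j < N \<Longrightarrow> \<bar>l\<bar> * norm (D j) \<le> 1 / 10" "V N \<le> K" for l N K
  proof (rule martingale_exponential_bound[OF sub mono_endos x0 x v(1)])
    show "star (v j) = v j" for j by (rule posD[OF v(2)])
    show "tr (y * (x (Suc j) - x j)) = 0" if "y \<in> endos (Nk j)" for j y
    proof -
      have "tr (y * (x (Suc j) - x j)) = tr (y * x (Suc j)) - tr (y * F j (x (Suc j)))"
        using that xM sub(2)[of j] unfolding mart right_diff_distrib by (intro tr_diff mem_intros) auto
      then show ?thesis using tr_F[OF that xM] by simp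
    qed
    show "tr (y * ((x (Suc j) - x j) * (x (Suc j) - x j))) = tr (y * v j)" if "y \<in> endos (Nk j)" for j y
      using tr_F[OF that DD(1)] by (simp add: v_def D_def)
    show "norm (\<Sum>j<N. v j) \<le> K" using that(2) by (simp add: V_eq)
  qed (use v(3) that(1) in \<open>auto simp: D_def\<close>)
  have mart': "F n (x m) = x n" if "n \<le> m" for n m
  proof (rule trace_cond_exp.F_unique[OF F xM x(1)])
    fix a assume a: "a \<in> endos (Nk n)"
    show "tr (a * x n) = tr (a * x m)" using that
    proof (induction rule: dec_induct)
      case (step m)
      have "a \<in> endos (Nk m)" using monoD[OF mono_endos step(1)] a by blast
      then show ?case using tr_F[OF _ xM, of a m "Suc m"] step.IH by (simp add: mart)
    qed simp
  qed
  \<comment> \<open>Block \<open>k\<close> ends at \<open>y k\<close> and begins at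
    \<open>lo k\<close>; the threshold uses \<open>lo k\<close>, the exponential bound uses
    \<open>y k\<close>.\<close>
  define y lo L :: "nat \<Rightarrow> real" where "y k = (9/8) ^ k" and "lo k = (8/9) * y k" and "L k = ln (ln (lo k))" for k
  have y: "0 < y k" "0 < lo k" "y (Suc k) = 9/8 * y k" for k by (simp_all add: y_def lo_def)
  have y_mono: "y k \<le> y m" if "k \<le> m" for k m
    unfolding y_def using that by (intro power_increasing) auto
  have ln98: "0 < ln (9/8 :: real)" by simp
  have ln_lo: "ln (lo k) = (real k - 1) * ln (9/8)" for k
  proof -
    have "lo k = y k / (9/8)" by (simp add: lo_def)
    then have "ln (lo k) = ln (y k) - ln (9/8)" using y(1)[of k] by (simp only: ln_div) simp
    also have "ln (y k) = real k * ln (9/8)" by (simp only: y_def ln_realpow)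
    finally show ?thesis by (simp add: left_diff_distrib)
  qed
  define f where "f k = 8 * exp (- (4/3 * L k))" for k
  have "filterlim y at_top sequentially"
    unfolding y_def
    by (intro filterlim_at_infinity_imp_filterlim_at_top filterlim_realpow_sequentially_gt1) simp_all
  then have y_lim: "eventually (\<lambda>k. C < y k) sequentially" for C by (simp add: filterlim_at_top_dense)
  have f_summable: "summable f"
  proof -
    \<comment> \<open>The shift by two is due to \<open>ln (lo k) = (k - 1) * ln (9/8)\<close>,
      which is positive only from \<open>k = 2\<close> on.\<close>
    have "f (Suc (Suc k)) = (8 * ln (9/8) powr (-4/3)) * real (Suc k) powr (-4/3)" for k
      using ln98 by (simp add: f_def L_def ln_lo powr_def ln_mult distrib_left flip: exp_add)
    moreover have "summable (\<lambda>k. (8 * ln (9/8 :: real) powr (-4/3)) * real (Suc k) powr (-4/3))"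
      using summable_Suc_iff[of "\<lambda>k. real k powr (-4/3)"] summable_real_powr_iff[of "-4/3"]
      by (intro summable_mult) simp
    ultimately have "summable (\<lambda>k. f (Suc (Suc k)))" by simp
    then show ?thesis
      using summable_Suc_iff[of f] summable_Suc_iff[of "\<lambda>k. f (Suc k)"] by simp
  qed
  have "\<exists>n0. \<forall>m\<ge>n0. \<forall>n. norm (sum f {m..<n}) < \<epsilon> / 2"
    using f_summable \<epsilon> unfolding summable_Cauchy by (meson half_gt_zero)
  then have ev1: "eventually (\<lambda>m. \<forall>n. norm (sum f {m..<n}) < \<epsilon> / 2) sequentially"
    by (simp add: eventually_sequentially)
  \<comment> \<open>\<open>1/200\<close> is half of \<open>(1/10)^2\<close>; the factor 2 comes from
    \<open>l^2 * y k = 2 * L k\<close> for the parameter \<open>l\<close> chosen below.\<close>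
  have ev2: "eventually (\<lambda>k. \<forall>j\<ge>1. V j \<le> (9/8) ^ k \<longrightarrow>
      (norm (x j - x (j - 1)))\<^sup>2 * ln (real k * ln (9/8)) \<le> 1/200 * (9/8) ^ k) sequentially"
  proof (rule eventually_increments_small[OF \<open>incseq V\<close> V0(2) \<alpha>])
    show "norm (x j - x (j - 1)) \<le> \<alpha> j * sqrt (V j) / sqrt (LL (V j))" if "j \<ge> 1" for j
      using bound[of "j - 1"] that by simp
  qed auto
  from ev1 ev2 y_lim[of "9/8 * exp 1"] eventually_gt_at_top[of 1]
  have "eventually (\<lambda>k. (\<forall>n. norm (sum f {k..<n}) < \<epsilon> / 2) \<and>
      (\<forall>j\<ge>1. V j \<le> (9/8) ^ k \<longrightarrow> (norm (x j - x (j - 1)))\<^sup>2 * ln (real k * ln (9/8)) \<le> 1/200 * (9/8) ^ k) \<and>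
      9/8 * exp 1 < y k \<and> 1 < k) sequentially"
    by eventually_elim blast
  then obtain k0 where k0: "\<forall>k\<ge>k0. (\<forall>n. norm (sum f {k..<n}) < \<epsilon> / 2) \<and>
      (\<forall>j\<ge>1. V j \<le> (9/8) ^ k \<longrightarrow> (norm (x j - x (j - 1)))\<^sup>2 * ln (real k * ln (9/8)) \<le> 1/200 * (9/8) ^ k) \<and>
      9/8 * exp 1 < y k \<and> 1 < k"
    unfolding eventually_sequentially by blast
  then have k0_inc: "\<And>k j. k \<ge> k0 \<Longrightarrow> j \<ge> 1 \<Longrightarrow> V j \<le> (9/8) ^ k \<Longrightarrow>
      (norm (x j - x (j - 1)))\<^sup>2 * ln (real k * ln (9/8)) \<le> 1/200 * (9/8) ^ k"
    and k0_y: "\<And>k. k \<ge> k0 \<Longrightarrow> 9/8 * exp 1 < y k" and k0_gt: "\<And>k. k \<ge> k0 \<Longrightarrow> 1 < k"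
    by blast+
  have "norm (sum f {k0..<n}) < \<epsilon> / 2" for n using k0 by blast
  then have sum_small: "sum f {k0..<n} < \<epsilon> / 2" for n
    using abs_ge_self[of "sum f {k0..<n}"] by (metis real_norm_def order_le_less_trans)
  have L_pos: "0 < L k" "1 < ln (lo k)" if "k \<ge> k0" for k
  proof -
    have "exp 1 < lo k" using k0_y[OF that] by (simp add: lo_def)
    then have "ln (exp 1) < ln (lo k)" using y(2)[of k] by (subst ln_less_cancel_iff) auto
    then show "1 < ln (lo k)" by simp
    then show "0 < L k" by (simp add: L_def)
  qed
  have increment: "(norm (D j))\<^sup>2 * L k \<le> 1/200 * y k" if "k \<ge> k0" "V (Suc j) \<le> y k" for j k
  proof -
    have "L k \<le> ln (real k * ln (9/8))"
      unfolding L_def using L_pos(2)[OF that(1)] ln98 k0_gt[OF that(1)]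
      by (simp add: ln_lo)
    then have "(norm (D j))\<^sup>2 * L k \<le> (norm (D j))\<^sup>2 * ln (real k * ln (9/8))"
      by (intro mult_left_mono) auto
    also have "\<dots> \<le> 1/200 * y k"
      using k0_inc[OF that(1), of "Suc j"] that(2) by (simp add: D_def y_def)
    finally show ?thesis .
  qed
  \<comment> \<open>The end of block \<open>k\<close>: the last time at which \<open>V\<close> has
    not exceeded \<open>y k\<close>. It exists since \<open>V 0 = 0\<close> and \<open>V\<close>
    tends to infinity.\<close>
  have "\<exists>N. V N \<le> y k \<and> (\<forall>n. V n \<le> y k \<longrightarrow> n \<le> N)" for k
  proof -
    obtain m where m: "\<And>n. n \<ge> m \<Longrightarrow> y k < V n"
      using V_lim by (auto simp: filterlim_at_top_dense eventually_sequentially)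
    have "finite {n. V n \<le> y k}"
      by (rule finite_subset[of _ "{..<m}"]) (use m not_le in \<open>auto intro: leI\<close>)
    moreover have "0 \<in> {n. V n \<le> y k}" using V0(1) y(1)[of k] by simp
    ultimately show ?thesis
      by (intro exI[of _ "Max {n. V n \<le> y k}"]) (use Max_in[of "{n. V n \<le> y k}"] in auto)
  qed
  then obtain N where N: "\<And>k. V (N k) \<le> y k" "\<And>k n. V n \<le> y k \<Longrightarrow> n \<le> N k" by metis
  define a where "a k = 2 * sqrt (lo k * L k)" for k
  define good where "good k W t \<longleftrightarrow> W \<in> endos M \<and> pos W \<and> 0 < t \<and> tr W / t \<le> f k \<and>
      (\<forall>N' F' h. trace_cond_exp J M \<tau> N' F' \<longrightarrow> inner (ap (F' W) h) h \<le> t * (norm h)\<^sup>2 \<longrightarrow>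
        norm (ap (F' (x (N k))) h) \<le> a k * norm h)" for k W t
  have "\<exists>W t. good k W t" if k: "k \<ge> k0" for k
  proof -
    note Lk = L_pos[OF k]
    have a_pos: "0 < a k" using y(2)[of k] Lk by (simp add: a_def)
    have a_sq: "(a k)\<^sup>2 = 32/9 * y k * L k"
      using y[of k] Lk by (simp add: a_def power_mult_distrib lo_def)
    \<comment> \<open>This \<open>l\<close> minimizes
      \<open>(2/3) * l^2 * y k - l * a k\<close>.\<close>
    define l where "l = 3/4 * a k / y k"
    have l: "0 < l" using a_pos y[of k] by (simp add: l_def)
    have l_sq: "l\<^sup>2 * y k = 2 * L k"
      using y(1)[of k] by (simp add: l_def power_divide power_mult_distrib a_sq) (simp add: power2_eq_square)
    have la: "l * a k = 8/3 * L k"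
    proof -
      have "l * a k = 3/4 * (a k)\<^sup>2 / y k" by (simp add: l_def power2_eq_square)
      then show ?thesis using y(1)[of k] by (simp add: a_sq)
    qed
    define E where "E = exp (2 / 3 * l\<^sup>2 * y k)"
    have E: "E = exp (4/3 * L k)" using l_sq by (simp add: E_def mult.assoc)
    have small: "\<bar>l\<bar> * norm (D j) \<le> 1 / 10" if "j < N k" for j
    proof -
      have "V (Suc j) \<le> y k" using incseqD[OF \<open>incseq V\<close>, of "Suc j" "N k"] that N(1)[of k] by simp
      have "l\<^sup>2 * ((norm (D j))\<^sup>2 * y k) = (norm (D j))\<^sup>2 * (l\<^sup>2 * y k)" by simp
      also have "\<dots> \<le> 1/100 * y k"
        using increment[OF k \<open>V (Suc j) \<le> y k\<close>] by (simp add: l_sq)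
      finally have "l\<^sup>2 * ((norm (D j))\<^sup>2 * y k) \<le> 1/100 * y k" .
      then have "(\<bar>l\<bar> * norm (D j))\<^sup>2 \<le> (1/10)\<^sup>2"
        using y(1)[of k] by (simp add: power_mult_distrib power_divide)
      then show ?thesis by (rule power2_le_imp_le) simp
    qed
    have "\<exists>C. \<forall>k'>0. tr (euler_power (2 ^ k') (l *\<^sub>R x (N k))) \<le> E + C / 2 ^ k'"
      unfolding E_def by (rule exp_bound[OF small N(1)])
    moreover have "\<exists>C. \<forall>k'>0. tr (euler_power (2 ^ k') ((- l) *\<^sub>R x (N k))) \<le> E + C / 2 ^ k'"
      using exp_bound[of "N k" "- l" "y k"] small N(1) by (simp add: E_def)
    moreover have "1 \<le> E" using Lk by (simp add: E)
    moreover have "8 * E * exp (- (l * a k)) = f k"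
      by (simp add: E la f_def flip: exp_add)
    ultimately show ?thesis
      using exponential_weight[OF xM x(2) l a_pos, of E "N k"] by (simp add: good_def)
  qed
  then obtain W t where good: "\<And>k. k \<ge> k0 \<Longrightarrow> good k (W k) (t k)" by metis
  then have Wt: "W k \<in> endos M \<and> pos (W k) \<and> 0 < t k \<and> tr (W k) / t k \<le> f k" if "k \<ge> k0" for k
    using that unfolding good_def by blast
  \<comment> \<open>Early blocks get weight 0 and level 1: their condition holds trivially and they
    cost nothing.\<close>
  define W' where "W' k = (if k < k0 then 0 else W k)" for k
  define T where "T k = (if k < k0 then 1 else t k)" for k
  define b where "b n = (LEAST k. V n \<le> y k)" for n
  have b: "V n \<le> y (b n)" for n
  proof -
    have "\<exists>k. V n \<le> y k"
      using y_lim[of "V n"] by (auto simp: eventually_sequentially intro: less_imp_le)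
    then show ?thesis unfolding b_def by (rule LeastI_ex)
  qed
  have tr0: "tr 0 = 0" using tr_scale[OF one_mem, of 0] by simp
  have W': "W' k \<in> endos M" "pos (W' k)" "0 < T k" for k
    using Wt[of k] zero_mem by (auto simp: W'_def T_def) (simp add: pos_def star_simps)
  have W'_sum: "(\<Sum>k<R. tr (W' k) / T k) \<le> \<epsilon> / 2" for R
  proof -
    have "(\<Sum>k<R. tr (W' k) / T k) \<le> (\<Sum>k<R. if k < k0 then 0 else f k)"
      using Wt by (intro sum_mono) (auto simp: W'_def T_def tr0)
    also have "\<dots> = sum f {k0..<R}"
      by (rule sum.mono_neutral_cong_right) auto
    also have "\<dots> \<le> \<epsilon> / 2" using sum_small by (simp add: less_imp_le)
    finally show ?thesis .
  qed
  obtain e where e: "e \<in> endos M" "star e = e" "e * e = e" "tr (1 - e) \<le> \<epsilon> / 2"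
    and control: "\<And>n h. n > 0 \<Longrightarrow> inner (ap (F n (W' (b n))) (ap e h)) (ap e h) \<le> T (b n) * (norm (ap e h))\<^sup>2"
    using maximal_inequality[where W = W' and T = T and b = b and F = F and Nk = Nk, OF F Nk W' W'_sum] by blast
  have "eventually (\<lambda>n. y k0 < V n) sequentially"
    using V_lim by (simp add: filterlim_at_top_dense)
  then have "\<forall>\<^sub>F n in sequentially. \<forall>h. norm (ap (x n) (ap e h)) \<le> 2 * sqrt (V n) * sqrt (LL (V n)) * norm (ap e h)"
    using eventually_gt_at_top[of 0]
  proof eventually_elim
    case (elim n)
    define k where "k = b n"
    have "y k0 < y k" using elim(1) b[of n] by (simp add: k_def)
    then have k: "k0 \<le> k" using y_mono[of k k0] by (cases "k0 \<le> k") auto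
    note Lk = L_pos[OF k]
    have "k > 0" using k0_gt[OF k] by simp
    \<comment> \<open>Minimality of \<open>b n\<close> puts \<open>V n\<close> above the lower end
      \<open>lo k\<close> of its block, so the threshold \<open>a k\<close> is at most the one
      claimed at time \<open>n\<close>.\<close>
    then have "\<not> V n \<le> y (k - 1)"
      unfolding k_def b_def by (intro not_less_Least) simp
    moreover have "lo k = y (k - 1)" using y(3)[of "k - 1"] \<open>k > 0\<close> by (simp add: lo_def)
    ultimately have lo_V: "lo k < V n" by simp
    have "ln (lo k) \<le> ln (V n)" using lo_V y(2)[of k] by simp
    then have "L k \<le> ln (ln (V n))" unfolding L_def using Lk by simp
    then have "L k \<le> LL (V n)" using LL_ge(2) order_trans by blast
    then have "lo k * L k \<le> V n * LL (V n)"
      using lo_V Lk y(2)[of k] V0 by (intro mult_mono) auto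
    then have a_le: "a k \<le> 2 * sqrt (V n) * sqrt (LL (V n))"
      by (simp add: a_def flip: real_sqrt_mult)
    \<comment> \<open>The weight controls expectations of the terminal value \<open>x (N k)\<close>;
      by the martingale property the one at time \<open>n\<close> is \<open>x n\<close>.\<close>
    have xn: "F n (x (N k)) = x n" by (rule mart'[OF N(2)]) (simp add: k_def b)
    have "norm (ap (x n) (ap e h)) \<le> a k * norm (ap e h)" for h
    proof -
      have "inner (ap (F n (W k)) (ap e h)) (ap e h) \<le> t k * (norm (ap e h))\<^sup>2"
        using control[OF elim(2), of h] k by (simp add: W'_def T_def flip: k_def)
      then have "norm (ap (F n (x (N k))) (ap e h)) \<le> a k * norm (ap e h)"
        using good[OF k] F[of n] unfolding good_def by blast
      then show ?thesis by (simp only: xn)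
    qed
    then show ?case using a_le by (meson mult_right_mono norm_ge_zero order_trans)
  qed
  moreover have "tr (1 - e) < \<epsilon>" using e(4) \<epsilon> by simp
  ultimately show ?thesis using that e(1-3) by blast
qed

end

section \<open>Transfer to bounded linear functions and the limit superior\<close>

theorem theorem1p1:
  fixes J :: "'h::{real_inner, complete_space} op"
    and M :: "'h op set" and \<tau> :: "'h op \<Rightarrow> complex"
    and Nk :: "nat \<Rightarrow> 'h op set" and E :: "nat \<Rightarrow> 'h op \<Rightarrow> 'h op"
    and x :: "nat \<Rightarrow> 'h op" and \<alpha> :: "nat \<Rightarrow> real"
    and d :: "nat \<Rightarrow> 'h op" and s u :: "nat \<Rightarrow> real"
  assumes ncps: "nc_prob_space J M \<tau>"
    and filt: "filtration J M Nk"
    and E: "\<And>k. cond_exp M \<tau> (Nk k) (E k)"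
    and x0: "x 0 = 0"
    and x_in: "\<And>n. x n \<in> Nk n"
    and x_sa: "\<And>n. selfadj (x n)"
    and mart: "\<And>n. E n (x (Suc n)) = x n"
    and d_def: "\<And>i. i \<ge> 1 \<Longrightarrow> d i = x i - x (i - 1)"
    and s_def: "\<And>n. s n = sqrt (norm (\<Sum>i=1..n. E (i - 1) (d i o\<^sub>L d i)))"
    and u_def: "\<And>n. u n = sqrt (LL ((s n)\<^sup>2))"
    and s_inf: "filterlim (\<lambda>n. (s n)\<^sup>2) at_top sequentially"
    and \<alpha>_pos: "\<And>n. \<alpha> n > 0"
    and \<alpha>_lim: "\<alpha> \<longlonglongrightarrow> 0"
    and d_bound: "\<And>n. n \<ge> 1 \<Longrightarrow> norm (d n) \<le> \<alpha> n * s n / u n"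
  shows "\<forall>\<epsilon>>0. \<forall>\<delta>>0. \<exists>e\<in>M. projection e \<and> Re (\<tau> (id_blinfun - e)) < \<epsilon> \<and>
           limsup (\<lambda>n. ereal (norm ((1 / (s n * u n)) *\<^sub>R x n o\<^sub>L e))) \<le> ereal (2 + \<delta>)"
proof (intro allI impI)
  fix \<epsilon> \<delta> :: real assume \<epsilon>: "\<epsilon> > 0" and \<delta>: "\<delta> > 0"
  interpret nc_probability J M \<tau> by standard (rule ncps)
  have vNk: "von_neumann_algebra J (Nk n)" "Nk n \<subseteq> M" and "mono Nk" for n
    using filt by (auto simp: filtration_def)
  define F where "F n T = of_op (E n (op_of T))" for n T
  have F: "trace_cond_exp J M \<tau> (Nk n) (F n)" for n
  proof unfold_locales
    show "von_neumann_algebra J (Nk n)" "Nk n \<subseteq> M" by (rule vNk)+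
    show "F n T \<in> endos (Nk n)" if "T \<in> endos M" for T
      using E[of n] that by (simp add: cond_exp_def F_def endos_def)
    fix a T assume a: "a \<in> endos (Nk n)" and T: "T \<in> endos M"
    \<comment> \<open>The bimodule property with right factor 1, combined with trace preservation,
      gives the weak identity \<open>tr_F\<close>.\<close>
    have "id_blinfun \<in> Nk n"
      using unital_subalgebraD(1)[OF endos_subalgebra[OF vNk(1)]] by (simp add: endos_def op_of_simps)
    then have "E n (op_of a o\<^sub>L op_of T o\<^sub>L id_blinfun) = op_of a o\<^sub>L E n (op_of T) o\<^sub>L id_blinfun"
      using E[of n] a T by (simp add: cond_exp_def endos_def)
    moreover have "S o\<^sub>L id_blinfun = S" for S :: "'h op" by (rule blinfun_eqI) simp
    ultimately have "E n (op_of (a * T)) = op_of (a * F n T)" by (simp add: F_def op_of_simps)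
    moreover have "a * T \<in> endos M"
      using a T vNk(2)[of n] by (intro mult_mem) (auto simp: endos_def)
    then have "\<tau> (E n (op_of (a * T))) = \<tau> (op_of (a * T))"
      using E[of n] by (simp add: cond_exp_def endos_def)
    ultimately show "tr (a * F n T) = tr (a * T)" by (simp add: tr_def)
  qed
  define X where "X n = of_op (x n)" for n
  define V where "V n = norm (\<Sum>j<n. F j ((X (Suc j) - X j) * (X (Suc j) - X j)))" for n
  have d_op: "of_op (d (Suc j)) = X (Suc j) - X j" for j
    by (simp add: d_def X_def of_op_diff)
  have V_s: "V n = (s n)\<^sup>2" for n
  proof -
    have "norm (\<Sum>i=1..n. E (i - 1) (d i o\<^sub>L d i)) = norm (of_op (\<Sum>i=1..n. E (i - 1) (d i o\<^sub>L d i)))"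
      by (simp add: norm_endo_def)
    also have "of_op (\<Sum>i=1..n. E (i - 1) (d i o\<^sub>L d i)) = (\<Sum>j<n. of_op (E j (d (Suc j) o\<^sub>L d (Suc j))))"
      by (simp add: of_op_sum sum.atLeast1_atMost_eq)
    also have "\<dots> = (\<Sum>j<n. F j ((X (Suc j) - X j) * (X (Suc j) - X j)))"
      unfolding F_def d_op[symmetric] by (simp add: op_of_simps)
    finally show ?thesis by (simp add: s_def V_def)
  qed
  have s_V: "s n = sqrt (V n)" and u_V: "u n = sqrt (LL (V n))" for n
    using u_def[of n] by (simp_all add: V_s) (simp add: s_def)
  obtain e where e: "e \<in> endos M" "star e = e" "e * e = e" "tr (1 - e) < \<epsilon>"
    and lil: "\<forall>\<^sub>F n in sequentially. \<forall>h. norm (ap (X n) (ap e h)) \<le> 2 * sqrt (V n) * sqrt (LL (V n)) * norm (ap e h)"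
  proof (rule law_of_iterated_logarithm[where x = X and V = V, OF F \<open>mono Nk\<close> _ _ _ _ V_def _ \<alpha>_lim _ \<epsilon>])
    show "X 0 = 0" by (simp add: X_def x0 zero_endo_def)
    show "X n \<in> endos (Nk n)" for n using x_in by (simp add: X_def endos_def)
    show "star (X n) = X n" for n
      using x_sa[of n] by (simp add: X_def flip: selfadj_iff_star)
    show "F n (X (Suc n)) = X n" for n using mart by (simp add: F_def X_def)
    show "filterlim V at_top sequentially" using s_inf unfolding V_s[symmetric] .
    show "norm (X (Suc n) - X n) \<le> \<alpha> (Suc n) * sqrt (V (Suc n)) / sqrt (LL (V (Suc n)))" for n
      using d_bound[of "Suc n"] by (simp add: s_V u_V norm_endo_def flip: d_op)
  qed
  \<comment> \<open>A projection is a contraction, so the bound on the range of \<open>e\<close>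
    becomes a bound on an operator norm.\<close>
  have e_le: "norm (ap e h) \<le> norm h" for h
  proof -
    have "(norm (ap e h))\<^sup>2 = inner (ap e h) h"
      using inner_ap[of e "ap e h" h] e(2) e(3) by (metis ap_simps(6) inner_ap power2_norm_eq_inner)
    also have "\<dots> \<le> norm (ap e h) * norm h" by (rule norm_cauchy_schwarz)
    finally show ?thesis by (cases "ap e h = 0") (simp_all add: power2_eq_square)
  qed
  show "\<exists>e\<in>M. projection e \<and> Re (\<tau> (id_blinfun - e)) < \<epsilon> \<and>
           limsup (\<lambda>n. ereal (norm ((1 / (s n * u n)) *\<^sub>R x n o\<^sub>L e))) \<le> ereal (2 + \<delta>)"
  proof (intro bexI[of _ "op_of e"] conjI)
    show "op_of e \<in> M" using e(1) by (simp add: endos_def)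
    show "projection (op_of e)"
      using e(2,3) by (simp add: projection_def selfadj_iff_star flip: op_of_simps)
    show "Re (\<tau> (id_blinfun - op_of e)) < \<epsilon>" using e(4) by (simp add: tr_def op_of_simps)
    show "limsup (\<lambda>n. ereal (norm ((1 / (s n * u n)) *\<^sub>R x n o\<^sub>L op_of e))) \<le> ereal (2 + \<delta>)"
    proof (rule Limsup_bounded)
      show "\<forall>\<^sub>F n in sequentially. ereal (norm ((1 / (s n * u n)) *\<^sub>R x n o\<^sub>L op_of e)) \<le> ereal (2 + \<delta>)"
        using lil
      proof eventually_elim
        case (elim n)
        have "0 \<le> V n" by (simp add: V_def)
        then have su: "0 \<le> s n * u n" using LL_ge(1)[of "V n"] by (simp add: s_V u_V)
        have "norm ((1 / (s n * u n)) *\<^sub>R x n o\<^sub>L op_of e) \<le> 2"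
        proof (rule norm_blinfun_bound)
          fix h
          have "norm (((1 / (s n * u n)) *\<^sub>R x n o\<^sub>L op_of e) h) = 1 / (s n * u n) * norm (ap (X n) (ap e h))"
            using su by (simp add: ap_def X_def blinfun.bilinear_simps)
          also have "\<dots> \<le> 1 / (s n * u n) * (2 * (s n * u n) * norm h)"
          proof (rule mult_left_mono)
            have "norm (ap (X n) (ap e h)) \<le> 2 * (s n * u n) * norm (ap e h)"
              using elim by (simp add: s_V u_V mult.assoc)
            also have "\<dots> \<le> 2 * (s n * u n) * norm h" using su by (intro mult_left_mono e_le) simp
            finally show "norm (ap (X n) (ap e h)) \<le> 2 * (s n * u n) * norm h" .
          qed (use su in simp)
          \<comment> \<open>If \<open>s n * u n = 0\<close>, the left side is 0, since division by
            zero yields 0.\<close>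
          also have "\<dots> \<le> 2 * norm h" by simp
          finally show "norm (((1 / (s n * u n)) *\<^sub>R x n o\<^sub>L op_of e) h) \<le> 2 * norm h" .
        qed simp
        then show ?case using \<delta> by simp
      qed
    qed
  qed
qed

end
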